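(* For every integer $n \ge 0$, \[ N_2(0, 6, 9n+2) + N_2(1, 6, 9n+2) > N_2(2, 6, 9n+2) + N_2(3, 6, 9n+2) \] and \[ N_2(0, 6, 9n+5) + N_2(1, 6, 9n+5) > N_2(2, 6, 9n+5) + N_2(3, 6, 9n+5). \] Equivalently, $N_2(0,6,3n+2)+N_2(1,6,3n+2) > N_2(2,6,3n+2)+N_2(3,6,3n+2)$ holds for all integers $n\ge 0$ with $3 \nmid n+1$.
   Context: For a partition $\lambda$, let $n(\lambda)$ denote its number of parts and $l(\lambda)$ its largest part. For a partition $\lambda$ with no repeated odd parts (i.e. each odd part occurs at most once), its $M_2$ rank is $\lceil l(\lambda)/2 \rceil - n(\lambda)$. For integers $s$, $m \ge 1$ and $n \ge 0$, $N_2(s, m, n)$ denotes the number of partitions of $n$ with no repeated odd parts whose $M_2$ rank is congruent to $s$ modulo $m$. *)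

theory Defs
  imports Complex_Main "HOL-Library.Multiset" "HOL-Number_Theory.Cong"
begin

text \<open>A partition is the multiset of its (positive) parts.\<close>

definition partitions :: "nat \<Rightarrow> nat multiset set" where
  "partitions n = {p. 0 \<notin># p \<and> sum_mset p = n}"

definition num_parts :: "nat multiset \<Rightarrow> nat" where
  "num_parts p = size p"

text \<open>The empty partition has largest part \<open>0\<close>, hence \<open>M\<^sub>2\<close> rank \<open>0\<close>.\<close>

definition largest_part :: "nat multiset \<Rightarrow> nat" where
  "largest_part p = (if p = {#} then 0 else Max (set_mset p))"

definition no_repeated_odd_parts :: "nat multiset \<Rightarrow> bool" where
  "no_repeated_odd_parts p \<longleftrightarrow> (\<forall>k. odd k \<longrightarrow> count p k \<le> 1)"

definition M2_rank :: "nat multiset \<Rightarrow> int" where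
  "M2_rank p = \<lceil>real (largest_part p) / 2\<rceil> - int (num_parts p)"

definition N2 :: "int \<Rightarrow> nat \<Rightarrow> nat \<Rightarrow> nat" where
  "N2 s m n = card {p \<in> partitions n. no_repeated_odd_parts p \<and> [M2_rank p = s] (mod int m)}"

lemma finite_partitions: "finite (partitions n)"
proof -
  have "p \<in> mset ` {xs. set xs \<subseteq> {..n} \<and> length xs \<le> n}" if "p \<in> partitions n" for p
  proof -
    obtain xs where xs: "p = mset xs"
      by (metis ex_mset)
    have pos: "0 \<notin> set xs" and sum: "sum_list xs = n"
      using that xs by (auto simp: partitions_def sum_mset_sum_list)
    have "length ys \<le> sum_list ys" if "0 \<notin> set ys" for ys :: "nat list"
      using that by (induction ys) auto
    then have "length xs \<le> n"
      using pos sum by blast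
    moreover have "set xs \<subseteq> {..n}"
      using sum member_le_sum_list by fastforce
    ultimately show ?thesis
      using xs by blast
  qed
  then have "partitions n \<subseteq> mset ` {xs. set xs \<subseteq> {..n} \<and> length xs \<le> n}"
    by (rule subsetI)
  then show ?thesis
    by (rule finite_subset) (intro finite_imageI finite_lists_length_le finite_atMost)
qed

end

theory Submission
  imports Defs "HOL-Analysis.Analysis"
begin

text \<open>
  Write \<open>u\<^sub>k\<close> for the generating function of the partitions without repeated odd parts of \<open>M\<^sub>2\<close> rank
  at most \<open>k\<close>. An analogue of Dyson's adjoint gives a two-term recurrence for \<open>u\<^sub>k\<close>, hence a
  \<open>q\<close>-difference equation for the two-variable rank generating function \<open>R(z; q)\<close>. Multiplying by the
  theta function \<open>\<Sum> (-1)\<^sup>n q\<^bsup>2n\<^sup>2-2n\<^esup> z\<^bsup>-2n\<^esup>\<close> turns it into an equation that determines each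
  coefficient of the product separately. At a primitive sixth root of unity \<open>z\<close> the theta function is a series
  in \<open>q\<^sup>1\<^sup>2\<close> (up to a constant) and \<open>R(z; q)\<close> generates the differences in the theorem, so its terms with
  exponent \<open>2\<close> modulo \<open>3\<close> can be read off as an indefinite double sum over this series.

  Multiplied by \<open>\<psi>(-q\<^sup>9)\<close> the double sum telescopes: with \<open>F\<close> denoting those terms,
  \<open>q \<psi>(-q\<^sup>9) F(q)\<close> equals \<open>\<Sum>\<^sub>N q\<^bsup>3N\<^esup> \<Sum>\<^bsub>d | N\<^esub> \<chi>(d)\<close> plus a function of \<open>q\<^sup>9\<close>,
  where \<open>\<chi>\<close> is the character modulo \<open>12\<close> induced by the one modulo \<open>4\<close>. The divisor sums are
  nonnegative, and \<open>1/\<psi>(-q)\<close> is the generating function of all partitions without repeated odd parts, whose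
  coefficients are positive. Comparing coefficients of \<open>q\<^bsup>3N\<^esup>\<close> with \<open>3 \<nmid> N\<close> gives the claim.
\<close>

subsection \<open>An analogue of Dyson's adjoint for the \<open>M\<^sub>2\<close> rank\<close>

text \<open>The class 2 modulo 3 is special because \<open>rank_gf\<close> times the pentagonal
  series in \<open>q^12\<close> is a sum of two Lambert series. Their double-sum exponents are
  congruent to \<open>l\<close> and to \<open>2 l + 1\<close> modulo 3, so both are 2 exactly when
  \<open>l\<close> is 2, and \<open>l -> 3 l + 2\<close> treats both alike. The factor psi is chosen
  because summation along \<open>M = t + l\<close> leaves truncated theta series with negative
  exponents as inner sums. Times psi(-y^3), with \<open>y = q^3\<close>, each of their terms becomes
  a series whose terms depend geometrically on \<open>M\<close>, hence an explicit difference up to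
  the constant \<open>y^3\<close>. The function of \<open>q^9\<close> that remains has no evident
  sign. It is not evaluated but removed: it is invariant when \<open>q\<close> is multiplied by a
  ninth root of unity, so it contributes only to exponents divisible by 9. The identities are
  analytic, for \<open>0 < |q| < 1/2\<close>; a neighbourhood of 0 suffices to compare
  coefficients.\<close>

definition NRO :: "nat multiset set" where
  "NRO = {p. 0 \<notin># p \<and> no_repeated_odd_parts p}"

lemma M2_rank_eq: "M2_rank p = (int (largest_part p) + 1) div 2 - int (size p)"
proof -
  have "\<lceil>real n / 2\<rceil> = (int n + 1) div 2" for n :: nat
    by (simp add: ceiling_eq_iff) linarith
  then show ?thesis
    by (simp add: M2_rank_def num_parts_def)
qed

lemma half_ceil_le_iff: "(a + 1) div 2 \<le> m \<longleftrightarrow> a \<le> 2 * m" for a m :: int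
  by presburger

lemma largest_part_ge: "x \<in># p \<Longrightarrow> x \<le> largest_part p"
  by (auto simp: largest_part_def)

lemma largest_part_in: "p \<noteq> {#} \<Longrightarrow> largest_part p \<in># p"
  by (simp add: largest_part_def)

lemma largest_part_le: "(\<And>x. x \<in># p \<Longrightarrow> x \<le> m) \<Longrightarrow> largest_part p \<le> m"
  by (auto simp: largest_part_def)

text \<open>The first column of the 2-modular diagram weighs \<open>2 * size p\<close>, less 1 if a
  part 1 is present; the new part is this weight plus \<open>2 * k - 1\<close>. Its parity records
  whether a part 1 was there, which makes the map invertible.\<close>

definition new_part :: "int \<Rightarrow> nat multiset \<Rightarrow> nat" where
  "new_part k p = nat (2 * (int (size p) + k) - (if 1 \<in># p then 2 else 1))"

text \<open>
  The first column of the \<open>2\<close>-modular diagram is removed (a part \<open>1\<close> occupies a cell of weight \<open>1\<close> in it) and put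
  back as a new largest part, whose size is chosen so that \<open>rank \<le> k\<close> becomes \<open>rank \<ge> k - 1\<close>. The new part
  vanishes exactly when the result is the empty partition.
\<close>

definition dyson_adjoint :: "int \<Rightarrow> nat multiset \<Rightarrow> nat multiset" where
  "dyson_adjoint k p = image_mset (\<lambda>x. x - 2) (filter_mset (\<lambda>x. x > 2) p) +
     (if new_part k p = 0 then {#} else {#new_part k p#})"

text \<open>The inverse map: the removed part \<open>X\<close> determines the length of the old
  first column. The parts of \<open>p'\<close> account for its cells in longer rows, an even
  \<open>X\<close> for a part 1, and what remains of the length is the number of parts 2.\<close>

definition dyson_coadjoint :: "int \<Rightarrow> nat multiset \<Rightarrow> nat multiset" where
  "dyson_coadjoint k p = (let X = largest_part p; p' = p - {#X#}; e = (if even X then 1 else 0 :: nat) in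
     image_mset (\<lambda>x. x + 2) p' +
     replicate_mset (nat ((int X + 1) div 2 - k - int (size p'))) 2 + replicate_mset e 1)"

lemma filter_parts_split:
  assumes "p \<in> NRO"
  shows "p = filter_mset (\<lambda>x. x > 2) p + replicate_mset (count p 2) 2 + replicate_mset (count p 1) 1"
proof (rule multiset_eqI)
  fix x
  have "count p 0 = 0"
    using assms by (simp add: NRO_def not_in_iff)
  then show "count p x = count (filter_mset (\<lambda>x. x > 2) p + replicate_mset (count p 2) 2 + replicate_mset (count p 1) 1) x"
    by (cases "x = 0 \<or> x = 1 \<or> x = 2") (auto)
qed

lemma sum_mset_sub2:
  "sum_mset (image_mset (\<lambda>x. x - 2) (filter_mset (\<lambda>x. x > 2) p)) + 2 * size (filter_mset (\<lambda>x. x > 2) p)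
    = sum_mset (filter_mset (\<lambda>x. x > (2::nat)) p)"
  by (induction p) auto

lemma NRO_count_one: "p \<in> NRO \<Longrightarrow> count p 1 = (if 1 \<in># p then 1 else 0)"
  using odd_one[where 'a = nat] unfolding NRO_def no_repeated_odd_parts_def
  by (metis (mono_tags, lifting) count_eq_zero_iff le_antisym mem_Collect_eq not_less_eq_eq One_nat_def le_zero_eq)

lemma NRO_size: 
  assumes "p \<in> NRO"
  shows "size p = size (filter_mset (\<lambda>x. x > 2) p) + count p 2 + (if 1 \<in># p then 1 else 0)"
  by (subst filter_parts_split[OF assms]) (use NRO_count_one[OF assms] in simp)

lemma NRO_sum: 
  assumes "p \<in> NRO"
  shows "sum_mset p = sum_mset (filter_mset (\<lambda>x. x > 2) p) + 2 * count p 2 + (if 1 \<in># p then 1 else 0)"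
  by (subst filter_parts_split[OF assms]) (use NRO_count_one[OF assms] in simp)

text \<open>Truncation by \<open>nat\<close> does no harm: rank at most \<open>k\<close> bounds half
  the largest part, rounded up, by \<open>size p + k\<close>, which is therefore at least 1. The
  exception is the empty partition with \<open>k = 0\<close>, hence the exclusion of that
  pair.\<close>

lemma new_part_int:
  assumes "p \<in> NRO" "M2_rank p \<le> k" "\<not> (k = 0 \<and> p = {#})"
  shows "int (new_part k p) = 2 * (int (size p) + k) - (if 1 \<in># p then 2 else 1)"
    "x \<in># p \<Longrightarrow> x \<le> 2 * (int (size p) + k)"
proof -
  have *: "(int (largest_part p) + 1) div 2 \<le> int (size p) + k"
    using assms by (simp add: M2_rank_eq)
  show "x \<le> 2 * (int (size p) + k)" if "x \<in># p"
    using largest_part_ge[OF that] * unfolding half_ceil_le_iff by linarith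
  have "int (size p) + k \<ge> 1"
  proof (cases "p = {#}")
    case True
    then show ?thesis using assms * by (simp add: largest_part_def)
  next
    case False
    then have "largest_part p \<ge> 1"
      using largest_part_in[OF False] assms(1) unfolding NRO_def
      by (metis (mono_tags, lifting) less_one linorder_not_less mem_Collect_eq)
    then show ?thesis using * by linarith
  qed
  then show "int (new_part k p) = 2 * (int (size p) + k) - (if 1 \<in># p then 2 else 1)"
    by (simp add: new_part_def)
qed

lemma even_new_part_iff:
  assumes "p \<in> NRO" "M2_rank p \<le> k" "\<not> (k = 0 \<and> p = {#})"
  shows "even (new_part k p) \<longleftrightarrow> 1 \<in># p"
proof -
  have "even (int (new_part k p)) \<longleftrightarrow> 1 \<in># p"
    unfolding new_part_int(1)[OF assms] by (cases "1 \<in># p") simp_all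
  then show ?thesis by simp
qed

text \<open>A part of \<open>p\<close> is at most \<open>2 * (size p + k)\<close>, so after losing 2
  it does not exceed the new part. An odd new part is larger by one more, which keeps odd parts
  distinct.\<close>

lemma dyson_adjoint_parts_le:
  assumes "p \<in> NRO" "M2_rank p \<le> k" "\<not> (k = 0 \<and> p = {#})"
    and "x \<in># image_mset (\<lambda>x. x - 2) (filter_mset (\<lambda>x. x > 2) p)"
  shows "x \<le> new_part k p" "odd (new_part k p) \<Longrightarrow> x < new_part k p" "x > 0"
proof -
  obtain y where y: "y \<in># p" "y > 2" "x = y - 2"
    using assms(4) by auto
  show "x > 0" using y by simp
  show "x \<le> new_part k p" "odd (new_part k p) \<Longrightarrow> x < new_part k p"
    using new_part_int(1)[OF assms(1-3)] new_part_int(2)[OF assms(1-3) y(1)] y even_new_part_iff[OF assms(1-3)]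
    by (auto split: if_splits)
qed

lemma largest_part_dyson_adjoint:
  assumes "p \<in> NRO" "M2_rank p \<le> k" "\<not> (k = 0 \<and> p = {#})"
  shows "largest_part (dyson_adjoint k p) = new_part k p"
proof (rule antisym)
  show "largest_part (dyson_adjoint k p) \<le> new_part k p"
    using dyson_adjoint_parts_le(1)[OF assms]
    by (intro largest_part_le) (auto simp: dyson_adjoint_def split: if_splits)
  show "new_part k p \<le> largest_part (dyson_adjoint k p)"
    by (cases "new_part k p = 0") (auto simp: dyson_adjoint_def intro: largest_part_ge)
qed

lemma dyson_adjoint_minus_largest:
  assumes "p \<in> NRO" "M2_rank p \<le> k" "\<not> (k = 0 \<and> p = {#})"
  shows "dyson_adjoint k p - {#new_part k p#} = image_mset (\<lambda>x. x - 2) (filter_mset (\<lambda>x. x > 2) p)"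
proof (cases "new_part k p = 0")
  case True
  then have "0 \<notin># image_mset (\<lambda>x. x - 2) (filter_mset (\<lambda>x. x > 2) p)"
    by auto
  then show ?thesis using True by (simp add: dyson_adjoint_def diff_single_trivial)
qed (simp add: dyson_adjoint_def)

lemma dyson_adjoint_properties:
  assumes "p \<in> NRO" "M2_rank p \<le> k" "\<not> (k = 0 \<and> p = {#})"
  shows "dyson_adjoint k p \<in> NRO" "M2_rank (dyson_adjoint k p) \<ge> k - 1" "\<not> (k = 1 \<and> dyson_adjoint k p = {#})"
    "int (sum_mset (dyson_adjoint k p)) + 1 = int (sum_mset p) + 2 * k"
proof -
  let ?A = "image_mset (\<lambda>x. x - 2) (filter_mset (\<lambda>x. x > 2) p)"
  note np = new_part_int(1)[OF assms]
  have "count (dyson_adjoint k p) x \<le> 1" if "odd x" for x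
  proof -
    have "count ?A x \<le> 1"
    proof -
      have "count ?A x = count p (x + 2)"
      proof -
        have "count ?A x = sum (count (filter_mset (\<lambda>x. x > 2) p)) {y \<in> set_mset (filter_mset (\<lambda>x. x > 2) p). x = y - 2}"
          by (simp add: count_image_mset' eq_commute)
        also have "\<dots> = sum (count (filter_mset (\<lambda>x. x > 2) p)) (if x + 2 \<in># p then {x + 2} else {})"
        proof (intro sum.cong refl)
          have "2 < y \<and> x = y - 2 \<longleftrightarrow> y = x + 2" for y
            using odd_pos[OF that] by linarith
          then have "{y \<in> set_mset (filter_mset (\<lambda>x. x > 2) p). x = y - 2} = {y. y \<in># p \<and> y = x + 2}"
            by auto
          then show "{y \<in> set_mset (filter_mset (\<lambda>x. x > 2) p). x = y - 2} = (if x + 2 \<in># p then {x + 2} else {})"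
            by auto
        qed
        also have "\<dots> = count p (x + 2)"
          using that by (auto simp: not_in_iff elim: oddE)
        finally show ?thesis .
      qed
      also have "\<dots> \<le> 1"
        using assms(1) that by (simp add: NRO_def no_repeated_odd_parts_def)
      finally show ?thesis .
    qed
    moreover have "count ?A x = 0" if "x = new_part k p"
      using dyson_adjoint_parts_le(2)[OF assms] \<open>odd x\<close> that by (metis less_irrefl not_in_iff)
    ultimately show ?thesis
      by (auto simp: dyson_adjoint_def)
  qed
  then show "dyson_adjoint k p \<in> NRO"
    using dyson_adjoint_parts_le(3)[OF assms]
    by (auto simp: NRO_def no_repeated_odd_parts_def dyson_adjoint_def split: if_splits)
  show "M2_rank (dyson_adjoint k p) \<ge> k - 1"
    unfolding M2_rank_eq largest_part_dyson_adjoint[OF assms]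
    using np NRO_size[OF assms(1)] by (auto simp: dyson_adjoint_def split: if_splits)
  \<comment> \<open>An empty image needs the new part 0, which is even and so requires a part 1 in
    \<open>p\<close>; but its size formula then gives \<open>size p = 0\<close>.\<close>
  show "\<not> (k = 1 \<and> dyson_adjoint k p = {#})"
  proof
    assume *: "k = 1 \<and> dyson_adjoint k p = {#}"
    then have "new_part k p = 0"
      by (auto simp: dyson_adjoint_def split: if_splits)
    then have "size p = 0 \<and> 1 \<in># p"
      using np * by (auto split: if_splits)
    then show False by auto
  qed
  show "int (sum_mset (dyson_adjoint k p)) + 1 = int (sum_mset p) + 2 * k"
  proof -
    define a b s where "a = sum_mset ?A" "b = sum_mset (filter_mset (\<lambda>x. x > 2) p)" "s = sum_mset p"
    have "sum_mset (dyson_adjoint k p) = a + new_part k p"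
      by (simp add: dyson_adjoint_def a_b_s_def)
    moreover have "s = b + 2 * count p 2 + (if 1 \<in># p then 1 else 0)"
      using NRO_sum[OF assms(1)] by (simp add: a_b_s_def)
    moreover have "a + 2 * size (filter_mset (\<lambda>x. x > 2) p) = b"
      using sum_mset_sub2[of p] by (simp add: a_b_s_def)
    ultimately show ?thesis
      using np NRO_size[OF assms(1)] unfolding a_b_s_def(3)[symmetric] by auto
  qed
qed

lemma dyson_coadjoint_adjoint:
  assumes "p \<in> NRO" "M2_rank p \<le> k" "\<not> (k = 0 \<and> p = {#})"
  shows "dyson_coadjoint k (dyson_adjoint k p) = p"
proof -
  have "dyson_coadjoint k (dyson_adjoint k p) = image_mset (\<lambda>x. x + 2) (image_mset (\<lambda>x. x - 2) (filter_mset (\<lambda>x. x > 2) p)) +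
      replicate_mset (nat ((int (new_part k p) + 1) div 2 - k - int (size (filter_mset (\<lambda>x. x > 2) p)))) 2 + replicate_mset (count p 1) 1"
    unfolding dyson_coadjoint_def Let_def largest_part_dyson_adjoint[OF assms] dyson_adjoint_minus_largest[OF assms] NRO_count_one[OF assms(1)]
    using even_new_part_iff[OF assms] by simp
  also have "nat ((int (new_part k p) + 1) div 2 - k - int (size (filter_mset (\<lambda>x. x > 2) p))) = count p 2"
    using new_part_int(1)[OF assms] NRO_size[OF assms(1)] by (auto split: if_splits)
  also have "image_mset (\<lambda>x. x + 2) (image_mset (\<lambda>x. x - 2) (filter_mset (\<lambda>x. x > 2) p)) = filter_mset (\<lambda>x. x > 2) p"
    by (induction p) auto
  finally show ?thesis
    using filter_parts_split[OF assms(1)] by simp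
qed

lemma dyson_coadjoint_properties:
  assumes "p \<in> NRO" "M2_rank p \<ge> k - 1" "\<not> (k = 1 \<and> p = {#})"
  shows "dyson_coadjoint k p \<in> NRO" "M2_rank (dyson_coadjoint k p) \<le> k" "\<not> (k = 0 \<and> dyson_coadjoint k p = {#})"
    "dyson_adjoint k (dyson_coadjoint k p) = p"
proof -
  define X where "X = largest_part p"
  define p' where "p' = p - {#X#}"
  define c where "c = nat ((int X + 1) div 2 - k - int (size p'))"
  define r where "r = dyson_coadjoint k p"
  have r: "r = image_mset (\<lambda>x. x + 2) p' + replicate_mset c 2 + replicate_mset (if even X then 1 else 0) 1"
    by (simp add: r_def dyson_coadjoint_def X_def p'_def c_def Let_def)
  have pos: "0 \<notin># p'"
    using assms(1) by (auto simp: NRO_def p'_def dest: in_diffD)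
  have pp: "p = p' + (if X = 0 then {#} else {#X#})"
  proof (cases "p = {#}")
    case True
    then show ?thesis by (simp add: p'_def X_def largest_part_def)
  next
    case False
    then have "X \<in># p" by (simp add: X_def largest_part_in)
    moreover from this have "X \<noteq> 0" using assms(1) unfolding NRO_def by (metis (mono_tags, lifting) mem_Collect_eq)
    ultimately show ?thesis by (simp add: p'_def)
  qed
  \<comment> \<open>The column is long enough for the rows of \<open>p'\<close>. This is the rank
    bound, except for the empty partition, where the exclusion at \<open>k = 1\<close> provides
    it.\<close>
  have "int (size p') \<le> (int X + 1) div 2 - k"
  proof (cases "X = 0")
    case True
    then have "p = {#}" using assms(1) largest_part_in[of p] by (auto simp: X_def NRO_def)
    then show ?thesis using assms(2,3) True by (simp add: p'_def M2_rank_eq largest_part_def)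
  next
    case False
    then have "size p = size p' + 1" by (subst pp) simp
    then show ?thesis using assms(2) by (simp add: M2_rank_eq X_def)
  qed
  then have c: "int c = (int X + 1) div 2 - k - int (size p')"
    by (simp add: c_def)
  have size_r: "int (size r) = (int X + 1) div 2 - k + (if even X then 1 else 0)"
    using c by (simp add: r)
  have le: "x \<le> X" if "x \<in># p'" for x
    using that largest_part_ge[of x p] by (auto simp: p'_def X_def dest: in_diffD)
  have lt: "x < X" if "x \<in># p'" "odd X" for x
  proof (rule ccontr)
    assume "\<not> x < X"
    then have "x = X" using le[OF that(1)] by simp
    then have "count p X \<ge> 2"
      using that by (subst pp) (auto simp: Suc_le_eq elim: oddE)
    then show False using assms(1) that(2) by (auto simp: NRO_def no_repeated_odd_parts_def)
  qed
  have one: "1 \<in># r \<longleftrightarrow> even X"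
    by (auto simp: r)
  have filt: "filter_mset (\<lambda>x. x > 2) r = image_mset (\<lambda>x. x + 2) p'"
  proof -
    have "filter_mset (\<lambda>x. x > 2) (image_mset (\<lambda>x. x + 2) p') = image_mset (\<lambda>x. x + 2) p'"
      using pos by (auto simp: filter_mset_eq_conv intro: gr0I)
    moreover have "filter_mset (\<lambda>x. x > 2) (replicate_mset n (m::nat)) = {#}" if "m \<le> 2" for n m
      using that by (induction n) auto
    ultimately show ?thesis by (simp add: r)
  qed
  have lr: "(int (largest_part r) + 1) div 2 \<le> (int X + 1) div 2 + (if even X then 1 else 0)"
  proof -
    have "largest_part r \<le> X + (if even X then 2 else 1)"
    proof (rule largest_part_le)
      fix x assume "x \<in># r"
      then consider y where "y \<in># p'" "x = y + 2" | "x = 2" | "x = 1" "even X"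
        by (auto simp: r split: if_splits)
      then show "x \<le> X + (if even X then 2 else 1)"
      proof cases
        case 1
        then show ?thesis using le[of y] lt[of y] by (cases "even X") auto
      next
        case 2
        then show ?thesis using odd_pos[of X] by (cases "even X") auto
      qed auto
    qed
    moreover have "(a + 1) div 2 \<le> (b + 1) div 2 + (if even b then 1 else 0)"
      if "a \<le> b + (if even b then 2 else 1)" for a b :: int
      using that by presburger
    ultimately show ?thesis
      using of_nat_mono[where 'a = int] by (force split: if_splits)
  qed
  show "M2_rank (dyson_coadjoint k p) \<le> k"
    using lr size_r unfolding M2_rank_eq r_def by (auto split: if_splits)
  have np: "new_part k r = X"
  proof -
    have "2 * ((b + 1) div 2 - k + (if even b then 1 else 0) + k) - (if even b then 2 else 1) = b" for b :: int
      by presburger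
    from this[of "int X"] show ?thesis
      unfolding new_part_def size_r one by simp
  qed
  show "dyson_adjoint k (dyson_coadjoint k p) = p"
    unfolding dyson_adjoint_def r_def[symmetric] np filt
    by (subst pp) (simp add: multiset.map_comp o_def)
  show "\<not> (k = 0 \<and> dyson_coadjoint k p = {#})"
  proof
    assume *: "k = 0 \<and> dyson_coadjoint k p = {#}"
    then have "size r = 0" unfolding r_def by force
    then have "(int X + 1) div 2 + (if even X then 1 else 0) = 0" using size_r * by simp
    then show False by (cases "X = 0") (auto split: if_splits)
  qed
  have "count r x \<le> 1" if "odd x" for x
  proof -
    have "count (image_mset (\<lambda>x. x + 2) p') x \<le> 1"
    proof (cases "x \<ge> 2")
      case True
      have "count (image_mset (\<lambda>x. x + 2) M) (y + 2) = count M y" for M and y :: nat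
        by (induction M) auto
      from this[of p' "x - 2"] have "count (image_mset (\<lambda>x. x + 2) p') x = count p' (x - 2)"
        by (simp only: le_add_diff_inverse2[OF True])
      moreover have "count p' (x - 2) \<le> count p (x - 2)" by (subst pp) simp
      moreover have "count p (x - 2) \<le> 1"
        using assms(1) that True by (auto simp: NRO_def no_repeated_odd_parts_def)
      ultimately show ?thesis by linarith
    next
      case False
      then have "x \<notin># image_mset (\<lambda>x. x + 2) p'" by auto
      then have "count (image_mset (\<lambda>x. x + 2) p') x = 0" by (simp only: not_in_iff)
      then show ?thesis by linarith
    qed
    moreover have "count (image_mset (\<lambda>x. x + 2) p') 1 = 0"
      by (auto simp: count_eq_zero_iff)
    ultimately show ?thesis using that by (auto simp: r)
  qed
  then show "dyson_coadjoint k p \<in> NRO"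
    unfolding r_def[symmetric] by (auto simp: NRO_def no_repeated_odd_parts_def r)
qed

lemma bij_betw_dyson_adjoint:
  "bij_betw (dyson_adjoint k) {p \<in> NRO. M2_rank p \<le> k \<and> \<not> (k = 0 \<and> p = {#})}
     {p \<in> NRO. M2_rank p \<ge> k - 1 \<and> \<not> (k = 1 \<and> p = {#})}"
proof (rule bij_betw_byWitness[where f' = "dyson_coadjoint k"])
  show "\<forall>p\<in>{p \<in> NRO. M2_rank p \<le> k \<and> \<not> (k = 0 \<and> p = {#})}. dyson_coadjoint k (dyson_adjoint k p) = p"
    using dyson_coadjoint_adjoint by blast
  show "\<forall>p\<in>{p \<in> NRO. M2_rank p \<ge> k - 1 \<and> \<not> (k = 1 \<and> p = {#})}. dyson_adjoint k (dyson_coadjoint k p) = p"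
    using dyson_coadjoint_properties(4) by blast
  show "dyson_adjoint k ` {p \<in> NRO. M2_rank p \<le> k \<and> \<not> (k = 0 \<and> p = {#})} \<subseteq> {p \<in> NRO. M2_rank p \<ge> k - 1 \<and> \<not> (k = 1 \<and> p = {#})}"
    using dyson_adjoint_properties(1-3) by blast
  show "dyson_coadjoint k ` {p \<in> NRO. M2_rank p \<ge> k - 1 \<and> \<not> (k = 1 \<and> p = {#})} \<subseteq> {p \<in> NRO. M2_rank p \<le> k \<and> \<not> (k = 0 \<and> p = {#})}"
    using dyson_coadjoint_properties(1-3) by blast
qed

subsection \<open>Sums over the integers\<close>

lemma summable_geometric_abs_int:
  fixes r :: real
  assumes "0 \<le> r" "r < 1"
  shows "(\<lambda>n::int. r ^ nat \<bar>n\<bar>) summable_on UNIV"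
proof -
  have nat: "(\<lambda>n::nat. r ^ n) summable_on UNIV"
    using assms by (intro summable_nonneg_imp_summable_on) (auto intro: summable_geometric)
  have "(\<lambda>n::int. r ^ nat \<bar>n\<bar>) summable_on {0..}"
    by (rule summable_on_reindex_bij_witness[of _ int nat UNIV "\<lambda>n. r ^ n", THEN iffD2]) (use nat in auto)
  moreover have "(\<lambda>n::int. r ^ nat \<bar>n\<bar>) summable_on {..0}"
    by (rule summable_on_reindex_bij_witness[of _ "\<lambda>n. - int n" "\<lambda>n. nat (- n)" UNIV "\<lambda>n. r ^ n", THEN iffD2])
      (use nat in auto)
  ultimately have "(\<lambda>n::int. r ^ nat \<bar>n\<bar>) summable_on ({0..} \<union> {..0})"
    by (rule summable_on_union)
  also have "{0..} \<union> {..0::int} = UNIV" by auto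
  finally show ?thesis .
qed

lemma summable_on_complex_comparison:
  fixes f :: "'a \<Rightarrow> complex"
  assumes "g summable_on A" "\<And>x. x \<in> A \<Longrightarrow> norm (f x) \<le> g x"
  shows "f summable_on A"
  using Infinite_Sum.abs_summable_on_comparison_test'[OF assms] abs_summable_summable by blast

lemma summable_on_product_mult:
  fixes f :: "'a \<Rightarrow> real" and g :: "'b \<Rightarrow> real"
  assumes "f summable_on A" "g summable_on B" "\<And>x. x \<in> A \<Longrightarrow> f x \<ge> 0" "\<And>x. x \<in> B \<Longrightarrow> g x \<ge> 0"
  shows "(\<lambda>(x, y). f x * g y) summable_on A \<times> B"
proof -
  have "(\<lambda>z. norm (case z of (x, y) \<Rightarrow> f x * g y)) summable_on A \<times> B"
  proof (subst Infinite_Sum.abs_summable_on_Sigma_iff, intro conjI ballI, goal_cases)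
    case (1 x)
    have "(\<lambda>y. f x * g y) summable_on B"
      by (rule summable_on_cmult_right) fact
    then have "(\<lambda>y. norm (f x * g y)) summable_on B"
      by (subst (asm) summable_on_iff_abs_summable_on_real)
    then show ?case by simp
  next
    case 2
    have "(\<lambda>x. f x * infsum g B) summable_on A"
      by (rule summable_on_cmult_left) fact
    then have "(\<lambda>x. norm (f x * infsum g B)) summable_on A"
      by (subst (asm) summable_on_iff_abs_summable_on_real)
    moreover have "norm (\<Sum>\<^sub>\<infinity>y\<in>B. norm (f x * g y)) = norm (f x * infsum g B)" if "x \<in> A" for x
    proof -
      have "(\<Sum>\<^sub>\<infinity>y\<in>B. norm (f x * g y)) = (\<Sum>\<^sub>\<infinity>y\<in>B. f x * g y)"
        using assms(3,4) that by (intro infsum_cong) (auto simp: abs_mult)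
      then show ?thesis by (simp add: infsum_cmult_right')
    qed
    ultimately have "(\<lambda>x. norm (\<Sum>\<^sub>\<infinity>y\<in>B. norm (f x * g y))) summable_on A"
      by (subst summable_on_cong[where g = "\<lambda>x. norm (f x * infsum g B)"])
    then show ?case by simp
  qed
  then show ?thesis
    by (rule abs_summable_summable)
qed

lemma
  fixes f :: "'a \<Rightarrow> complex" and g :: "'b \<Rightarrow> complex"
  assumes "f summable_on A" "g summable_on B"
  shows summable_on_complex_product: "(\<lambda>(x, y). f x * g y) summable_on A \<times> B"
    and infsum_complex_product: "infsum (\<lambda>(x, y). f x * g y) (A \<times> B) = infsum f A * infsum g B"
proof -
  have "(\<lambda>(x, y). norm (f x) * norm (g y)) summable_on A \<times> B"
    using assms unfolding summable_on_iff_abs_summable_on_complex[of f] summable_on_iff_abs_summable_on_complex[of g]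
    by (intro summable_on_product_mult) auto
  then show *: "(\<lambda>(x, y). f x * g y) summable_on A \<times> B"
    by (rule summable_on_complex_comparison) (auto simp: norm_mult)
  show "infsum (\<lambda>(x, y). f x * g y) (A \<times> B) = infsum f A * infsum g B"
    by (subst infsum_Sigma'_banach[OF *, symmetric]) (simp add: infsum_cmult_right' infsum_cmult_left')
qed

section \<open>Convergence of series with quadratic exponents\<close>

lemma norm_powi_le:
  fixes q :: complex
  assumes "q \<noteq> 0" "norm q < 1" "\<bar>n\<bar> - c \<le> e"
  shows "norm (q powi e) \<le> norm q powi (- c) * norm q ^ nat \<bar>n\<bar>"
proof -
  have "norm (q powi e) = norm q powi e"
    by (simp add: norm_power_int)
  also have "\<dots> \<le> norm q powi (- c + \<bar>n\<bar>)"
    using assms by (intro power_int_decreasing) auto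
  also have "\<dots> = norm q powi (- c) * norm q ^ nat \<bar>n\<bar>"
    using assms by (subst power_int_add) (auto simp: power_int_nonneg_exp)
  finally show ?thesis .
qed

lemma summable_powi:
  fixes q :: complex
  assumes q: "q \<noteq> 0" "norm q < 1" and e: "\<And>n. n \<in> A \<Longrightarrow> \<bar>n\<bar> - c \<le> e n" and b: "\<And>n. n \<in> A \<Longrightarrow> norm (b n) \<le> B"
  shows "(\<lambda>n::int. b n * q powi (e n)) summable_on A"
proof (rule summable_on_complex_comparison)
  have "(\<lambda>n::int. \<bar>B\<bar> * norm q powi (- c) * norm q ^ nat \<bar>n\<bar>) summable_on UNIV"
    using q by (intro summable_on_cmult_right summable_geometric_abs_int) auto
  then show "(\<lambda>n::int. \<bar>B\<bar> * norm q powi (- c) * norm q ^ nat \<bar>n\<bar>) summable_on A"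
    by (rule summable_on_subset) auto
  fix n assume n: "n \<in> A"
  show "norm (b n * q powi (e n)) \<le> \<bar>B\<bar> * norm q powi (- c) * norm q ^ nat \<bar>n\<bar>"
    unfolding norm_mult mult.assoc
    using norm_powi_le[OF q e[OF n]] b[OF n] by (intro mult_mono) auto
qed

lemma summable_powi2:
  fixes q :: complex
  assumes q: "q \<noteq> 0" "norm q < 1" and e: "\<And>m n. (m, n) \<in> A \<Longrightarrow> \<bar>m\<bar> + \<bar>n\<bar> - c \<le> e m n"
    and b: "\<And>m n. (m, n) \<in> A \<Longrightarrow> norm (b m n) \<le> B"
  shows "(\<lambda>(m::int, n::int). b m n * q powi (e m n)) summable_on A"
proof (rule summable_on_complex_comparison)
  have "(\<lambda>(m::int, n::int). norm q ^ nat \<bar>m\<bar> * norm q ^ nat \<bar>n\<bar>) summable_on UNIV \<times> UNIV"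
    using q by (intro summable_on_product_mult summable_geometric_abs_int) auto
  then have "(\<lambda>x. \<bar>B\<bar> * norm q powi (- c) * (case x of (m::int, n::int) \<Rightarrow> norm q ^ nat \<bar>m\<bar> * norm q ^ nat \<bar>n\<bar>)) summable_on UNIV"
    by (intro summable_on_cmult_right) simp
  then show "(\<lambda>x. \<bar>B\<bar> * norm q powi (- c) * (case x of (m::int, n::int) \<Rightarrow> norm q ^ nat \<bar>m\<bar> * norm q ^ nat \<bar>n\<bar>)) summable_on A"
    by (rule summable_on_subset) auto
  fix x assume "x \<in> A"
  then obtain m n where x: "x = (m, n)" "(m, n) \<in> A" by (cases x) auto
  have "norm (q powi (e m n)) \<le> norm q powi (- c) * norm q ^ nat \<bar>\<bar>m\<bar> + \<bar>n\<bar>\<bar>"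
    using e[OF x(2)] by (intro norm_powi_le[OF q]) auto
  also have "\<dots> = norm q powi (- c) * (norm q ^ nat \<bar>m\<bar> * norm q ^ nat \<bar>n\<bar>)"
    by (simp add: nat_add_distrib power_add)
  finally have "norm (b m n) * norm (q powi (e m n)) \<le> \<bar>B\<bar> * (norm q powi (- c) * (norm q ^ nat \<bar>m\<bar> * norm q ^ nat \<bar>n\<bar>))"
    using b[OF x(2)] by (intro mult_mono) auto
  then show "norm (case x of (m, n) \<Rightarrow> b m n * q powi (e m n)) \<le>
    \<bar>B\<bar> * norm q powi (- c) * (case x of (m::int, n::int) \<Rightarrow> norm q ^ nat \<bar>m\<bar> * norm q ^ nat \<bar>n\<bar>)"
    by (simp add: x(1) norm_mult mult.assoc)
qed

lemma infsum_int_shift: "(\<Sum>\<^sub>\<infinity>n::int. f (n + a)) = (\<Sum>\<^sub>\<infinity>n. f n)"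
  by (rule infsum_reindex_bij_witness[of _ "\<lambda>n. n - a" "\<lambda>n. n + a"]) auto

lemma infsum_int_minus: "(\<Sum>\<^sub>\<infinity>n::int. f (- n)) = (\<Sum>\<^sub>\<infinity>n. f n)"
  by (rule infsum_reindex_bij_witness[of _ uminus uminus]) auto

text \<open>With \<open>B = |b| + 1\<close> this comes down to \<open>B |n| <= n^2 + B^2\<close>. It
  lets every theta series be dominated by a geometric series in \<open>|n|\<close>.\<close>

lemma int_quadratic_ge:
  fixes a b d n :: int
  assumes "a \<ge> 1"
  shows "\<bar>n\<bar> - ((\<bar>b\<bar> + 1)\<^sup>2 + \<bar>d\<bar>) \<le> a * n\<^sup>2 + b * n + d"
proof -
  have "n\<^sup>2 \<le> a * n\<^sup>2"
    using assms by (simp add: mult_le_cancel_right1)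
  moreover have "- (\<bar>b\<bar> * \<bar>n\<bar>) \<le> b * n"
    by (metis abs_ge_minus_self abs_mult minus_le_iff)
  moreover have "0 \<le> (\<bar>n\<bar> - (\<bar>b\<bar> + 1))\<^sup>2 + \<bar>n\<bar> * (\<bar>b\<bar> + 1)"
    by simp
  then have "(\<bar>b\<bar> + 1) * \<bar>n\<bar> \<le> n\<^sup>2 + (\<bar>b\<bar> + 1)\<^sup>2"
    by (simp add: power2_eq_square algebra_simps)
  ultimately show ?thesis
    by (simp add: algebra_simps)
qed

lemma summable_theta:
  fixes q :: complex
  assumes "q \<noteq> 0" "norm q < 1" "a \<ge> 1" "\<And>n. norm (c n) \<le> B"
  shows "(\<lambda>n::int. c n * q powi (a * n\<^sup>2 + b * n + d)) summable_on A"
  using assms int_quadratic_ge by (intro summable_powi) auto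

section \<open>Residue classes and reflections of the summation index\<close>

lemma infsum_int_mod3:
  fixes f :: "int \<Rightarrow> complex"
  assumes "f summable_on UNIV"
  shows "infsum f UNIV = (\<Sum>\<^sub>\<infinity>t. f (3 * t)) + (\<Sum>\<^sub>\<infinity>t. f (3 * t + 1)) + (\<Sum>\<^sub>\<infinity>t. f (3 * t + 2))"
proof -
  define S where "S j = {n::int. n mod 3 = j}" for j
  have sm: "f summable_on S j" for j
    using assms by (rule summable_on_subset) auto
  have U: "UNIV = (S 0 \<union> S 1) \<union> S 2" by (auto simp: S_def)
  have "infsum f UNIV = infsum f (S 0) + infsum f (S 1) + infsum f (S 2)"
  proof -
    have "infsum f ((S 0 \<union> S 1) \<union> S 2) = infsum f (S 0 \<union> S 1) + infsum f (S 2)"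
      by (intro infsum_Un_disjoint summable_on_union sm) (auto simp: S_def)
    also have "infsum f (S 0 \<union> S 1) = infsum f (S 0) + infsum f (S 1)"
      by (intro infsum_Un_disjoint sm) (auto simp: S_def)
    finally show ?thesis unfolding U .
  qed
  moreover have "infsum f (S j) = (\<Sum>\<^sub>\<infinity>t. f (3 * t + j))" if "0 \<le> j" "j < 3" for j
    using that by (intro infsum_reindex_bij_witness[of _ "\<lambda>t. 3 * t + j" "\<lambda>n. n div 3"]) (auto simp: S_def)
  ultimately show ?thesis by simp
qed

lemma has_sum_int_parity:
  fixes f :: "int \<Rightarrow> complex"
  assumes "(\<lambda>t. f (2 * t)) summable_on UNIV" "(\<lambda>t. f (2 * t + 1)) summable_on UNIV"
  shows "(f has_sum (\<Sum>\<^sub>\<infinity>t. f (2 * t)) + (\<Sum>\<^sub>\<infinity>t. f (2 * t + 1))) UNIV"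
proof -
  have "(f has_sum (\<Sum>\<^sub>\<infinity>t. f (2 * t))) {n. even n}"
    by (subst has_sum_reindex_bij_witness[of _ "\<lambda>t. 2 * t" "\<lambda>n. n div 2" UNIV "\<lambda>t. f (2 * t)" _ _ "\<Sum>\<^sub>\<infinity>t. f (2 * t)"])
      (use assms in auto)
  moreover have "(f has_sum (\<Sum>\<^sub>\<infinity>t. f (2 * t + 1))) {n. odd n}"
    by (subst has_sum_reindex_bij_witness[of _ "\<lambda>t. 2 * t + 1" "\<lambda>n. n div 2" UNIV "\<lambda>t. f (2 * t + 1)" _ _ "\<Sum>\<^sub>\<infinity>t. f (2 * t + 1)"])
      (use assms in auto)
  moreover have "UNIV = {n::int. even n} \<union> {n. odd n}" by auto
  ultimately show ?thesis
    using has_sum_Un_disjoint by (metis (mono_tags, lifting) disjoint_iff mem_Collect_eq)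
qed

lemma infsum_antisym_zero:
  fixes f :: "int \<Rightarrow> complex"
  assumes "\<And>n. f (a - n) = - f n"
  shows "infsum f UNIV = 0"
proof -
  have "infsum f UNIV = (\<Sum>\<^sub>\<infinity>n. f (a - n))"
    by (rule infsum_reindex_bij_witness[of _ "\<lambda>n. a - n" "\<lambda>n. a - n"]) auto
  also have "\<dots> = - infsum f UNIV"
    by (simp add: assms infsum_uminus)
  finally show ?thesis by simp
qed

section \<open>Regrouping by exponent and comparison of power series coefficients\<close>

lemma has_sum_fibres:
  fixes f :: "'a \<Rightarrow> complex" and e :: "'a \<Rightarrow> 'b"
  assumes "f summable_on A"
  shows "((\<lambda>k. infsum f {i \<in> A. e i = k}) has_sum infsum f A) UNIV"
proof -
  have bij: "bij_betw snd (SIGMA k:UNIV. {i \<in> A. e i = k}) A"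
    by (rule bij_betw_byWitness[where f' = "\<lambda>i. (e i, i)"]) auto
  have sm: "(\<lambda>(k, i). f i) summable_on (SIGMA k:UNIV. {i \<in> A. e i = k})"
    using summable_on_reindex_bij_betw[OF bij, of f] assms by (simp add: case_prod_unfold)
  have "infsum f A = infsum (\<lambda>(k, i). f i) (SIGMA k:UNIV. {i \<in> A. e i = k})"
    using infsum_reindex_bij_betw[OF bij, of f] by (simp add: case_prod_unfold)
  also have "\<dots> = (\<Sum>\<^sub>\<infinity>k. infsum f {i \<in> A. e i = k})"
    by (rule infsum_Sigma'_banach[OF sm, symmetric])
  finally have "infsum f A = (\<Sum>\<^sub>\<infinity>k. infsum f {i \<in> A. e i = k})" .
  moreover have "(\<lambda>k. infsum f {i \<in> A. e i = k}) summable_on UNIV"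
    using summable_on_Sigma_banach[OF sm] .
  ultimately show ?thesis
    by (simp add: has_sum_infsum)
qed

lemma has_sum_power_fibres:
  fixes s :: "'a \<Rightarrow> complex" and e :: "'a \<Rightarrow> nat"
  assumes "(\<lambda>i. s i * z ^ e i) summable_on A"
  shows "((\<lambda>n. infsum s {i \<in> A. e i = n} * z ^ n) has_sum infsum (\<lambda>i. s i * z ^ e i) A) UNIV"
proof -
  have "infsum (\<lambda>i. s i * z ^ e i) {i \<in> A. e i = n} = infsum s {i \<in> A. e i = n} * z ^ n" for n
  proof -
    have "infsum (\<lambda>i. s i * z ^ e i) {i \<in> A. e i = n} = infsum (\<lambda>i. s i * z ^ n) {i \<in> A. e i = n}"
      by (intro infsum_cong) auto
    then show ?thesis by (simp add: infsum_cmult_left')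
  qed
  then show ?thesis
    using has_sum_fibres[OF assms, of e] by simp
qed

text \<open>Rotation turns the coefficients into \<open>c n * w ^ n\<close>, and uniqueness of power
  series gives \<open>c n = c n * w ^ n\<close>. The point 0 is treated apart because the identities
  for \<open>G\<close> involve negative powers; there both series reduce to their constant
  terms.\<close>

lemma power_series_rotation_coeff:
  fixes c :: "nat \<Rightarrow> complex"
  assumes r: "r > 0" and sums: "\<And>z. z \<noteq> 0 \<Longrightarrow> norm z < r \<Longrightarrow> (\<lambda>n. c n * z ^ n) sums G z"
    and inv: "\<And>z. z \<noteq> 0 \<Longrightarrow> norm z < r \<Longrightarrow> G (w * z) = G z"
    and w: "norm w = 1" "w ^ n \<noteq> 1"
  shows "c n = 0"
proof -
  define f where "f = Abs_fps c"
  define g where "g = Abs_fps (\<lambda>n. c n * w ^ n)"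
  have "w \<noteq> 0" using w by auto
  then have sums': "(\<lambda>n. c n * w ^ n * z ^ n) sums G (w * z)" if "z \<noteq> 0" "norm z < r" for z
    using sums[of "w * z"] that w by (auto simp: norm_mult power_mult_distrib mult.assoc)
  have rad: "fps_conv_radius h > 0" if "\<And>z. z \<noteq> 0 \<Longrightarrow> norm z < r \<Longrightarrow> summable (\<lambda>n. fps_nth h n * z ^ n)" for h :: "complex fps"
  proof -
    have "of_real (r / 2) \<noteq> (0 :: complex)" "norm (of_real (r / 2) :: complex) < r" using r by simp_all
    from that[OF this] have "conv_radius (fps_nth h) \<ge> norm (of_real (r / 2) :: complex)"
      by (rule conv_radius_geI)
    moreover have "ereal (norm (of_real (r / 2) :: complex)) > 0" using r by simp
    ultimately show ?thesis unfolding fps_conv_radius_def by order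
  qed
  have "f = g"
  proof (rule eval_fps_eqD)
    show "fps_conv_radius f > 0" "fps_conv_radius g > 0"
      using sums sums' by (auto intro!: rad simp: f_def g_def sums_iff)
    have "eval_fps f z = eval_fps g z" if "norm z < r" for z
    proof (cases "z = 0")
      case False
      then show ?thesis
        using sums[OF False that] sums'[OF False that] inv[OF False that] by (simp add: eval_fps_def f_def g_def sums_iff)
    qed (simp add: f_def g_def eval_fps_at_0)
    then show "\<forall>\<^sub>F z in nhds 0. eval_fps f z = eval_fps g z"
      unfolding eventually_nhds_metric using r by (auto simp: dist_norm)
  qed
  then have "c n = c n * w ^ n"
    by (metis f_def g_def fps_nth_Abs_fps)
  then show ?thesis using w by auto
qed

subsection \<open>Generating functions by rank\<close>

text \<open>For \<open>n > 0\<close>, removing the first part \<open>n - m\<close> leaves a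
  composition of some \<open>m < n\<close>, and the bounds \<open>2 ^ m\<close> add up to
  \<open>2 ^ n - 1\<close>. Partitions inherit the bound, and with it comes the radius 1/2 of the
  later identities.\<close>

lemma card_compositions_le:
  "finite {xs. 0 \<notin> set xs \<and> sum_list xs = n} \<and> card {xs :: nat list. 0 \<notin> set xs \<and> sum_list xs = n} \<le> 2 ^ n"
proof (induction n rule: less_induct)
  case (less n)
  define C where "C m = {xs :: nat list. 0 \<notin> set xs \<and> sum_list xs = m}" for m
  show ?case
  proof (cases "n = 0")
    case True
    have "C 0 = {[]}"
    proof -
      have "xs = []" if "0 \<notin> set xs" "sum_list xs = 0" for xs :: "nat list"
        using that by (cases xs) auto
      then show ?thesis by (auto simp: C_def)
    qed
    then show ?thesis using True by (simp add: C_def)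
  next
    case False
    have sub: "C n \<subseteq> (\<Union>m<n. (#) (n - m) ` C m)"
    proof
      fix xs assume xs: "xs \<in> C n"
      then obtain x ys where "xs = x # ys" using False by (cases xs) (auto simp: C_def)
      then show "xs \<in> (\<Union>m<n. (#) (n - m) ` C m)"
        using xs by (auto simp: C_def intro!: bexI[of _ "sum_list ys"])
    qed
    have fin: "finite (\<Union>m<n. (#) (n - m) ` C m)"
      using less.IH by (auto simp: C_def)
    have "card (C n) \<le> card (\<Union>m<n. (#) (n - m) ` C m)"
      by (rule card_mono[OF fin sub])
    also have "\<dots> \<le> (\<Sum>m<n. card ((#) (n - m) ` C m))"
      by (rule card_UN_le) simp
    also have "\<dots> \<le> (\<Sum>m<n. 2 ^ m)"
      using less.IH by (intro sum_mono) (auto simp: C_def card_image)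
    also have "\<dots> \<le> 2 ^ n"
      by (simp add: lessThan_atLeast0 sum_power2)
    finally show ?thesis
      using finite_subset[OF sub fin] by (simp add: C_def)
  qed
qed

lemma card_partitions_le: "card (partitions n) \<le> 2 ^ n"
proof -
  have "partitions n \<subseteq> mset ` {xs. 0 \<notin> set xs \<and> sum_list xs = n}"
  proof
    fix p assume p: "p \<in> partitions n"
    obtain xs where "p = mset xs" by (metis ex_mset)
    then show "p \<in> mset ` {xs. 0 \<notin> set xs \<and> sum_list xs = n}"
      using p by (auto simp: partitions_def sum_mset_sum_list)
  qed
  then have "card (partitions n) \<le> card {xs :: nat list. 0 \<notin> set xs \<and> sum_list xs = n}"
    using card_compositions_le by (meson card_image_le card_mono finite_imageI le_trans)
  then show ?thesis using card_compositions_le le_trans by blast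
qed

lemma summable_partitions_real:
  fixes r :: real
  assumes "0 \<le> r" "r < 1 / 2"
  shows "(\<lambda>p. r ^ sum_mset p) summable_on {p. 0 \<notin># p}"
proof (rule nonneg_bdd_above_summable_on)
  show "bdd_above (sum (\<lambda>p. r ^ sum_mset p) ` {F. F \<subseteq> {p. 0 \<notin># p} \<and> finite F})"
  proof (rule bdd_aboveI2)
    fix F assume "F \<in> {F :: nat multiset set. F \<subseteq> {p. 0 \<notin># p} \<and> finite F}"
    then have F: "F \<subseteq> {p. 0 \<notin># p}" "finite F" by auto
    define N where "N = Suc (Max (sum_mset ` F))"
    have "F \<subseteq> (\<Union>n<N. partitions n)"
    proof
      fix p assume "p \<in> F"
      then have "sum_mset p < N" unfolding N_def using F by (simp add: le_imp_less_Suc)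
      then show "p \<in> (\<Union>n<N. partitions n)" using F \<open>p \<in> F\<close> by (auto simp: partitions_def)
    qed
    then have "(\<Sum>p\<in>F. r ^ sum_mset p) \<le> (\<Sum>p\<in>(\<Union>n<N. partitions n). r ^ sum_mset p)"
      using assms by (intro sum_mono2) (auto simp: finite_partitions)
    also have "\<dots> = (\<Sum>n<N. \<Sum>p\<in>partitions n. r ^ sum_mset p)"
      by (intro sum.UNION_disjoint) (auto simp: finite_partitions, auto simp: partitions_def)
    also have "\<dots> = (\<Sum>n<N. card (partitions n) * r ^ n)"
      by (intro sum.cong) (auto simp: partitions_def)
    also have "\<dots> \<le> (\<Sum>n<N. 2 ^ n * r ^ n)"
    proof (intro sum_mono mult_right_mono)
      fix n
      have "real (card (partitions n)) \<le> real (2 ^ n)"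
        using card_partitions_le of_nat_mono by blast
      then show "real (card (partitions n)) \<le> 2 ^ n" by simp
    qed (use assms in auto)
    also have "\<dots> = (\<Sum>n<N. (2 * r) ^ n)"
      by (simp add: power_mult_distrib)
    also have "\<dots> \<le> (\<Sum>n. (2 * r) ^ n)"
      using assms by (intro sum_le_suminf summable_geometric) auto
    finally show "(\<Sum>p\<in>F. r ^ sum_mset p) \<le> (\<Sum>n. (2 * r) ^ n)" .
  qed
qed (use assms in auto)

lemma summable_NRO:
  fixes q :: complex
  assumes "norm q < 1 / 2" "A \<subseteq> NRO" "\<And>p. norm (c p) \<le> B"
  shows "(\<lambda>p. c p * q ^ sum_mset p) summable_on A"
proof (rule summable_on_complex_comparison)
  have "(\<lambda>p. \<bar>B\<bar> * norm q ^ sum_mset p) summable_on {p. 0 \<notin># p}"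
    using assms(1) by (intro summable_on_cmult_right summable_partitions_real) auto
  then show "(\<lambda>p. \<bar>B\<bar> * norm q ^ sum_mset p) summable_on A"
    by (rule summable_on_subset) (use assms(2) in \<open>auto simp: NRO_def\<close>)
  show "norm (c p * q ^ sum_mset p) \<le> \<bar>B\<bar> * norm q ^ sum_mset p" for p
    using order.trans[OF assms(3)[of p] abs_ge_self] by (simp add: norm_mult norm_power mult_right_mono)
qed

lemma summable_NRO_power:
  fixes q :: complex
  assumes "norm q < 1 / 2" "A \<subseteq> NRO"
  shows "(\<lambda>p. q ^ sum_mset p) summable_on A"
  using summable_NRO[OF assms, of "\<lambda>_. 1" 1] by simp

section \<open>Rank-bounded generating functions and their recurrence\<close>

definition gf :: "complex \<Rightarrow> complex" where
  "gf q = (\<Sum>\<^sub>\<infinity>p\<in>NRO. q ^ sum_mset p)"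

definition gf_le :: "complex \<Rightarrow> int \<Rightarrow> complex" where
  "gf_le q k = (\<Sum>\<^sub>\<infinity>p\<in>{p \<in> NRO. M2_rank p \<le> k}. q ^ sum_mset p)"

lemma gf_le_bounded:
  assumes "norm q < 1 / 2"
  shows "\<exists>U. \<forall>k. norm (gf_le q k) \<le> U"
proof (intro exI allI)
  fix k
  have sm: "(\<lambda>p. norm (q ^ sum_mset p)) summable_on A" if "A \<subseteq> NRO" for A
    using summable_NRO_power[OF assms that] unfolding summable_on_iff_abs_summable_on_complex .
  have "norm (gf_le q k) \<le> (\<Sum>\<^sub>\<infinity>p\<in>{p \<in> NRO. M2_rank p \<le> k}. norm (q ^ sum_mset p))"
    unfolding gf_le_def by (intro norm_infsum_bound sm) auto
  also have "\<dots> \<le> (\<Sum>\<^sub>\<infinity>p\<in>NRO. norm (q ^ sum_mset p))"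
    by (intro infsum_mono2 sm) auto
  finally show "norm (gf_le q k) \<le> (\<Sum>\<^sub>\<infinity>p\<in>NRO. norm (q ^ sum_mset p))" .
qed

lemma empty_NRO [simp]: "{#} \<in> NRO"
  by (simp add: NRO_def no_repeated_odd_parts_def)

lemma M2_rank_empty [simp]: "M2_rank {#} = 0"
  by (simp add: M2_rank_eq largest_part_def)

text \<open>\<open>dyson_adjoint k\<close> carries rank at most \<open>k\<close> to rank at least
  \<open>k - 1\<close> and adds \<open>2 * k - 1\<close> to the sum of the parts; the partitions of
  rank at least \<open>k - 1\<close> are those that \<open>gf_le q (k - 2)\<close> omits. The
  indicator terms restore the empty partition, excluded from the source at \<open>k = 0\<close> and
  from the target at \<open>k = 1\<close>.\<close>

lemma gf_le_recurrence:
  assumes q: "q \<noteq> 0" "norm q < 1 / 2"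
  shows "q * gf_le q (k - 2) + q powi (2 * k) * gf_le q k
    = q * gf q + ((if k = 0 then 1 else 0) - (if k = 1 then q else 0))"
proof -
  define A where "A = {p \<in> NRO. M2_rank p \<le> k \<and> \<not> (k = 0 \<and> p = {#})}"
  define B where "B = {p \<in> NRO. M2_rank p \<ge> k - 1 \<and> \<not> (k = 1 \<and> p = {#})}"
  let ?f = "\<lambda>p. q ^ sum_mset p"
  have smA: "?f summable_on A" and smB: "?f summable_on B"
    by (intro summable_NRO_power q; force simp: A_def B_def)+
  have "q powi (2 * k) * infsum ?f A = (\<Sum>\<^sub>\<infinity>p\<in>A. q powi (2 * k) * q ^ sum_mset p)"
    by (simp add: infsum_cmult_right')
  also have "\<dots> = (\<Sum>\<^sub>\<infinity>p\<in>A. q * q ^ sum_mset (dyson_adjoint k p))"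
  proof (intro infsum_cong)
    fix p assume "p \<in> A"
    then have "int (sum_mset (dyson_adjoint k p)) + 1 = int (sum_mset p) + 2 * k"
      using dyson_adjoint_properties(4) by (auto simp: A_def)
    moreover have "q powi (2 * k) * q ^ b = q * q ^ a" if "int a + 1 = int b + 2 * k" for a b
    proof -
      have "q powi (int a + 1) = q powi (int b + 2 * k)" using that by simp
      then show ?thesis using q by (simp add: power_int_add mult.commute)
    qed
    ultimately show "q powi (2 * k) * q ^ sum_mset p = q * q ^ sum_mset (dyson_adjoint k p)"
      by blast
  qed
  also have "\<dots> = (\<Sum>\<^sub>\<infinity>p\<in>B. q * q ^ sum_mset p)"
    using infsum_reindex_bij_betw[OF bij_betw_dyson_adjoint[of k], of "\<lambda>p. q * q ^ sum_mset p"]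
    by (simp add: A_def B_def)
  also have "\<dots> = q * infsum ?f B"
    by (simp add: infsum_cmult_right')
  finally have AB: "q powi (2 * k) * infsum ?f A = q * infsum ?f B" .
  have A: "gf_le q k = infsum ?f A + (if k = 0 then 1 else 0)"
  proof (cases "k = 0")
    case True
    then have "{p \<in> NRO. M2_rank p \<le> k} = insert {#} A" by (auto simp: A_def)
    then show ?thesis
      using smA True by (simp add: gf_le_def infsum_insert A_def)
  next
    case False
    then show ?thesis by (simp add: gf_le_def A_def)
  qed
  have B: "(\<Sum>\<^sub>\<infinity>p\<in>{p \<in> NRO. M2_rank p \<ge> k - 1}. ?f p) = infsum ?f B + (if k = 1 then 1 else 0)"
  proof (cases "k = 1")
    case True
    then have "{p \<in> NRO. M2_rank p \<ge> k - 1} = insert {#} B" by (auto simp: B_def)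
    then show ?thesis
      using smB True by (simp add: infsum_insert B_def)
  next
    case False
    then show ?thesis by (simp add: B_def)
  qed
  have "gf q = (\<Sum>\<^sub>\<infinity>p\<in>{p \<in> NRO. M2_rank p \<le> k - 2} \<union> {p \<in> NRO. M2_rank p \<ge> k - 1}. ?f p)"
    unfolding gf_def by (rule arg_cong[where f = "infsum ?f"]) force
  also have "\<dots> = gf_le q (k - 2) + (\<Sum>\<^sub>\<infinity>p\<in>{p \<in> NRO. M2_rank p \<ge> k - 1}. ?f p)"
    unfolding gf_le_def by (intro infsum_Un_disjoint summable_NRO_power q) auto
  finally have G: "gf q = gf_le q (k - 2) + (infsum ?f B + (if k = 1 then 1 else 0))"
    unfolding B .
  have "q powi (2 * k) * gf_le q k = q * infsum ?f B + (if k = 0 then 1 else 0)"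
    unfolding A distrib_left AB by auto
  then show ?thesis
    unfolding G by (simp add: algebra_simps)
qed

lemma powi_split:
  fixes q :: complex
  shows "q \<noteq> 0 \<Longrightarrow> e = a + b \<Longrightarrow> q powi e = q powi a * q powi b"
  by (simp add: power_int_add)

lemma norm_minus1_powi [simp]: "norm ((- 1 :: complex) powi k) = 1"
  by (simp add: norm_power_int)

lemma minus1_powi_add1 [simp]: "(- 1 :: complex) powi (k + 1) = - ((- 1) powi k)"
  by (simp add: power_int_add)

lemma minus1_powi_1add [simp]: "(- 1 :: complex) powi (1 + k) = - ((- 1) powi k)"
  by (simp add: power_int_add)

text \<open>The series is psi(-q), since \<open>2 k^2 + k\<close> runs through the triangular
  numbers. The recurrence at even indices, multiplied by
  \<open>(- 1) powi n * q powi (2 n^2 - 3 n)\<close>, becomes the difference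
  \<open>b n - b (n + 1)\<close>. Summed over all integers it gives 0, and the empty partition
  contributes the 1.\<close>

lemma gf_times_psi:
  assumes q: "q \<noteq> 0" "norm q < 1 / 2"
  shows "gf q * (\<Sum>\<^sub>\<infinity>k. (- 1) powi k * q powi (2 * k\<^sup>2 + k)) = 1"
proof -
  define b where "b n = (- 1) powi n * gf_le q (2 * n - 2) * q powi (2 * n\<^sup>2 - 3 * n + 1)" for n
  obtain U where U: "norm (gf_le q k) \<le> U" for k
    using gf_le_bounded[OF q(2)] by blast
  have q1: "norm q < 1" using q by simp
  have smb: "b summable_on UNIV"
    unfolding b_def
    using summable_theta[OF q(1) q1, of 2 "\<lambda>n. (- 1) powi n * gf_le q (2 * n - 2)" U "- 3" 1] U
    by (simp add: norm_mult)
  have smb': "(\<lambda>n. b (n + 1)) summable_on UNIV"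
    using smb by (subst summable_on_reindex_bij_witness[of _ "\<lambda>n. n - 1" "\<lambda>n. n + 1" UNIV b]) auto
  have smt: "(\<lambda>n. (- 1) powi n * q powi (2 * n\<^sup>2 - 3 * n + 1)) summable_on UNIV"
    using summable_theta[OF q(1) q1, of 2 "\<lambda>n. (- 1) powi n" 1 "- 3" 1] by simp
  have step: "b n - b (n + 1) = gf q * ((- 1) powi n * q powi (2 * n\<^sup>2 - 3 * n + 1)) + (if n = 0 then 1 else 0)" for n
  proof -
    have e1: "q powi (2 * n\<^sup>2 - 3 * n + 1) = q powi (2 * n\<^sup>2 - 3 * n) * q"
      using q by (simp add: power_int_add)
    have e2: "q powi (2 * (n + 1)\<^sup>2 - 3 * (n + 1) + 1) = q powi (2 * n\<^sup>2 - 3 * n) * q powi (2 * (2 * n))"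
      by (rule powi_split[OF q(1)]) (simp add: power2_eq_square algebra_simps)
    have "b n - b (n + 1) = (- 1) powi n * q powi (2 * n\<^sup>2 - 3 * n) *
        (q * gf_le q (2 * n - 2) + q powi (2 * (2 * n)) * gf_le q (2 * n))"
      unfolding b_def e2 e1 by (simp add: algebra_simps)
    also have "\<dots> = (- 1) powi n * q powi (2 * n\<^sup>2 - 3 * n) * (q * gf q + (if n = 0 then 1 else 0))"
      using gf_le_recurrence[OF q, of "2 * n"] by (simp add: pos_zmult_eq_1_iff)
    also have "\<dots> = gf q * ((- 1) powi n * q powi (2 * n\<^sup>2 - 3 * n + 1)) + (if n = 0 then 1 else 0)"
      unfolding e1 by (simp add: algebra_simps)
    finally show ?thesis .
  qed
  have single: "((\<lambda>n::int. if n = 0 then 1 else 0 :: complex) has_sum 1) UNIV"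
    by (rule has_sum_finite_neutralI[of "{0}"]) auto
  have "0 = infsum b UNIV - (\<Sum>\<^sub>\<infinity>n. b (n + 1))"
    by (simp add: infsum_int_shift)
  also have "\<dots> = (\<Sum>\<^sub>\<infinity>n. b n - b (n + 1))"
    using infsum_add[OF smb, of "\<lambda>n. - b (n + 1)"] smb' by (simp add: infsum_uminus summable_on_uminus)
  also have "\<dots> = (\<Sum>\<^sub>\<infinity>n. gf q * ((- 1) powi n * q powi (2 * n\<^sup>2 - 3 * n + 1))) + (\<Sum>\<^sub>\<infinity>n. if n = (0::int) then 1 else 0)"
    unfolding step using single by (intro infsum_add summable_on_cmult_right smt) (auto simp: summable_on_def)
  also have "\<dots> = gf q * (\<Sum>\<^sub>\<infinity>n. (- 1) powi n * q powi (2 * n\<^sup>2 - 3 * n + 1)) + 1"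
    using infsumI[OF single] by (simp add: infsum_cmult_right')
  also have "(\<Sum>\<^sub>\<infinity>n. (- 1) powi n * q powi (2 * n\<^sup>2 - 3 * n + 1)) =
      (\<Sum>\<^sub>\<infinity>n. (- 1) powi (n + 1) * q powi (2 * (n + 1)\<^sup>2 - 3 * (n + 1) + 1))"
    by (rule infsum_int_shift[symmetric])
  also have "\<dots> = - (\<Sum>\<^sub>\<infinity>n. (- 1) powi n * q powi (2 * n\<^sup>2 + n))"
    unfolding infsum_uminus[symmetric]
    by (intro infsum_cong) (simp add: power2_eq_square algebra_simps)
  finally show ?thesis by simp
qed

section \<open>Coefficients of the theta function times the rank generating function\<close>

lemma powi_neq_one:
  fixes q :: complex
  assumes "q \<noteq> 0" "norm q < 1 / 2" "m \<noteq> 0"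
  shows "q powi m \<noteq> 1" "norm (1 / (1 - q powi m)) \<le> 2"
proof -
  \<comment> \<open>For \<open>m > 0\<close> the power has modulus at most 1/2, for
    \<open>m < 0\<close> at least 2.\<close>
  have "norm (1 - q powi m) \<ge> 1 / 2"
  proof (cases "m > 0")
    case True
    have "norm (q powi m) = norm q ^ nat m"
      using True by (simp add: norm_power_int power_int_nonneg_exp norm_power)
    also have "\<dots> \<le> norm q ^ 1"
      using True assms by (intro power_decreasing) auto
    finally have "norm (q powi m) \<le> 1 / 2" using assms by simp
    then show ?thesis using norm_triangle_ineq2[of 1 "q powi m"] by simp
  next
    case False
    have "norm (q powi (- m)) = norm q ^ nat (- m)"
      using False by (simp add: norm_power_int power_int_nonneg_exp norm_power)
    also have "\<dots> \<le> norm q ^ 1"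
      using False assms by (intro power_decreasing) auto
    finally have le: "norm (q powi (- m)) \<le> 1 / 2" using assms by simp
    have "norm (q powi m) * norm (q powi (- m)) = 1"
      using assms by (simp add: power_int_minus norm_inverse)
    moreover have "norm (q powi m) * norm (q powi (- m)) \<le> norm (q powi m) * (1 / 2)"
      by (intro mult_left_mono le) auto
    ultimately have "norm (q powi m) \<ge> 2" by simp
    then show ?thesis using norm_triangle_ineq2[of "q powi m" 1] by (simp add: norm_minus_commute)
  qed
  note le = this
  then show "q powi m \<noteq> 1" by auto
  have "1 / norm (1 - q powi m) \<le> 1 / (1 / 2)"
    using le by (intro divide_left_mono) auto
  then show "norm (1 / (1 - q powi m)) \<le> 2"
    by (simp add: norm_divide)
qed

lemma minus1_powi_reflect: "(- 1 :: complex) powi (a - n) = (- 1) powi a * (- 1) powi n"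
proof -
  have "(- 1 :: complex) powi n * (- 1) powi n = 1"
    by (simp add: power_int_mult_distrib[symmetric])
  moreover have "(- 1 :: complex) powi a = (- 1) powi (a - n) * (- 1) powi n"
    by (rule powi_split) auto
  ultimately show ?thesis by (simp add: mult.assoc)
qed

lemma eq_divide_cancel_left:
  fixes A D S X Y :: complex
  assumes "A * (X * D) = S * (X * Y)" "X \<noteq> 0" "D \<noteq> 0"
  shows "A = S * Y / D"
proof -
  have "X * (A * D) = X * (S * Y)" using assms(1) by (simp add: mult_ac)
  then show ?thesis using assms(2,3) by (simp add: eq_divide_eq)
qed

lemma infsum_single:
  fixes f :: "'a \<Rightarrow> complex"
  assumes "\<And>x. x \<noteq> a \<Longrightarrow> f x = 0"
  shows "infsum f UNIV = f a"
  by (rule infsumI, rule has_sum_finite_neutralI[of "{a}"]) (use assms in auto)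

text \<open>
  The coefficient of \<open>z\<^sup>k\<close> in the product of \<open>\<Sum>\<^sub>n (-1)\<^sup>n q\<^bsup>2n\<^sup>2-2n\<^esup> z\<^bsup>-2n\<^esup>\<close> and \<open>\<Sum>\<^sub>k u\<^sub>k z\<^sup>k\<close>.
\<close>

definition theta_gf :: "complex \<Rightarrow> int \<Rightarrow> complex" where
  "theta_gf q k = (\<Sum>\<^sub>\<infinity>n. (- 1) powi n * gf_le q (k + 2 * n) * q powi (2 * n\<^sup>2 - 2 * n))"

lemma theta_gf_summable:
  assumes q: "q \<noteq> 0" "norm q < 1 / 2"
  shows "(\<lambda>n. (- 1) powi n * gf_le q (k + 2 * n) * q powi (2 * n\<^sup>2 - 2 * n)) summable_on UNIV"
proof -
  obtain U where U: "norm (gf_le q k) \<le> U" for k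
    using gf_le_bounded[OF q(2)] by blast
  show ?thesis
    using summable_theta[OF q(1), of 2 "\<lambda>n. (- 1) powi n * gf_le q (k + 2 * n)" U "- 2" 0] U q
    by (simp add: norm_mult)
qed

text \<open>Multiplication by \<open>q powi (2 * k)\<close> produces
  \<open>q powi (2 * (k + 2 n)) * gf_le q (k + 2 n)\<close> in every term, to which the recurrence
  applies. The \<open>gf q\<close> part sums to 0, the \<open>gf_le q (k + 2 n - 2)\<close> part is
  \<open>theta_gf q k\<close> again after \<open>n -> n + 1\<close>, with factor
  \<open>q powi (- 3)\<close>, and the empty partition leaves the right-hand side.\<close>

lemma theta_gf_equation:
  assumes q: "q \<noteq> 0" "norm q < 1 / 2"
  shows "theta_gf q k * (q powi (2 * k) - q powi (- 3)) =
    (\<Sum>\<^sub>\<infinity>n. (- 1) powi n * ((if k + 2 * n = 0 then 1 else 0) - (if k + 2 * n = 1 then q else 0)) * q powi (2 * n\<^sup>2 - 6 * n))"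
    (is "_ = infsum ?D UNIV")
proof -
  have q1: "norm q < 1" using q by simp
  obtain U where U: "norm (gf_le q k) \<le> U" for k
    using gf_le_bounded[OF q(2)] by blast
  let ?T = "\<lambda>n. (- 1) powi n * q powi (2 * n\<^sup>2 - 6 * n)"
  let ?S = "\<lambda>n. (- 1) powi n * gf_le q (k + 2 * n - 2) * q powi (2 * n\<^sup>2 - 6 * n)"
  have smT: "?T summable_on UNIV"
    using summable_theta[OF q(1) q1, of 2 "\<lambda>n. (- 1) powi n" 1 "- 6" 0] by simp
  have smS: "?S summable_on UNIV"
    using summable_theta[OF q(1) q1, of 2 "\<lambda>n. (- 1) powi n * gf_le q (k + 2 * n - 2)" U "- 6" 0] U
    by (simp add: norm_mult)
  have smD: "?D summable_on UNIV"
    using summable_theta[OF q(1) q1, of 2 "\<lambda>n. (- 1) powi n * ((if k + 2 * n = 0 then 1 else 0) - (if k + 2 * n = 1 then q else 0))" "1" "- 6" 0] q1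
    by (simp add: norm_mult)
  \<comment> \<open>The exponent \<open>2 n^2 - 6 n\<close> is invariant under
    \<open>n -> 3 - n\<close>, while the sign changes.\<close>
  have T0: "infsum ?T UNIV = 0"
  proof (rule infsum_antisym_zero[of _ 3])
    fix n :: int
    have "(- 1 :: complex) powi (3 - n) = - ((- 1) powi n)"
      by (simp add: minus1_powi_reflect)
    then show "?T (3 - n) = - ?T n"
      by (simp add: power2_eq_square algebra_simps)
  qed
  have S: "infsum ?S UNIV = - (q powi (- 4) * theta_gf q k)"
  proof -
    have "infsum ?S UNIV = (\<Sum>\<^sub>\<infinity>n. ?S (n + 1))"
      by (rule infsum_int_shift[symmetric])
    also have "\<dots> = (\<Sum>\<^sub>\<infinity>n. - (q powi (- 4)) * ((- 1) powi n * gf_le q (k + 2 * n) * q powi (2 * n\<^sup>2 - 2 * n)))"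
    proof (intro infsum_cong)
      fix n :: int
      have "q powi (2 * (n + 1)\<^sup>2 - 6 * (n + 1)) = q powi (- 4) * q powi (2 * n\<^sup>2 - 2 * n)"
        by (rule powi_split[OF q(1)]) (simp add: power2_eq_square algebra_simps)
      then show "?S (n + 1) = - (q powi (- 4)) * ((- 1) powi n * gf_le q (k + 2 * n) * q powi (2 * n\<^sup>2 - 2 * n))"
        by simp
    qed
    also have "\<dots> = - (q powi (- 4)) * theta_gf q k"
      unfolding theta_gf_def by (rule infsum_cmult_right')
    finally show ?thesis by simp
  qed
  have "theta_gf q k * q powi (2 * k) = (\<Sum>\<^sub>\<infinity>n. q * gf q * ?T n + (?D n + (- q) * ?S n))"
    unfolding theta_gf_def infsum_cmult_left'[symmetric]
  proof (intro infsum_cong)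
    fix n :: int
    have e: "q powi (2 * n\<^sup>2 - 2 * n) * q powi (2 * k) = q powi (2 * n\<^sup>2 - 6 * n) * q powi (2 * (k + 2 * n))"
      unfolding powi_split[OF q(1) refl, symmetric] by (simp add: algebra_simps)
    have r: "q powi (2 * (k + 2 * n)) * gf_le q (k + 2 * n) = q * gf q + ((if k + 2 * n = 0 then 1 else 0) - (if k + 2 * n = 1 then q else 0)) - q * gf_le q (k + 2 * n - 2)"
      using gf_le_recurrence[OF q, of "k + 2 * n"] by (simp add: algebra_simps)
    have "(- 1) powi n * gf_le q (k + 2 * n) * q powi (2 * n\<^sup>2 - 2 * n) * q powi (2 * k)
       = (- 1) powi n * q powi (2 * n\<^sup>2 - 6 * n) * (q powi (2 * (k + 2 * n)) * gf_le q (k + 2 * n))"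
      using e by (simp add: mult_ac)
    also have "\<dots> = q * gf q * ?T n + (?D n + (- q) * ?S n)"
      unfolding r by (simp add: algebra_simps)
    finally show "(- 1) powi n * gf_le q (k + 2 * n) * q powi (2 * n\<^sup>2 - 2 * n) * q powi (2 * k) =
      q * gf q * ?T n + (?D n + (- q) * ?S n)" .
  qed
  also have "\<dots> = (\<Sum>\<^sub>\<infinity>n. q * gf q * ?T n) + ((\<Sum>\<^sub>\<infinity>n. ?D n) + (\<Sum>\<^sub>\<infinity>n. (- q) * ?S n))"
    by (subst infsum_add infsum_add; (intro summable_on_add summable_on_cmult_right smT smS smD)?)+ simp
  also have "\<dots> = infsum ?D UNIV + q * (q powi (- 4) * theta_gf q k)"
    unfolding infsum_cmult_right' T0 S by simp
  also have "q * (q powi (- 4) * theta_gf q k) = q powi (- 3) * theta_gf q k"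
    using powi_split[OF q(1), of "- 3" 1 "- 4"] by simp
  finally show ?thesis by (simp add: algebra_simps)
qed

text \<open>The common value of \<open>theta_gf q\<close> at the even index \<open>- 2 r\<close> and
  at the odd index \<open>2 r - 3\<close>. As \<open>4 r - 3\<close> is never 0, the denominator
  does not vanish for small nonzero \<open>q\<close>.\<close>

definition lambert_term :: "complex \<Rightarrow> int \<Rightarrow> complex" where
  "lambert_term q r = (- 1) powi r * q powi (2 * r\<^sup>2 - 2 * r) / (1 - q powi (4 * r - 3))"

text \<open>Parity rules out the indicator \<open>k + 2 n = 1\<close>, and the other one leaves the
  single index \<open>n = r\<close> in \<open>theta_gf_equation\<close>.\<close>

lemma theta_gf_even:
  assumes q: "q \<noteq> 0" "norm q < 1 / 2"
  shows "theta_gf q (- 2 * r) = lambert_term q r"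
proof -
  have ind: "- 2 * r + 2 * n = 0 \<longleftrightarrow> n = r" "- 2 * r + 2 * n \<noteq> 1" for n
    by presburger+
  have "theta_gf q (- 2 * r) * (q powi (2 * (- 2 * r)) - q powi (- 3)) = (- 1) powi r * q powi (2 * r\<^sup>2 - 6 * r)"
    unfolding theta_gf_equation[OF q] by (subst infsum_single[of r]) (simp_all only: ind, simp_all)
  moreover have "q powi (2 * (- 2 * r)) - q powi (- 3) = q powi (- 4 * r) * (1 - q powi (4 * r - 3))"
    using powi_split[OF q(1), of "- 3" "- 4 * r" "4 * r - 3"] by (simp add: algebra_simps)
  moreover have "q powi (2 * r\<^sup>2 - 6 * r) = q powi (- 4 * r) * q powi (2 * r\<^sup>2 - 2 * r)"
    by (rule powi_split[OF q(1)]) simp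
  moreover have "1 - q powi (4 * r - 3) \<noteq> 0"
  proof -
    have "4 * r - 3 \<noteq> 0" by presburger
    then show ?thesis using powi_neq_one(1)[OF q] by simp
  qed
  ultimately have "theta_gf q (- 2 * r) * (q powi (- 4 * r) * (1 - q powi (4 * r - 3))) = (- 1) powi r * (q powi (- 4 * r) * q powi (2 * r\<^sup>2 - 2 * r))"
    and "1 - q powi (4 * r - 3) \<noteq> 0" by simp_all
  then show ?thesis
    unfolding lambert_term_def by (intro eq_divide_cancel_left[of _ "q powi (- 4 * r)"]) (use q in auto)
qed

text \<open>Parity now leaves only the indicator \<open>k + 2 n = 1\<close>, hence
  \<open>n = 2 - r\<close>. Its minus sign cancels the one from the factor on the left, which is why
  the value agrees with the even case.\<close>

lemma theta_gf_odd:
  assumes q: "q \<noteq> 0" "norm q < 1 / 2"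
  shows "theta_gf q (2 * r - 3) = lambert_term q r"
proof -
  have ind: "2 * r - 3 + 2 * n \<noteq> 0" "2 * r - 3 + 2 * n = 1 \<longleftrightarrow> n = 2 - r" for n
    by presburger+
  have "theta_gf q (2 * r - 3) * (q powi (2 * (2 * r - 3)) - q powi (- 3)) =
      (- 1) powi (2 - r) * (- q) * q powi (2 * (2 - r)\<^sup>2 - 6 * (2 - r))"
    unfolding theta_gf_equation[OF q] by (subst infsum_single[of "2 - r"]) (simp_all only: ind, simp_all)
  also have "(- 1 :: complex) powi (2 - r) = (- 1) powi r"
    by (simp add: minus1_powi_reflect)
  also have "(- 1) powi r * (- q) * q powi (2 * (2 - r)\<^sup>2 - 6 * (2 - r)) = - ((- 1) powi r * q powi (2 * r\<^sup>2 - 2 * r - 3))"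
    using powi_split[OF q(1), of "2 * r\<^sup>2 - 2 * r - 3" 1 "2 * (2 - r)\<^sup>2 - 6 * (2 - r)"]
    by (simp add: power2_eq_square algebra_simps)
  also have "q powi (2 * r\<^sup>2 - 2 * r - 3) = q powi (- 3) * q powi (2 * r\<^sup>2 - 2 * r)"
    by (rule powi_split[OF q(1)]) simp
  finally have "theta_gf q (2 * r - 3) * (q powi (2 * (2 * r - 3)) - q powi (- 3)) =
    - ((- 1) powi r * (q powi (- 3) * q powi (2 * r\<^sup>2 - 2 * r)))" .
  moreover have "q powi (2 * (2 * r - 3)) - q powi (- 3) = - (q powi (- 3) * (1 - q powi (4 * r - 3)))"
    using powi_split[OF q(1), of "2 * (2 * r - 3)" "- 3" "4 * r - 3"] by (simp add: algebra_simps)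
  moreover have "1 - q powi (4 * r - 3) \<noteq> 0"
  proof -
    have "4 * r - 3 \<noteq> 0" by presburger
    then show ?thesis using powi_neq_one(1)[OF q] by simp
  qed
  ultimately have "theta_gf q (2 * r - 3) * (q powi (- 3) * (1 - q powi (4 * r - 3))) = (- 1) powi r * (q powi (- 3) * q powi (2 * r\<^sup>2 - 2 * r))"
    and "1 - q powi (4 * r - 3) \<noteq> 0" by simp_all
  then show ?thesis
    unfolding lambert_term_def by (intro eq_divide_cancel_left[of _ "q powi (- 3)"]) (use q in auto)
qed

lemma lambert_term_summable:
  assumes q: "q \<noteq> 0" "norm q < 1 / 2" and c: "\<And>r. norm (c r) \<le> B"
  shows "(\<lambda>r. c r * lambert_term q r) summable_on UNIV"
proof -
  have "norm (c r * (- 1) powi r * (1 / (1 - q powi (4 * r - 3)))) \<le> B * 2" for r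
  proof -
    have "norm (1 / (1 - q powi (4 * r - 3))) \<le> 2"
      by (rule powi_neq_one(2)[OF q]) presburger
    moreover have "0 \<le> B" using c[of r] norm_ge_zero order_trans by blast
    ultimately show ?thesis
      unfolding norm_mult norm_minus1_powi using c[of r] by (intro mult_mono) auto
  qed
  then have "(\<lambda>r. c r * (- 1) powi r * (1 / (1 - q powi (4 * r - 3))) * q powi (2 * r\<^sup>2 + (- 2) * r + 0)) summable_on UNIV"
    using q by (intro summable_theta) auto
  then show ?thesis
    by (simp add: lambert_term_def mult.assoc)
qed

subsection \<open>The rank generating function at a sixth root of unity\<close>

definition zeta6 :: complex where
  "zeta6 = cis (pi / 3)"

lemma norm_zeta6_powi [simp]: "norm (zeta6 powi k) = 1"
  by (simp add: zeta6_def norm_power_int)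

lemma zeta6_nonzero [simp]: "zeta6 \<noteq> 0"
  by (simp add: zeta6_def)

lemma zeta6_squared: "zeta6 * zeta6 = zeta6 - 1"
  by (simp add: zeta6_def complex_eq_iff cos_60 sin_60)

lemma zeta6_cubed: "zeta6 ^ 3 = - 1"
proof -
  have "zeta6 ^ 3 = zeta6 * zeta6 - zeta6"
    by (simp add: power3_eq_cube zeta6_squared left_diff_distrib)
  then show ?thesis by (simp add: zeta6_squared)
qed

lemma zeta6_powi_6 [simp]: "zeta6 powi (6 * k) = 1"
proof -
  have "zeta6 ^ 6 = 1"
    using power_mult[of zeta6 3 2] by (simp add: zeta6_cubed)
  then show ?thesis by (simp add: power_int_mult)
qed

lemma zeta6_inverse: "inverse zeta6 = 1 - zeta6"
  by (rule inverse_unique) (simp add: algebra_simps zeta6_squared)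

definition rank_gf :: "complex \<Rightarrow> complex" where
  "rank_gf q = (\<Sum>\<^sub>\<infinity>p\<in>NRO. zeta6 powi M2_rank p * q ^ sum_mset p)"

lemma gf_rank_eq:
  assumes "norm q < 1 / 2"
  shows "(\<Sum>\<^sub>\<infinity>p\<in>{p \<in> NRO. M2_rank p = k}. q ^ sum_mset p) = gf_le q k - gf_le q (k - 1)"
proof -
  have "gf_le q k = (\<Sum>\<^sub>\<infinity>p\<in>{p \<in> NRO. M2_rank p = k} \<union> {p \<in> NRO. M2_rank p \<le> k - 1}. q ^ sum_mset p)"
    unfolding gf_le_def by (rule arg_cong[where f = "infsum _"]) force
  also have "\<dots> = (\<Sum>\<^sub>\<infinity>p\<in>{p \<in> NRO. M2_rank p = k}. q ^ sum_mset p) + gf_le q (k - 1)"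
    unfolding gf_le_def by (intro infsum_Un_disjoint summable_NRO_power assms) auto
  finally show ?thesis by simp
qed

text \<open>Differences are essential: as \<open>k\<close> grows, \<open>gf_le q k\<close> tends to
  \<open>gf q\<close>, which is nonzero, so the series of \<open>zeta6 powi k * gf_le q k\<close>
  itself has no sum.\<close>

lemma rank_gf_by_rank:
  assumes "norm q < 1 / 2"
  shows "((\<lambda>k. zeta6 powi k * (gf_le q k - gf_le q (k - 1))) has_sum rank_gf q) UNIV"
proof -
  have "(\<lambda>p. zeta6 powi M2_rank p * q ^ sum_mset p) summable_on NRO"
    using assms by (intro summable_NRO[where B = 1]) auto
  from has_sum_fibres[OF this, of M2_rank]
  have "((\<lambda>k. \<Sum>\<^sub>\<infinity>p\<in>{p \<in> NRO. M2_rank p = k}. zeta6 powi M2_rank p * q ^ sum_mset p) has_sum rank_gf q) UNIV"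
    by (simp add: rank_gf_def)
  moreover have "(\<Sum>\<^sub>\<infinity>p\<in>{p \<in> NRO. M2_rank p = k}. zeta6 powi M2_rank p * q ^ sum_mset p) = zeta6 powi k * (gf_le q k - gf_le q (k - 1))" for k
    unfolding gf_rank_eq[OF assms, symmetric] infsum_cmult_right'[symmetric]
    by (intro infsum_cong) auto
  ultimately show ?thesis by simp
qed

text \<open>A product of two bilateral series, reindexed with rank \<open>k + 2 n\<close>: the
  powers of \<open>zeta6\<close> combine to \<open>zeta6 powi k\<close>, and the inner sum over
  \<open>n\<close> is a difference of two values of \<open>theta_gf\<close>.\<close>

lemma theta_times_rank_gf:
  assumes q: "q \<noteq> 0" "norm q < 1 / 2"
  shows "(\<Sum>\<^sub>\<infinity>n. (- 1) powi n * zeta6 powi (- 2 * n) * q powi (2 * n\<^sup>2 - 2 * n)) * rank_gf q =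
    (\<Sum>\<^sub>\<infinity>k. zeta6 powi k * (theta_gf q k - theta_gf q (k - 1)))"
proof -
  let ?t = "\<lambda>n. (- 1) powi n * zeta6 powi (- 2 * n) * q powi (2 * n\<^sup>2 - 2 * n)"
  let ?r = "\<lambda>k. zeta6 powi k * (gf_le q k - gf_le q (k - 1))"
  have smt: "?t summable_on UNIV"
    using summable_theta[OF q(1), of 2 "\<lambda>n. (- 1) powi n * zeta6 powi (- 2 * n)" 1 "- 2" 0] q by (simp add: norm_mult)
  have smr: "?r summable_on UNIV" and r: "infsum ?r UNIV = rank_gf q"
    using rank_gf_by_rank[OF q(2)] by (auto simp: has_sum_iff)
  have sm: "(\<lambda>(n, k). ?t n * ?r k) summable_on UNIV \<times> UNIV"
    by (rule summable_on_complex_product[OF smt smr])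
  have bij: "bij_betw (\<lambda>(k, n). (n, k + 2 * n)) (UNIV \<times> UNIV) (UNIV \<times> (UNIV :: int set))"
    by (rule bij_betw_byWitness[where f' = "\<lambda>(n, k). (k - 2 * n, n)"]) auto
  have sm': "(\<lambda>(k, n). ?t n * ?r (k + 2 * n)) summable_on UNIV \<times> UNIV"
    using summable_on_reindex_bij_betw[OF bij, of "\<lambda>(n, k). ?t n * ?r k"] sm by (simp add: case_prod_unfold)
  have "infsum ?t UNIV * rank_gf q = infsum (\<lambda>(n, k). ?t n * ?r k) (UNIV \<times> UNIV)"
    unfolding r[symmetric] by (rule infsum_complex_product[OF smt smr, symmetric])
  also have "\<dots> = infsum (\<lambda>(k, n). ?t n * ?r (k + 2 * n)) (UNIV \<times> UNIV)"
    using infsum_reindex_bij_betw[OF bij, of "\<lambda>(n, k). ?t n * ?r k"] by (simp add: case_prod_unfold)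
  also have "\<dots> = (\<Sum>\<^sub>\<infinity>k. \<Sum>\<^sub>\<infinity>n. ?t n * ?r (k + 2 * n))"
    by (rule infsum_Sigma'_banach[OF sm', symmetric])
  also have "\<dots> = (\<Sum>\<^sub>\<infinity>k. zeta6 powi k * (theta_gf q k - theta_gf q (k - 1)))"
  proof (intro infsum_cong)
    fix k :: int
    let ?s = "\<lambda>k n. (- 1) powi n * gf_le q (k + 2 * n) * q powi (2 * n\<^sup>2 - 2 * n)"
    have "(\<Sum>\<^sub>\<infinity>n. ?t n * ?r (k + 2 * n)) = (\<Sum>\<^sub>\<infinity>n. zeta6 powi k * (?s k n - ?s (k - 1) n))"
    proof (intro infsum_cong)
      fix n :: int
      have "zeta6 powi (- 2 * n) * zeta6 powi (k + 2 * n) = zeta6 powi k"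
        by (subst powi_split[symmetric]) auto
      then have "?t n * ?r (k + 2 * n) = zeta6 powi k * ((- 1) powi n * q powi (2 * n\<^sup>2 - 2 * n) * (gf_le q (k + 2 * n) - gf_le q (k + 2 * n - 1)))"
        by (simp add: mult_ac)
      also have "\<dots> = zeta6 powi k * (?s k n - ?s (k - 1) n)"
        by (simp add: algebra_simps)
      finally show "?t n * ?r (k + 2 * n) = zeta6 powi k * (?s k n - ?s (k - 1) n)" .
    qed
    also have "\<dots> = zeta6 powi k * (\<Sum>\<^sub>\<infinity>n. ?s k n + - ?s (k - 1) n)"
      unfolding infsum_cmult_right' by simp
    also have "(\<Sum>\<^sub>\<infinity>n. ?s k n + - ?s (k - 1) n) = theta_gf q k - theta_gf q (k - 1)"
      by (subst infsum_add) (auto simp: infsum_uminus theta_gf_def summable_on_uminus theta_gf_summable[OF q])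
    finally show "(\<Sum>\<^sub>\<infinity>n. ?t n * ?r (k + 2 * n)) = zeta6 powi k * (theta_gf q k - theta_gf q (k - 1))" .
  qed
  finally show ?thesis .
qed

lemma theta_gf_zeta6_has_sum:
  assumes q: "q \<noteq> 0" "norm q < 1 / 2"
  shows "((\<lambda>k. zeta6 powi k * theta_gf q k) has_sum
    (\<Sum>\<^sub>\<infinity>r. (zeta6 powi (- 2 * r) + zeta6 powi (2 * r - 3)) * lambert_term q r)) UNIV"
proof -
  let ?f = "\<lambda>k. zeta6 powi k * theta_gf q k"
  let ?e = "\<lambda>r. zeta6 powi (- 2 * r) * lambert_term q r" and ?o = "\<lambda>r. zeta6 powi (2 * r - 3) * lambert_term q r"
  have sme: "?e summable_on UNIV" and smo: "?o summable_on UNIV"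
    using q by (auto intro!: lambert_term_summable[where B = 1])
  have e: "((\<lambda>t. ?f (2 * t)) has_sum infsum ?e UNIV) UNIV"
  proof (subst has_sum_reindex_bij_witness[of UNIV uminus uminus UNIV ?e])
    fix t :: int
    show "?e (- t) = ?f (2 * t)"
      using theta_gf_even[OF q, of "- t"] by simp
  qed (use sme in auto)
  have o: "((\<lambda>t. ?f (2 * t + 1)) has_sum infsum ?o UNIV) UNIV"
  proof (subst has_sum_reindex_bij_witness[of UNIV "\<lambda>t. t - 2" "\<lambda>t. t + 2" UNIV ?o])
    fix t :: int
    show "?o (t + 2) = ?f (2 * t + 1)"
      using theta_gf_odd[OF q, of "t + 2"] by (simp add: algebra_simps)
  qed (use smo in auto)
  have "(?f has_sum (\<Sum>\<^sub>\<infinity>t. ?f (2 * t)) + (\<Sum>\<^sub>\<infinity>t. ?f (2 * t + 1))) UNIV"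
    using e o by (intro has_sum_int_parity) (auto simp: summable_on_def)
  also have "(\<Sum>\<^sub>\<infinity>t. ?f (2 * t)) + (\<Sum>\<^sub>\<infinity>t. ?f (2 * t + 1)) = infsum ?e UNIV + infsum ?o UNIV"
    using infsumI[OF e] infsumI[OF o] by simp
  also have "\<dots> = (\<Sum>\<^sub>\<infinity>r. (zeta6 powi (- 2 * r) + zeta6 powi (2 * r - 3)) * lambert_term q r)"
    by (subst infsum_add[OF sme smo, symmetric]) (simp add: algebra_simps)
  finally show ?thesis .
qed

text \<open>Euler's pentagonal number series in \<open>q^12\<close>, that is, the product of all
  \<open>1 - q^(12 n)\<close>.\<close>

definition euler12 :: "complex \<Rightarrow> complex" where
  "euler12 q = (\<Sum>\<^sub>\<infinity>t. (- 1) powi t * q powi (18 * t\<^sup>2 - 6 * t))"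

lemma minus1_powi_3 [simp]: "(- 1 :: complex) powi (3 * t) = (- 1) powi t"
  by (simp add: power_int_mult)

lemma minus1_powi_3' [simp]: "(- 1 :: complex) powi (t * 3) = (- 1) powi t"
  using minus1_powi_3[of t] by (simp only: mult.commute)

lemma minus1_powi_uminus [simp]: "(- 1 :: complex) powi (- t) = (- 1) powi t"
  using minus1_powi_reflect[of 0 t] by simp

lemma minus1_powi_add2 [simp]: "(- 1 :: complex) powi (t + 2) = (- 1) powi t"
  by (simp add: power_int_add)

lemma minus1_powi_2add [simp]: "(- 1 :: complex) powi (2 + t) = (- 1) powi t"
  by (simp add: power_int_add)

lemma zeta6_powi_shift:
  "zeta6 powi (6 * t + a) = zeta6 powi a"
  by (simp add: power_int_add)

lemma zeta6_powi_minus2: "zeta6 powi (- 2) = - zeta6"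
proof -
  have "zeta6 powi (- 2) = (1 - zeta6) * (1 - zeta6)"
    by (simp add: power_int_minus power2_eq_square zeta6_inverse)
  also have "\<dots> = - zeta6" by (simp add: algebra_simps zeta6_squared)
  finally show ?thesis .
qed

lemma zeta6_powi_minus1: "zeta6 powi (- 1) = 1 - zeta6"
  by (simp add: power_int_minus zeta6_inverse)

lemma zeta6_powi_minus3: "zeta6 powi (- 3) = - 1"
  by (simp add: power_int_minus zeta6_cubed)

lemma zeta6_powi_minus4: "zeta6 powi (- 4) = zeta6 - 1"
  using powi_split[of zeta6 "- 4" "- 2" "- 2"] by (simp add: zeta6_powi_minus2 zeta6_squared)

lemma one_plus_zeta6_nonzero: "1 + zeta6 \<noteq> 0"
  by (simp add: zeta6_def complex_eq_iff cos_60)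

text \<open>As \<open>zeta6 powi (- 2)\<close> is a primitive cube root of unity, \<open>n\<close>
  is split modulo 3. Class 0 is the pentagonal series, class 1 is \<open>zeta6\<close> times it
  after \<open>t -> - t\<close>, and class 2 cancels under \<open>t -> - 1 - t\<close>.\<close>

lemma theta_at_zeta6:
  assumes q: "q \<noteq> 0" "norm q < 1 / 2"
  shows "(\<Sum>\<^sub>\<infinity>n. (- 1) powi n * zeta6 powi (- 2 * n) * q powi (2 * n\<^sup>2 - 2 * n)) = (1 + zeta6) * euler12 q"
proof -
  let ?f = "\<lambda>n. (- 1) powi n * zeta6 powi (- 2 * n) * q powi (2 * n\<^sup>2 - 2 * n)"
  have sm: "?f summable_on UNIV"
    using summable_theta[OF q(1), of 2 "\<lambda>n. (- 1) powi n * zeta6 powi (- 2 * n)" 1 "- 2" 0] q by (simp add: norm_mult)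
  have "(\<Sum>\<^sub>\<infinity>t. ?f (3 * t)) = euler12 q"
    unfolding euler12_def
  proof (intro infsum_cong)
    fix t :: int
    have "zeta6 powi (- 2 * (3 * t)) = 1"
      using zeta6_powi_6[of "- t"] by simp
    then show "?f (3 * t) = (- 1) powi t * q powi (18 * t\<^sup>2 - 6 * t)"
      by (simp add: power_mult_distrib)
  qed
  moreover have "(\<Sum>\<^sub>\<infinity>t. ?f (3 * t + 1)) = zeta6 * euler12 q"
  proof -
    have "(\<Sum>\<^sub>\<infinity>t. ?f (3 * t + 1)) = (\<Sum>\<^sub>\<infinity>t. ?f (3 * (- t) + 1))"
      by (rule infsum_int_minus[symmetric])
    also have "\<dots> = (\<Sum>\<^sub>\<infinity>t. zeta6 * ((- 1) powi t * q powi (18 * t\<^sup>2 - 6 * t)))"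
    proof (intro infsum_cong)
      fix t :: int
      have "zeta6 powi (- 2 * (3 * (- t) + 1)) = - zeta6"
        using zeta6_powi_shift[of t "- 2"] by (simp add: zeta6_powi_minus2 algebra_simps)
      moreover have "(- 1 :: complex) powi (3 * (- t) + 1) = - ((- 1) powi t)"
        by (simp add: minus1_powi_reflect)
      moreover have "2 * (3 * (- t) + 1)\<^sup>2 - 2 * (3 * (- t) + 1) = 18 * t\<^sup>2 - 6 * t"
        by (simp add: power2_eq_square algebra_simps)
      ultimately show "?f (3 * (- t) + 1) = zeta6 * ((- 1) powi t * q powi (18 * t\<^sup>2 - 6 * t))"
        by (simp only:) simp
    qed
    finally show ?thesis by (simp add: euler12_def infsum_cmult_right')
  qed
  moreover have "(\<Sum>\<^sub>\<infinity>t. ?f (3 * t + 2)) = 0"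
  proof (rule infsum_antisym_zero[of _ "- 1"])
    fix t :: int
    have "zeta6 powi (- 2 * (3 * s + 2)) = zeta6 powi (- 4)" for s
      using zeta6_powi_shift[of "- s" "- 4"] by (simp add: algebra_simps)
    moreover have "(- 1 :: complex) powi (3 * (- 1 - t) + 2) = - ((- 1) powi (3 * t + 2))"
      using minus1_powi_3[of "- 1 - t"] by (simp add: minus1_powi_reflect)
    moreover have "2 * (3 * (- 1 - t) + 2)\<^sup>2 - 2 * (3 * (- 1 - t) + 2) = 2 * (3 * t + 2)\<^sup>2 - 2 * (3 * t + 2)"
      by (simp add: power2_eq_square algebra_simps)
    ultimately show "?f (3 * (- 1 - t) + 2) = - ?f (3 * t + 2)"
      by (simp only:) simp
  qed
  ultimately show ?thesis
    unfolding infsum_int_mod3[OF sm] by (simp add: algebra_simps)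
qed

text \<open>The difference of consecutive \<open>theta_gf\<close> values brings the factor
  \<open>1 - zeta6\<close>. The weight of \<open>lambert_term q r\<close> is 0,
  \<open>1 - 2 zeta6\<close> or \<open>2 zeta6 - 1\<close> for \<open>r\<close> congruent to 0, 1 or
  2 modulo 3, and \<open>(1 - zeta6) (2 zeta6 - 1) = 1 + zeta6\<close> cancels the constant of the
  theta function.\<close>

lemma euler12_times_rank_gf:
  assumes q: "q \<noteq> 0" "norm q < 1 / 2"
  shows "euler12 q * rank_gf q =
    (\<Sum>\<^sub>\<infinity>t. (- 1) powi t * q powi (18 * t\<^sup>2 + 6 * t) / (1 - q powi (12 * t + 1))) +
    (\<Sum>\<^sub>\<infinity>t. (- 1) powi t * q powi (18 * t\<^sup>2 + 18 * t + 4) / (1 - q powi (12 * t + 5)))" (is "_ = ?A + ?B")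
proof -
  define X where "X = (\<Sum>\<^sub>\<infinity>r. (zeta6 powi (- 2 * r) + zeta6 powi (2 * r - 3)) * lambert_term q r)"
  let ?g = "\<lambda>k. zeta6 powi k * theta_gf q k"
  have X: "(?g has_sum X) UNIV"
    unfolding X_def by (rule theta_gf_zeta6_has_sum[OF q])
  have X': "((\<lambda>k. ?g (k - 1)) has_sum X) UNIV"
    using X by (subst has_sum_reindex_bij_witness[of UNIV "\<lambda>k. k + 1" "\<lambda>k. k - 1" UNIV ?g _ _ X]) auto
  have "((\<lambda>k. ?g k + (- zeta6) * ?g (k - 1)) has_sum (X + (- zeta6) * X)) UNIV"
    by (intro has_sum_add X has_sum_cmult_right X')
  moreover have "?g k + (- zeta6) * ?g (k - 1) = zeta6 powi k * (theta_gf q k - theta_gf q (k - 1))" for k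
    using powi_split[of zeta6 k 1 "k - 1"] by (simp add: algebra_simps)
  ultimately have "((\<lambda>k. zeta6 powi k * (theta_gf q k - theta_gf q (k - 1))) has_sum (X + (- zeta6) * X)) UNIV"
    by (simp only:)
  then have h1: "(1 + zeta6) * euler12 q * rank_gf q = (1 - zeta6) * X"
    unfolding theta_at_zeta6[OF q, symmetric] theta_times_rank_gf[OF q]
    by (simp add: infsumI left_diff_distrib)
  have h2: "X = (2 * zeta6 - 1) * (?A + ?B)"
  proof -
    let ?f = "\<lambda>r. (zeta6 powi (- 2 * r) + zeta6 powi (2 * r - 3)) * lambert_term q r"
    have nrm: "norm (zeta6 powi (- 2 * r) + zeta6 powi (2 * r - 3)) \<le> 2" for r
      using norm_triangle_ineq[of "zeta6 powi (- 2 * r)" "zeta6 powi (2 * r - 3)"] by simp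
    have sm: "?f summable_on UNIV"
      by (rule lambert_term_summable[OF q nrm])
    have "?f (3 * t) = 0" for t
      using zeta6_powi_shift[of "- t" 0] zeta6_powi_shift[of t "- 3"] by (simp add: zeta6_powi_minus3)
    then have "(\<Sum>\<^sub>\<infinity>t. ?f (3 * t)) = 0" by (intro infsum_0)
    moreover have "(\<Sum>\<^sub>\<infinity>t. ?f (3 * t + 1)) = (2 * zeta6 - 1) * ?A"
      unfolding infsum_cmult_right'[symmetric]
    proof (intro infsum_cong)
      fix t :: int
      have "zeta6 powi (- 2 * (3 * t + 1)) + zeta6 powi (2 * (3 * t + 1) - 3) = 1 - 2 * zeta6"
        using zeta6_powi_shift[of "- t" "- 2"] zeta6_powi_shift[of t "- 1"]
        by (simp add: zeta6_powi_minus2 zeta6_powi_minus1 zeta6_inverse algebra_simps)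
      moreover have "lambert_term q (3 * t + 1) = - ((- 1) powi t * q powi (18 * t\<^sup>2 + 6 * t) / (1 - q powi (12 * t + 1)))"
        unfolding lambert_term_def by (simp add: power2_eq_square algebra_simps)
      ultimately show "?f (3 * t + 1) = (2 * zeta6 - 1) * ((- 1) powi t * q powi (18 * t\<^sup>2 + 6 * t) / (1 - q powi (12 * t + 1)))"
        by (simp only: mult_minus_right minus_mult_left minus_diff_eq)
    qed
    moreover have "(\<Sum>\<^sub>\<infinity>t. ?f (3 * t + 2)) = (2 * zeta6 - 1) * ?B"
      unfolding infsum_cmult_right'[symmetric]
    proof (intro infsum_cong)
      fix t :: int
      have "zeta6 powi (- 2 * (3 * t + 2)) + zeta6 powi (2 * (3 * t + 2) - 3) = 2 * zeta6 - 1"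
        using zeta6_powi_shift[of "- t" "- 4"] zeta6_powi_shift[of t 1]
        by (simp add: zeta6_powi_minus4 algebra_simps)
      moreover have "lambert_term q (3 * t + 2) = (- 1) powi t * q powi (18 * t\<^sup>2 + 18 * t + 4) / (1 - q powi (12 * t + 5))"
        unfolding lambert_term_def by (simp add: power2_eq_square algebra_simps)
      ultimately show "?f (3 * t + 2) = (2 * zeta6 - 1) * ((- 1) powi t * q powi (18 * t\<^sup>2 + 18 * t + 4) / (1 - q powi (12 * t + 5)))"
        by (simp only:)
    qed
    ultimately show ?thesis
      unfolding X_def infsum_int_mod3[OF sm] by (simp add: algebra_simps)
  qed
  have h3: "(1 - zeta6) * (2 * zeta6 - 1) = 1 + zeta6"
  proof -
    have "(1 - zeta6) * (2 * zeta6 - 1) = 3 * zeta6 - 1 - 2 * (zeta6 * zeta6)"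
      by (simp add: algebra_simps)
    then show ?thesis by (simp add: zeta6_squared)
  qed
  have "(1 + zeta6) * (euler12 q * rank_gf q) = (1 - zeta6) * (2 * zeta6 - 1) * (?A + ?B)"
    using h1 unfolding h2 by (simp only: mult.assoc)
  then have "(1 + zeta6) * (euler12 q * rank_gf q) = (1 + zeta6) * (?A + ?B)"
    unfolding h3 .
  then show ?thesis
    using one_plus_zeta6_nonzero by simp
qed

subsection \<open>The exponents congruent to 2 modulo 3\<close>

text \<open>
  The index set for expanding \<open>1 / (1 - q\<^bsup>12t+c\<^esup>)\<close> with \<open>0 < c < 12\<close> as a geometric series, in positive powers
  for \<open>t \<ge> 0\<close> and in negative powers for \<open>t < 0\<close>.
\<close>

definition quadrants :: "(int \<times> int) set" where
  "quadrants = (SIGMA t:UNIV. if t \<ge> 0 then {0..} else {..<0})"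

abbreviation (input) sg :: "int \<Rightarrow> complex" where
  "sg t \<equiv> (if t \<ge> 0 then 1 else - 1)"

text \<open>For \<open>m < 0\<close> the base \<open>x = q powi m\<close> has modulus above 1 and
  \<open>1 / (1 - x)\<close> is minus the sum of all negative powers of \<open>x\<close>; hence the
  sign and the index range.\<close>

lemma has_sum_geometric_powi:
  fixes q :: complex
  assumes q: "q \<noteq> 0" "norm q < 1 / 2" and "m \<noteq> 0"
  shows "((\<lambda>l. sg m * q powi (m * l)) has_sum 1 / (1 - q powi m)) (if m \<ge> 0 then {0..} else {..<0})"
proof (cases "m > 0")
  case True
  define x where "x = q ^ nat m"
  have x: "norm x < 1"
    using True q by (simp add: x_def norm_power power_less_one_iff)
  have xp: "q powi (m * l) = x ^ nat l" if "l \<ge> 0" for l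
    using True that by (simp add: x_def power_int_nonneg_exp nat_mult_distrib power_mult)
  have xm: "q powi m = x" using True by (simp add: x_def power_int_nonneg_exp)
  have "((\<lambda>n. x ^ n) has_sum (1 / (1 - x))) UNIV"
    using x geometric_sums[OF x] by (intro norm_summable_imp_has_sum) (auto simp: norm_power summable_geometric)
  then have "((\<lambda>l. q powi (m * l)) has_sum (1 / (1 - x))) {0..}"
    using xp by (subst has_sum_reindex_bij_witness[of _ int nat UNIV "\<lambda>n. x ^ n" _ _ "1 / (1 - x)"]) auto
  then show ?thesis using True xm by simp
next
  case False
  then have m: "m < 0" using assms by simp
  define x where "x = q ^ nat (- m)"
  have x: "norm x < 1"
    using m q by (simp add: x_def norm_power power_less_one_iff)
  have x0: "x \<noteq> 0" "x \<noteq> 1" using q x by (auto simp: x_def)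
  have xp: "q powi (m * l) = x ^ nat (- l)" if "l < 0" for l
  proof -
    have "m * l = int (nat (- m) * nat (- l))" using m that by (simp add: mult_neg_neg)
    then show ?thesis by (simp only: power_int_of_nat x_def power_mult)
  qed
  have xm: "q powi m = 1 / x"
    using m power_int_minus[of q "- m"] by (simp add: x_def power_int_nonneg_exp divide_inverse)
  have "((\<lambda>n. x ^ n) has_sum (x / (1 - x))) {1..}"
    by (rule has_sum_geometric_from_1[OF x])
  then have "((\<lambda>l. q powi (m * l)) has_sum (x / (1 - x))) {..<0}"
    using xp by (subst has_sum_reindex_bij_witness[of _ "\<lambda>n. - int n" "\<lambda>l. nat (- l)" "{1..}" "\<lambda>n. x ^ n" _ _ "x / (1 - x)"]) auto
  then have "((\<lambda>l. - (q powi (m * l))) has_sum (- (x / (1 - x)))) {..<0}"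
    by (rule has_sum_uminusI)
  moreover have "- (x / (1 - x)) = 1 / (1 - 1 / x)"
    using x0 by (simp add: field_simps)
  ultimately show ?thesis using m xm by simp
qed

text \<open>The quadratic form is indefinite, but on \<open>quadrants\<close> the coordinates have
  the same sign, and \<open>0 < c < 12\<close> gives it to \<open>12 t + c\<close> as well, with
  absolute value at least 1. Hence \<open>(12 t + c) l >= |l|\<close>.\<close>

lemma quadrants_summable:
  fixes q :: complex
  assumes q: "q \<noteq> 0" "norm q < 1" and "a \<ge> 1" "0 < c" "c < 12"
  shows "(\<lambda>(t, l). sg t * (- 1) powi t * q powi (a * t\<^sup>2 + b * t + d + (12 * t + c) * l)) summable_on quadrants"
proof (rule summable_powi2[OF q])
  fix t l assume tl: "(t, l) \<in> quadrants"
  have "\<bar>l\<bar> \<le> (12 * t + c) * l"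
  proof (cases "t \<ge> 0")
    case True
    then have "1 * l \<le> (12 * t + c) * l"
      using tl assms by (intro mult_right_mono) (auto simp: quadrants_def)
    then show ?thesis using True tl by (simp add: quadrants_def)
  next
    case False
    then have "(- 1) * l \<le> (12 * t + c) * l"
      using tl assms by (intro mult_right_mono_neg) (auto simp: quadrants_def)
    then show ?thesis using False tl by (simp add: quadrants_def)
  qed
  then show "\<bar>t\<bar> + \<bar>l\<bar> - ((\<bar>b\<bar> + 1)\<^sup>2 + \<bar>d\<bar>) \<le> a * t\<^sup>2 + b * t + d + (12 * t + c) * l"
    using int_quadratic_ge[OF assms(3), of t b d] by linarith
  show "norm (sg t * (- 1) powi t) \<le> 1"
    by (simp add: norm_mult)
qed

lemma lambert_as_double_sum:
  fixes q :: complex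
  assumes q: "q \<noteq> 0" "norm q < 1 / 2" and ac: "a \<ge> 1" "0 < c" "c < 12"
  shows "(\<Sum>\<^sub>\<infinity>t. (- 1) powi t * q powi (a * t\<^sup>2 + b * t + d) / (1 - q powi (12 * t + c))) =
    (\<Sum>\<^sub>\<infinity>(t, l)\<in>quadrants. sg t * (- 1) powi t * q powi (a * t\<^sup>2 + b * t + d + (12 * t + c) * l))"
proof -
  have "(\<lambda>(t, l). sg t * (- 1) powi t * q powi (a * t\<^sup>2 + b * t + d + (12 * t + c) * l)) summable_on quadrants"
    using q ac by (intro quadrants_summable) auto
  then have "(\<Sum>\<^sub>\<infinity>(t, l)\<in>quadrants. sg t * (- 1) powi t * q powi (a * t\<^sup>2 + b * t + d + (12 * t + c) * l)) =
      (\<Sum>\<^sub>\<infinity>t. \<Sum>\<^sub>\<infinity>l\<in>(if t \<ge> 0 then {0..} else {..<0}). sg t * (- 1) powi t * q powi (a * t\<^sup>2 + b * t + d + (12 * t + c) * l))"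
    unfolding quadrants_def by (rule infsum_Sigma'_banach[symmetric])
  also have "\<dots> = (\<Sum>\<^sub>\<infinity>t. (- 1) powi t * q powi (a * t\<^sup>2 + b * t + d) / (1 - q powi (12 * t + c)))"
  proof (intro infsum_cong)
    fix t :: int
    have m: "12 * t + c \<noteq> 0" "t \<ge> 0 \<longleftrightarrow> 12 * t + c \<ge> 0" using ac by presburger+
    have "((\<lambda>l. ((- 1) powi t * q powi (a * t\<^sup>2 + b * t + d)) * (sg t * q powi ((12 * t + c) * l))) has_sum
        ((- 1) powi t * q powi (a * t\<^sup>2 + b * t + d)) * (1 / (1 - q powi (12 * t + c)))) (if t \<ge> 0 then {0..} else {..<0})"
      unfolding m(2) by (intro has_sum_cmult_right has_sum_geometric_powi q m(1))
    then have "(\<Sum>\<^sub>\<infinity>l\<in>(if t \<ge> 0 then {0..} else {..<0}). ((- 1) powi t * q powi (a * t\<^sup>2 + b * t + d)) * (sg t * q powi ((12 * t + c) * l))) =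
      (- 1) powi t * q powi (a * t\<^sup>2 + b * t + d) * (1 / (1 - q powi (12 * t + c)))"
      by (rule infsumI)
    moreover have "sg t * (- 1) powi t * q powi (a * t\<^sup>2 + b * t + d + (12 * t + c) * l) =
      ((- 1) powi t * q powi (a * t\<^sup>2 + b * t + d)) * (sg t * q powi ((12 * t + c) * l))" for l
      using powi_split[OF q(1) refl, of "a * t\<^sup>2 + b * t + d" "(12 * t + c) * l"] by simp
    ultimately show "(\<Sum>\<^sub>\<infinity>l\<in>(if t \<ge> 0 then {0..} else {..<0}). sg t * (- 1) powi t * q powi (a * t\<^sup>2 + b * t + d + (12 * t + c) * l)) =
      (- 1) powi t * q powi (a * t\<^sup>2 + b * t + d) / (1 - q powi (12 * t + c))"
      by (simp only:) simp
  qed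
  finally show ?thesis by simp
qed

section \<open>Selecting exponents modulo 3 by cube roots of unity\<close>

definition omega :: complex where
  "omega = cis (2 * pi / 3)"

lemma omega_nonzero [simp]: "omega \<noteq> 0" and norm_omega [simp]: "norm omega = 1"
  by (simp_all add: omega_def)

lemma omega_squared: "omega\<^sup>2 = - 1 - omega"
  by (simp add: omega_def complex_eq_iff cos_120 sin_120 power2_eq_square)

lemma omega_cubed: "omega ^ 3 = 1"
proof -
  have "omega ^ 3 = omega * omega\<^sup>2" by (simp add: power3_eq_cube power2_eq_square mult.assoc)
  also have "\<dots> = - omega - omega\<^sup>2" by (simp add: omega_squared algebra_simps power2_eq_square[symmetric])
  also have "\<dots> = 1" by (simp add: omega_squared)
  finally show ?thesis .
qed

lemma omega_powi_mod3: "omega powi e = omega powi (e mod 3)"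
proof -
  have "omega powi (3 * (e div 3)) = 1"
    by (simp add: power_int_mult omega_cubed)
  then show ?thesis
    using powi_split[of omega e "3 * (e div 3)" "e mod 3"] by simp
qed

text \<open>The exponent \<open>e\<close> receives the weight
  \<open>1 + omega powi (e + 1) + omega powi (2 (e + 1))\<close>, which is 3 if 3 divides
  \<open>e + 1\<close> and 0 otherwise.\<close>

lemma infsum_residue2:
  fixes q :: complex and e :: "'a \<Rightarrow> int"
  assumes sm: "(\<lambda>i. s i * q powi e i) summable_on I"
  shows "(\<Sum>\<^sub>\<infinity>i\<in>I. s i * q powi e i) + omega * (\<Sum>\<^sub>\<infinity>i\<in>I. s i * (omega * q) powi e i)
    + omega\<^sup>2 * (\<Sum>\<^sub>\<infinity>i\<in>I. s i * (omega\<^sup>2 * q) powi e i) = 3 * (\<Sum>\<^sub>\<infinity>i\<in>{i \<in> I. e i mod 3 = 2}. s i * q powi e i)"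
proof -
  have rot: "(\<lambda>i. s i * (w * q) powi e i) summable_on I" if "norm w = 1" for w
  proof (subst summable_on_iff_abs_summable_on_complex)
    have "norm (s i * (w * q) powi e i) = norm (s i * q powi e i)" for i
      using that by (simp add: norm_mult norm_power_int)
    then show "(\<lambda>i. norm (s i * (w * q) powi e i)) summable_on I"
      using sm unfolding summable_on_iff_abs_summable_on_complex by simp
  qed
  have r1: "(\<lambda>i. omega * (s i * (omega * q) powi e i)) summable_on I"
    and r2: "(\<lambda>i. omega\<^sup>2 * (s i * (omega\<^sup>2 * q) powi e i)) summable_on I"
    by (intro summable_on_cmult_right rot; simp add: norm_power)+
  have "(\<Sum>\<^sub>\<infinity>i\<in>I. s i * q powi e i) + omega * (\<Sum>\<^sub>\<infinity>i\<in>I. s i * (omega * q) powi e i)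
    + omega\<^sup>2 * (\<Sum>\<^sub>\<infinity>i\<in>I. s i * (omega\<^sup>2 * q) powi e i)
    = (\<Sum>\<^sub>\<infinity>i\<in>I. s i * q powi e i + omega * (s i * (omega * q) powi e i) + omega\<^sup>2 * (s i * (omega\<^sup>2 * q) powi e i))"
    unfolding infsum_cmult_right'[symmetric]
    by (simp add: infsum_add[OF sm r1] infsum_add[OF summable_on_add[OF sm r1] r2])
  also have "\<dots> = (\<Sum>\<^sub>\<infinity>i\<in>{i \<in> I. e i mod 3 = 2}. 3 * (s i * q powi e i))"
  proof (rule infsum_cong_neutral)
    fix i
    have split: "s i * q powi e i + omega * (s i * (omega * q) powi e i) + omega\<^sup>2 * (s i * (omega\<^sup>2 * q) powi e i)
      = s i * q powi e i * (1 + omega * omega powi e i + omega\<^sup>2 * (omega powi e i)\<^sup>2)"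
      by (simp add: power_int_mult_distrib power2_eq_square algebra_simps)
    have "e i mod 3 = 0 \<or> e i mod 3 = 1 \<or> e i mod 3 = 2" by presburger
    then have val: "1 + omega * omega powi e i + omega\<^sup>2 * (omega powi e i)\<^sup>2 = (if e i mod 3 = 2 then 3 else 0)"
    proof (elim disjE)
      assume "e i mod 3 = 0"
      then show ?thesis by (subst (1 2) omega_powi_mod3) (simp add: omega_squared)
    next
      assume "e i mod 3 = 1"
      then show ?thesis
        by (subst (1 2) omega_powi_mod3) (simp add: omega_squared power2_eq_square[symmetric], simp add: power2_eq_square algebra_simps, simp add: power2_eq_square[symmetric] omega_squared)
    next
      assume "e i mod 3 = 2"
      moreover have "omega * omega\<^sup>2 = 1" using omega_cubed by (simp add: power3_eq_cube power2_eq_square mult.assoc)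
      moreover have "omega\<^sup>2 * (omega\<^sup>2)\<^sup>2 = 1"
        unfolding power_mult_distrib[symmetric] calculation(2) by simp
      ultimately show ?thesis by (subst (1 2) omega_powi_mod3) simp
    qed
    show "s i * q powi e i + omega * (s i * (omega * q) powi e i) + omega\<^sup>2 * (s i * (omega\<^sup>2 * q) powi e i) = 0"
      if "i \<in> I - {i \<in> I. e i mod 3 = 2}"
      unfolding split val using that by simp
    show "s i * q powi e i + omega * (s i * (omega * q) powi e i) + omega\<^sup>2 * (s i * (omega\<^sup>2 * q) powi e i)
       = 3 * (s i * q powi e i)" if "i \<in> I \<inter> {i \<in> I. e i mod 3 = 2}"
      unfolding split val using that by simp
  qed auto
  finally show ?thesis by (simp add: infsum_cmult_right')
qed

lemma euler12_rotate: 
  assumes "w ^ 3 = 1"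
  shows "euler12 (w * q) = euler12 q"
  unfolding euler12_def
proof (intro infsum_cong)
  fix t :: int
  have "w powi (18 * t\<^sup>2 - 6 * t) = (w powi 3) powi (6 * t\<^sup>2 - 2 * t)"
    unfolding power_int_mult[symmetric] by simp
  then have "w powi (18 * t\<^sup>2 - 6 * t) = 1"
    using assms by simp
  then show "(- 1) powi t * (w * q) powi (18 * t\<^sup>2 - 6 * t) = (- 1) powi t * q powi (18 * t\<^sup>2 - 6 * t)"
    by (simp add: power_int_mult_distrib)
qed

definition rank_gf2 :: "complex \<Rightarrow> complex" where
  "rank_gf2 q = (\<Sum>\<^sub>\<infinity>p\<in>{p \<in> NRO. int (sum_mset p) mod 3 = 2}. zeta6 powi M2_rank p * q powi int (sum_mset p))"

text \<open>After \<open>l -> 3 l + 2\<close>, removal of a factor \<open>q^2\<close> and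
  \<open>y = q^3\<close>, the exponents \<open>18 t^2 + 6 t + (12 t + 1) l\<close> and
  \<open>18 t^2 + 18 t + 4 + (12 t + 5) l\<close> take this form with \<open>c = 1\<close> and
  \<open>c = 5\<close>; the telescoping is then done once, with \<open>c\<close> as a
  parameter.\<close>

definition appell :: "int \<Rightarrow> complex \<Rightarrow> complex" where
  "appell c y = (\<Sum>\<^sub>\<infinity>(t, l)\<in>quadrants. sg t * (- 1) powi t * y powi (6 * t\<^sup>2 + (9 + c) * t + (c - 1) + (12 * t + c) * l))"

text \<open>The map \<open>l -> 3 l + 2\<close> respects the division into \<open>l >= 0\<close> and
  \<open>l < 0\<close>, so it carries \<open>quadrants\<close> bijectively onto its pairs with
  \<open>l\<close> congruent to 2 modulo 3.\<close>

lemma quadrants_residue2: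
  fixes q :: complex
  assumes q: "q \<noteq> 0" and e: "\<And>t l. e t l mod 3 = 2 \<longleftrightarrow> l mod 3 = 2" "\<And>t l. e t (3 * l + 2) = 3 * e' t l + 2"
  shows "(\<Sum>\<^sub>\<infinity>i\<in>{i \<in> quadrants. (case i of (t, l) \<Rightarrow> e t l) mod 3 = 2}. (case i of (t, l) \<Rightarrow> sg t * (- 1) powi t) * q powi (case i of (t, l) \<Rightarrow> e t l))
    = q\<^sup>2 * (\<Sum>\<^sub>\<infinity>(t, l)\<in>quadrants. sg t * (- 1) powi t * (q ^ 3) powi e' t l)"
proof -
  have "(\<Sum>\<^sub>\<infinity>i\<in>{i \<in> quadrants. (case i of (t, l) \<Rightarrow> e t l) mod 3 = 2}. (case i of (t, l) \<Rightarrow> sg t * (- 1) powi t) * q powi (case i of (t, l) \<Rightarrow> e t l))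
    = (\<Sum>\<^sub>\<infinity>i\<in>quadrants. q\<^sup>2 * (case i of (t, l) \<Rightarrow> sg t * (- 1) powi t * (q ^ 3) powi e' t l))"
  proof (rule infsum_reindex_bij_witness[of _ "\<lambda>(t, l). (t, 3 * l + 2)" "\<lambda>(t, l). (t, l div 3)"], goal_cases)
    case (5 a)
    obtain t l where a: "a = (t, l)" by (cases a)
    have "l mod 3 = 2" using 5 a e(1) by auto
    then have l: "l = 3 * (l div 3) + 2" by presburger
    then have "e t l = 3 * e' t (l div 3) + 2" using e(2) by metis
    then have "q powi e t l = q\<^sup>2 * (q ^ 3) powi e' t (l div 3)"
      using q by (simp add: power_int_add power_int_mult)
    then show ?case by (simp add: a)
  next
    case (1 a)
    obtain t l where a: "a = (t, l)" by (cases a)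
    have "l mod 3 = 2" using 1 a e(1) by auto
    then have "3 * (l div 3) + 2 = l" by presburger
    then show ?case using a by simp
  qed (auto simp: e quadrants_def split: if_splits)
  then show ?thesis by (simp add: infsum_cmult_right')
qed

text \<open>The pentagonal factor is unchanged when \<open>q\<close> is multiplied by a cube root of
  unity, so it passes through the selection of the residue class.\<close>

lemma euler12_times_rank_gf2:
  assumes q: "q \<noteq> 0" "norm q < 1 / 2"
  shows "euler12 q * rank_gf2 q = q\<^sup>2 * (appell 1 (q ^ 3) + appell 5 (q ^ 3))"
proof -
  define e1 where "e1 = (\<lambda>(t::int, l). 18 * t\<^sup>2 + 6 * t + 0 + (12 * t + 1) * l)"
  define e2 where "e2 = (\<lambda>(t::int, l). 18 * t\<^sup>2 + 18 * t + 4 + (12 * t + 5) * l)"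
  define s where "s = (\<lambda>(t::int, l::int). sg t * (- 1) powi t)"
  have L: "euler12 w * rank_gf w = (\<Sum>\<^sub>\<infinity>i\<in>quadrants. s i * w powi e1 i) + (\<Sum>\<^sub>\<infinity>i\<in>quadrants. s i * w powi e2 i)"
    if "norm w = norm q" for w
  proof -
    have w: "w \<noteq> 0" "norm w < 1 / 2" using that q by auto
    show ?thesis
      unfolding euler12_times_rank_gf[OF w]
      using lambert_as_double_sum[OF w, of 18 1 6 0] lambert_as_double_sum[OF w, of 18 5 18 4]
      by (simp add: e1_def e2_def s_def case_prod_unfold)
  qed
  have sm1: "(\<lambda>i. s i * q powi e1 i) summable_on quadrants"
    using quadrants_summable[OF q(1), of 18 1 6 0] q by (simp add: e1_def s_def case_prod_unfold)
  have sm2: "(\<lambda>i. s i * q powi e2 i) summable_on quadrants"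
    using quadrants_summable[OF q(1), of 18 5 18 4] q by (simp add: e2_def s_def case_prod_unfold)
  have smF: "(\<lambda>p. zeta6 powi M2_rank p * q powi int (sum_mset p)) summable_on NRO"
    unfolding power_int_of_nat using q by (intro summable_NRO[where B = 1]) auto
  have F: "rank_gf w = (\<Sum>\<^sub>\<infinity>p\<in>NRO. zeta6 powi M2_rank p * w powi int (sum_mset p))" for w
    by (simp only: rank_gf_def power_int_of_nat)
  have w3: "(omega\<^sup>2) ^ 3 = 1" using power_mult[of omega 3 2] power_mult[of omega 2 3] by (simp add: omega_cubed)
  have "3 * (euler12 q * rank_gf2 q) = euler12 q * (rank_gf q + omega * rank_gf (omega * q) + omega\<^sup>2 * rank_gf (omega\<^sup>2 * q))"
    unfolding F infsum_residue2[OF smF] by (simp add: rank_gf2_def)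
  also have "\<dots> = euler12 q * rank_gf q + omega * (euler12 (omega * q) * rank_gf (omega * q)) + omega\<^sup>2 * (euler12 (omega\<^sup>2 * q) * rank_gf (omega\<^sup>2 * q))"
    unfolding euler12_rotate[OF omega_cubed] euler12_rotate[OF w3] by (simp add: algebra_simps)
  also have "\<dots> = ((\<Sum>\<^sub>\<infinity>i\<in>quadrants. s i * q powi e1 i) + omega * (\<Sum>\<^sub>\<infinity>i\<in>quadrants. s i * (omega * q) powi e1 i)
        + omega\<^sup>2 * (\<Sum>\<^sub>\<infinity>i\<in>quadrants. s i * (omega\<^sup>2 * q) powi e1 i))
      + ((\<Sum>\<^sub>\<infinity>i\<in>quadrants. s i * q powi e2 i) + omega * (\<Sum>\<^sub>\<infinity>i\<in>quadrants. s i * (omega * q) powi e2 i)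
        + omega\<^sup>2 * (\<Sum>\<^sub>\<infinity>i\<in>quadrants. s i * (omega\<^sup>2 * q) powi e2 i))"
  proof -
    have "norm q = norm q" "norm (omega * q) = norm q" "norm (omega\<^sup>2 * q) = norm q"
      by (simp_all add: norm_mult norm_power)
    then show ?thesis
      unfolding L[OF \<open>norm q = norm q\<close>] L[OF \<open>norm (omega * q) = norm q\<close>] L[OF \<open>norm (omega\<^sup>2 * q) = norm q\<close>]
      by (simp only: distrib_left add_ac)
  qed
  also have "\<dots> = 3 * (q\<^sup>2 * appell 1 (q ^ 3)) + 3 * (q\<^sup>2 * appell 5 (q ^ 3))"
  proof -
    have m1: "(18 * t\<^sup>2 + 6 * t + 0 + (12 * t + 1) * l) mod 3 = 2 \<longleftrightarrow> l mod 3 = 2" for t l :: int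
    proof -
      have "18 * t\<^sup>2 + 6 * t + 0 + (12 * t + 1) * l = 3 * (6 * t\<^sup>2 + 2 * t + 4 * t * l) + l"
        by (simp add: algebra_simps)
      then show ?thesis by (simp only: mod_mult_self4)
    qed
    have m2: "(18 * t\<^sup>2 + 18 * t + 4 + (12 * t + 5) * l) mod 3 = 2 \<longleftrightarrow> l mod 3 = 2" for t l :: int
    proof -
      have "18 * t\<^sup>2 + 18 * t + 4 + (12 * t + 5) * l = 3 * (6 * t\<^sup>2 + 6 * t + 4 * t * l) + (5 * l + 4)"
        by (simp add: algebra_simps)
      moreover have "(5 * l + 4) mod 3 = 2 \<longleftrightarrow> l mod 3 = 2" by presburger
      ultimately show ?thesis by (simp only: mod_mult_self4)
    qed
    have "(\<Sum>\<^sub>\<infinity>i\<in>{i \<in> quadrants. e1 i mod 3 = 2}. s i * q powi e1 i) = q\<^sup>2 * appell 1 (q ^ 3)"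
      unfolding e1_def s_def appell_def by (rule quadrants_residue2[OF q(1) m1]) (simp add: algebra_simps)
    moreover have "(\<Sum>\<^sub>\<infinity>i\<in>{i \<in> quadrants. e2 i mod 3 = 2}. s i * q powi e2 i) = q\<^sup>2 * appell 5 (q ^ 3)"
      unfolding e2_def s_def appell_def by (rule quadrants_residue2[OF q(1) m2]) (simp add: algebra_simps)
    ultimately show ?thesis
      unfolding infsum_residue2[OF sm1] infsum_residue2[OF sm2] by simp
  qed
  finally have "3 * (euler12 q * rank_gf2 q) = 3 * (q\<^sup>2 * (appell 1 (q ^ 3) + appell 5 (q ^ 3)))"
    by (simp only: distrib_left)
  then show ?thesis by simp
qed

subsection \<open>Multiplication by a theta function\<close>

text \<open>The continuation to negative \<open>M\<close> is the one for which passing from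
  \<open>M\<close> to \<open>M + 1\<close> adds the same term at every integer; the value at
  \<open>M = - 1\<close> is 0.\<close>

definition partial_theta :: "complex \<Rightarrow> int \<Rightarrow> complex" where
  "partial_theta y M = (if M \<ge> 0 then (\<Sum>l\<in>{0..M}. (- 1) powi l * y powi (- 6 * l\<^sup>2 - 9 * l))
     else - (\<Sum>l\<in>{M + 1..- 1}. (- 1) powi l * y powi (- 6 * l\<^sup>2 - 9 * l)))"

lemma partial_theta_Suc:
  "partial_theta y (M + 1) = partial_theta y M + (- 1) powi (M + 1) * y powi (- 6 * (M + 1)\<^sup>2 - 9 * (M + 1))"
proof -
  consider "M \<ge> 0" | "M = - 1" | "M < - 1" by linarith
  then show ?thesis
  proof cases
    case 1
    then have "{0..M + 1} = insert (M + 1) {0..M}" by auto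
    then show ?thesis using 1 by (simp add: partial_theta_def)
  next
    case 2
    then show ?thesis by (simp add: partial_theta_def)
  next
    case 3
    then have "{M + 1..- 1} = insert (M + 1) {M + 1 + 1..- 1}" by auto
    then show ?thesis using 3 by (simp add: partial_theta_def)
  qed
qed

lemma partial_theta_minus1: "partial_theta y (- 1) = 0"
  by (simp add: partial_theta_def)

text \<open>This is psi(-y^3), so for \<open>y = q^3\<close> it is the inverse of
  \<open>gf (q^9)\<close>.\<close>

definition psi6 :: "complex \<Rightarrow> complex" where
  "psi6 y = (\<Sum>\<^sub>\<infinity>k. (- 1) powi k * y powi (6 * k\<^sup>2 + 3 * k))"

text \<open>
  A solution of \<open>V\<^sub>M - V\<^bsub>M-1\<^esub> = \<psi>(-y\<^sup>3) (-1)\<^sup>M y\<^bsup>-6M\<^sup>2-9M\<^esup> + y\<^sup>3\<close>: shifting the summation index in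
  \<open>\<psi>(-y\<^sup>3)\<close> makes the right-hand side, up to its \<open>k = 0\<close> term, the series \<open>\<Sum>\<^sub>k (-1)\<^sup>k y\<^bsup>6k\<^sup>2-12Mk-9k+3\<^esup>\<close>,
  whose terms depend on \<open>M\<close> geometrically.
\<close>

definition theta_lift_coeff :: "complex \<Rightarrow> int \<Rightarrow> int \<Rightarrow> complex" where
  "theta_lift_coeff y M k = - ((- 1) powi k * (1 / (1 - y powi (12 * k))) * y powi (6 * k\<^sup>2 - 12 * M * k - 9 * k + 3))"

definition theta_lift :: "complex \<Rightarrow> int \<Rightarrow> complex" where
  "theta_lift y M = (\<Sum>\<^sub>\<infinity>k\<in>- {0}. theta_lift_coeff y M k)"

lemma theta_lift_coeff_summable:
  assumes y: "y \<noteq> 0" "norm y < 1 / 2"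
  shows "theta_lift_coeff y M summable_on - {0}"
proof -
  have "(\<lambda>k. - ((- 1) powi k * (1 / (1 - y powi (12 * k)))) * y powi (6 * k\<^sup>2 + (- 12 * M - 9) * k + 3)) summable_on - {0}"
  proof (rule summable_powi[where c = "(\<bar>- 12 * M - 9\<bar> + 1)\<^sup>2 + \<bar>3\<bar>" and B = 2])
    show "norm (- ((- 1) powi n * (1 / (1 - y powi (12 * n))))) \<le> 2" if "n \<in> - {0}" for n
      using powi_neq_one(2)[OF y, of "12 * n"] that by (simp add: norm_divide)
    show "\<bar>n\<bar> - ((\<bar>- 12 * M - 9\<bar> + 1)\<^sup>2 + \<bar>3\<bar>) \<le> 6 * n\<^sup>2 + (- 12 * M - 9) * n + 3" for n
      by (rule int_quadratic_ge) simp
  qed (use y in auto)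
  then show ?thesis
    unfolding theta_lift_coeff_def by (simp add: algebra_simps)
qed

lemma theta_lift_Suc:
  assumes y: "y \<noteq> 0" "norm y < 1 / 2"
  shows "theta_lift y (M + 1) = theta_lift y M + psi6 y * ((- 1) powi (M + 1) * y powi (- 6 * (M + 1)\<^sup>2 - 9 * (M + 1))) + y ^ 3"
proof -
  let ?g = "\<lambda>k. - ((- 1) powi k * y powi (6 * k\<^sup>2 - 12 * (M + 1) * k - 9 * k + 3))"
  have smg: "?g summable_on A" for A
    using summable_theta[OF y(1), of 6 "\<lambda>k. - ((- 1) powi k)" 1 "- 12 * (M + 1) - 9" 3 A] y by (simp add: algebra_simps)
  have "theta_lift y (M + 1) - theta_lift y M = (\<Sum>\<^sub>\<infinity>k\<in>- {0}. theta_lift_coeff y (M + 1) k + - theta_lift_coeff y M k)"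
    using theta_lift_coeff_summable[OF y]
    by (subst infsum_add) (auto simp: theta_lift_def infsum_uminus summable_on_uminus)
  also have "\<dots> = (\<Sum>\<^sub>\<infinity>k\<in>- {0}. ?g k)"
  proof (intro infsum_cong)
    fix k :: int assume "k \<in> - {0}"
    then have nz: "1 - y powi (12 * k) \<noteq> 0" using powi_neq_one(1)[OF y, of "12 * k"] by simp
    \<comment> \<open>Raising \<open>M\<close> by 1 divides the power of \<open>y\<close> by
      \<open>y powi (12 * k)\<close>, so the difference contains the factor
      \<open>1 - y powi (12 * k)\<close> and the denominator cancels.\<close>
    have "y powi (6 * k\<^sup>2 - 12 * M * k - 9 * k + 3) = y powi (6 * k\<^sup>2 - 12 * (M + 1) * k - 9 * k + 3) * y powi (12 * k)"
      by (rule powi_split[OF y(1)]) (simp add: algebra_simps)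
    moreover have "- (s * r * e) + - (- (s * r * (e * z))) = - (s * e) * ((1 - z) * r)" for s r e z :: complex
      by (simp add: algebra_simps)
    ultimately have "theta_lift_coeff y (M + 1) k + - theta_lift_coeff y M k = ?g k * ((1 - y powi (12 * k)) * (1 / (1 - y powi (12 * k))))"
      unfolding theta_lift_coeff_def by (simp only:)
    then show "theta_lift_coeff y (M + 1) k + - theta_lift_coeff y M k = ?g k"
      using nz by simp
  qed
  \<comment> \<open>The term omitted at \<open>k = 0\<close> is \<open>- (y ^ 3)\<close>; this is
    where the inhomogeneous term comes from.\<close>
  also have "\<dots> = infsum ?g UNIV + y ^ 3"
  proof -
    have "infsum ?g (insert 0 (- {0})) = ?g 0 + infsum ?g (- {0})"
      by (rule infsum_insert[OF smg]) simp
    moreover have "insert 0 (- {0}) = (UNIV :: int set)" by auto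
    ultimately show ?thesis by simp
  qed
  also have "infsum ?g UNIV = psi6 y * ((- 1) powi (M + 1) * y powi (- 6 * (M + 1)\<^sup>2 - 9 * (M + 1)))"
  proof -
    have "psi6 y * ((- 1) powi (M + 1) * y powi (- 6 * (M + 1)\<^sup>2 - 9 * (M + 1))) =
      (\<Sum>\<^sub>\<infinity>k. (- 1) powi k * y powi (6 * k\<^sup>2 + 3 * k) * ((- 1) powi (M + 1) * y powi (- 6 * (M + 1)\<^sup>2 - 9 * (M + 1))))"
      unfolding psi6_def by (rule infsum_cmult_left'[symmetric])
    \<comment> \<open>The shift by \<open>M + 2\<close> cancels the square
      \<open>- 6 (M + 1)^2\<close>, leaving an exponent linear in \<open>M\<close>.\<close>
    also have "\<dots> = (\<Sum>\<^sub>\<infinity>k. (- 1) powi (k + (- (M + 2))) * y powi (6 * (k + (- (M + 2)))\<^sup>2 + 3 * (k + (- (M + 2)))) * ((- 1) powi (M + 1) * y powi (- 6 * (M + 1)\<^sup>2 - 9 * (M + 1))))"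
      by (rule infsum_int_shift[symmetric])
    also have "\<dots> = infsum ?g UNIV"
    proof (intro infsum_cong)
      fix k :: int
      have "(- 1 :: complex) powi (k + (- (M + 2))) * (- 1) powi (M + 1) = (- 1) powi (k + (- (M + 2)) + (M + 1))"
        by (rule powi_split[symmetric]) auto
      also have "\<dots> = - ((- 1) powi k)" using minus1_powi_add1[of "k - 1"] by simp
      finally have s: "(- 1 :: complex) powi (k + (- (M + 2))) * (- 1) powi (M + 1) = - ((- 1) powi k)" .
      have e: "y powi (6 * (k + (- (M + 2)))\<^sup>2 + 3 * (k + (- (M + 2)))) * y powi (- 6 * (M + 1)\<^sup>2 - 9 * (M + 1)) =
        y powi (6 * k\<^sup>2 - 12 * (M + 1) * k - 9 * k + 3)"
        by (rule powi_split[OF y(1), symmetric]) (simp add: power2_eq_square algebra_simps)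
      have "(- 1) powi (k + (- (M + 2))) * y powi (6 * (k + (- (M + 2)))\<^sup>2 + 3 * (k + (- (M + 2)))) * ((- 1) powi (M + 1) * y powi (- 6 * (M + 1)\<^sup>2 - 9 * (M + 1)))
        = ((- 1 :: complex) powi (k + (- (M + 2))) * (- 1) powi (M + 1)) * (y powi (6 * (k + (- (M + 2)))\<^sup>2 + 3 * (k + (- (M + 2)))) * y powi (- 6 * (M + 1)\<^sup>2 - 9 * (M + 1)))"
        by (simp only: mult_ac)
      then show "(- 1) powi (k + (- (M + 2))) * y powi (6 * (k + (- (M + 2)))\<^sup>2 + 3 * (k + (- (M + 2)))) * ((- 1) powi (M + 1) * y powi (- 6 * (M + 1)\<^sup>2 - 9 * (M + 1))) = ?g k"
        unfolding s e by simp
    qed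
    finally show ?thesis by simp
  qed
  finally show ?thesis by (simp add: algebra_simps)
qed

text \<open>Both sides vanish at \<open>M = - 1\<close> and have equal increments; the
  \<open>y ^ 3\<close> in each increment of \<open>theta_lift\<close> accumulates to the term linear
  in \<open>M\<close>.\<close>

lemma psi6_times_partial_theta:
  assumes y: "y \<noteq> 0" "norm y < 1 / 2"
  shows "psi6 y * partial_theta y M = theta_lift y M - theta_lift y (- 1) - y ^ 3 * of_int (M + 1)"
proof (induction M rule: int_induct[of _ "- 1"])
  case base
  then show ?case by (simp add: partial_theta_minus1)
next
  case (step1 M)
  then show ?case
    unfolding partial_theta_Suc theta_lift_Suc[OF y] by (simp add: algebra_simps)
next
  case (step2 M)
  from partial_theta_Suc[of y "M - 1"] theta_lift_Suc[OF y, of "M - 1"] step2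
  show ?case by (simp add: algebra_simps)
qed

section \<open>Summation of the telescoped identity over \<open>M\<close>\<close>

abbreviation (input) outer :: "int \<Rightarrow> complex \<Rightarrow> int \<Rightarrow> complex" where
  "outer c y M \<equiv> (- 1) powi M * y powi (6 * M\<^sup>2 + (9 + c) * M + (c - 1))"

text \<open>With \<open>M = t + l\<close> the exponent separates into a function of \<open>M\<close>
  and \<open>- 6 l^2 - 9 l\<close>, the latter free of \<open>c\<close>. The range of
  \<open>l\<close> is \<open>0 <= l <= M\<close> for \<open>M >= 0\<close>, and
  \<open>M < l < 0\<close> with the opposite sign for \<open>M < 0\<close>: the two cases of
  \<open>partial_theta\<close>.\<close>

lemma appell_eq_partial_theta:
  assumes y: "y \<noteq> 0" "norm y < 1 / 2" and c: "0 < c" "c < 12"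
  shows "((\<lambda>M. outer c y M * partial_theta y M) has_sum appell c y) UNIV"
proof -
  define R where "R = (SIGMA M:UNIV. if M \<ge> 0 then {0..M} else {M + 1..- 1 :: int})"
  let ?f = "\<lambda>(t, l). sg t * (- 1) powi t * y powi (6 * t\<^sup>2 + (9 + c) * t + (c - 1) + (12 * t + c) * l)"
  let ?h = "\<lambda>M l. outer c y M * (sg M * ((- 1) powi l * y powi (- 6 * l\<^sup>2 - 9 * l)))"
  have sm: "?f summable_on quadrants"
    using y c by (intro quadrants_summable) auto
  have bij: "bij_betw (\<lambda>(M, l). (M - l, l)) R quadrants"
    by (rule bij_betw_byWitness[where f' = "\<lambda>(t, l). (t + l, l)"])
      (auto simp: R_def quadrants_def split: if_splits)
  have eq: "?f (M - l, l) = ?h M l" if "(M, l) \<in> R" for M l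
  proof -
    have "(if M - l \<ge> 0 then 1 else - 1 :: complex) = sg M"
      using that by (auto simp: R_def split: if_splits)
    moreover have "y powi (6 * (M - l)\<^sup>2 + (9 + c) * (M - l) + (c - 1) + (12 * (M - l) + c) * l) =
        y powi (6 * M\<^sup>2 + (9 + c) * M + (c - 1)) * y powi (- 6 * l\<^sup>2 - 9 * l)"
      by (rule powi_split[OF y(1)]) (simp add: power2_eq_square algebra_simps)
    ultimately show ?thesis
      unfolding prod.case minus1_powi_reflect by (simp only: mult_ac)
  qed
  have sm': "(\<lambda>(M, l). ?h M l) summable_on R"
  proof -
    have "(\<lambda>x. ?f (case x of (M, l) \<Rightarrow> (M - l, l))) summable_on R"
      using summable_on_reindex_bij_betw[OF bij, of ?f] sm by simp
    also have "?this \<longleftrightarrow> ?thesis"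
      by (rule summable_on_cong) (use eq in auto)
    finally show ?thesis .
  qed
  have inner: "infsum (?h M) (if M \<ge> 0 then {0..M} else {M + 1..- 1}) = outer c y M * partial_theta y M" for M
    by (simp add: partial_theta_def sum_distrib_left sum_negf)
  have "appell c y = infsum (\<lambda>x. ?f (case x of (M, l) \<Rightarrow> (M - l, l))) R"
    unfolding appell_def using infsum_reindex_bij_betw[OF bij, of ?f] by simp
  also have "\<dots> = infsum (\<lambda>(M, l). ?h M l) R"
    by (rule infsum_cong) (use eq in auto)
  also have "\<dots> = (\<Sum>\<^sub>\<infinity>M. infsum (?h M) (if M \<ge> 0 then {0..M} else {M + 1..- 1}))"
    unfolding R_def by (rule infsum_Sigma'_banach[symmetric]) (use sm' R_def in simp)
  finally have "appell c y = (\<Sum>\<^sub>\<infinity>M. outer c y M * partial_theta y M)"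
    unfolding inner .
  moreover have "(\<lambda>M. infsum (?h M) (if M \<ge> 0 then {0..M} else {M + 1..- 1})) summable_on UNIV"
    by (rule summable_on_Sigma_banach) (use sm' R_def in simp)
  ultimately show ?thesis
    unfolding inner by (simp add: has_sum_infsum)
qed

text \<open>For \<open>c = 1\<close>, and for \<open>c = 5\<close> after \<open>t -> - t\<close>,
  the pentagonal number series in \<open>y^4\<close>; with \<open>y = q^3\<close> it is
  \<open>euler12 q\<close>.\<close>

definition euler4 :: "int \<Rightarrow> complex \<Rightarrow> complex" where
  "euler4 c y = (\<Sum>\<^sub>\<infinity>t. (- 1) powi t * y powi (6 * t\<^sup>2 + (c - 3) * t))"

text \<open>
  The weighted series comes from the \<open>y\<^sup>3\<close> terms in the telescoping sum; the two instances \<open>c = 1\<close> and \<open>c = 5\<close> cancel.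
\<close>

definition euler4' :: "int \<Rightarrow> complex \<Rightarrow> complex" where
  "euler4' c y = (\<Sum>\<^sub>\<infinity>t. of_int t * ((- 1) powi t * y powi (6 * t\<^sup>2 + (c - 3) * t)))"

definition lambert12 :: "int \<Rightarrow> complex \<Rightarrow> complex" where
  "lambert12 c y = (\<Sum>\<^sub>\<infinity>k\<in>- {0}. y powi (c * k) / (1 - y powi (12 * k)))"

lemma outer_shift:
  assumes "y \<noteq> 0"
  shows "outer c y (t + (- 1)) = - (y powi (- 4)) * ((- 1) powi t * y powi (6 * t\<^sup>2 + (c - 3) * t))"
proof -
  have "y powi (6 * (t + (- 1))\<^sup>2 + (9 + c) * (t + (- 1)) + (c - 1)) = y powi (- 4) * y powi (6 * t\<^sup>2 + (c - 3) * t)"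
    by (rule powi_split[OF assms]) (simp add: power2_eq_square algebra_simps)
  moreover have "(- 1 :: complex) powi (t + (- 1)) = - ((- 1) powi t)"
    using minus1_powi_add1[of "t - 1"] by simp
  ultimately show ?thesis by (simp only:) simp
qed

lemma outer_summable:
  assumes "y \<noteq> 0" "norm y < 1 / 2"
  shows "(\<lambda>M. outer c y M) summable_on UNIV"
  using summable_theta[OF assms(1), of 6 "\<lambda>M. (- 1) powi M" 1 "9 + c" "c - 1"] assms by (simp add: add.assoc)

lemma infsum_outer:
  assumes "y \<noteq> 0"
  shows "(\<Sum>\<^sub>\<infinity>M. outer c y M) = - (y powi (- 4)) * euler4 c y"
proof -
  have "(\<Sum>\<^sub>\<infinity>M. outer c y M) = (\<Sum>\<^sub>\<infinity>t. outer c y (t + (- 1)))"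
    by (rule infsum_int_shift[symmetric])
  then show ?thesis
    unfolding outer_shift[OF assms] euler4_def by (simp only: infsum_cmult_right')
qed

lemma infsum_outer_weighted:
  assumes "y \<noteq> 0"
  shows "(\<Sum>\<^sub>\<infinity>M. of_int (M + 1) * outer c y M) = - (y powi (- 4)) * euler4' c y"
proof -
  have "(\<Sum>\<^sub>\<infinity>M. of_int (M + 1) * outer c y M) = (\<Sum>\<^sub>\<infinity>t. of_int (t + (- 1) + 1) * outer c y (t + (- 1)))"
    by (rule infsum_int_shift[symmetric])
  also have "\<dots> = (\<Sum>\<^sub>\<infinity>t. - (y powi (- 4)) * (of_int t * ((- 1) powi t * y powi (6 * t\<^sup>2 + (c - 3) * t))))"
    unfolding outer_shift[OF assms] by (intro infsum_cong) simp
  finally show ?thesis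
    unfolding euler4'_def by (simp only: infsum_cmult_right')
qed

lemma lambert12_summable:
  fixes y :: complex
  assumes y: "y \<noteq> 0" "norm y < 1 / 2" and c: "0 < c" "c < 12"
  shows "(\<lambda>k. y powi (c * k) / (1 - y powi (12 * k))) summable_on - {0}"
proof -
  \<comment> \<open>For \<open>k < 0\<close> numerator and denominator are multiplied by
    \<open>- (y powi (- 12 * k))\<close>, which makes both exponents, \<open>(c - 12) * k\<close>
    and \<open>- 12 * k\<close>, positive.\<close>
  define b where "b k = (if k > 0 then 1 / (1 - y powi (12 * k)) else - (1 / (1 - y powi (- 12 * k))))" for k
  define e where "e k = (if k > 0 then c * k else (c - 12) * k)" for k
  have "(\<lambda>k. b k * y powi e k) summable_on - {0}"
  proof (rule summable_powi[OF y(1), of _ 0 e b 2])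
    fix k :: int assume "k \<in> - {0}"
    then show "norm (b k) \<le> 2"
      using powi_neq_one(2)[OF y, of "12 * k"] powi_neq_one(2)[OF y, of "- 12 * k"] by (auto simp: b_def norm_divide)
    show "\<bar>k\<bar> - 0 \<le> e k"
    proof (cases "k > 0")
      case True
      then show ?thesis using c by (simp add: e_def)
    next
      case False
      then have "(- 1) * k \<le> (c - 12) * k"
        using c by (intro mult_right_mono_neg) auto
      then show ?thesis using False by (simp add: e_def)
    qed
  qed (use y in auto)
  also have "?this \<longleftrightarrow> ?thesis"
  proof (rule summable_on_cong)
    fix k :: int assume k: "k \<in> - {0}"
    show "b k * y powi e k = y powi (c * k) / (1 - y powi (12 * k))"
    proof (cases "k > 0")
      case True
      then show ?thesis by (simp add: b_def e_def)
    next
      case False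
      have "y powi ((c - 12) * k) = y powi (c * k) * y powi (- 12 * k)"
        by (rule powi_split[OF y(1)]) (simp add: algebra_simps)
      moreover have "y powi (12 * k) * y powi (- 12 * k) = 1"
        by (subst powi_split[OF y(1) refl, symmetric]) simp
      moreover have "y powi (12 * k) \<noteq> 1" "y powi (- 12 * k) \<noteq> 1"
        using powi_neq_one(1)[OF y, of "12 * k"] powi_neq_one(1)[OF y, of "- 12 * k"] k by auto
      moreover have "- (1 / (1 - v)) * (a * v) = a / (1 - u)" if "u * v = 1" "u \<noteq> 1" "v \<noteq> 1" for a u v :: complex
        using that by (simp add: field_simps)
      ultimately show ?thesis using False by (simp only: b_def e_def if_False)
    qed
  qed
  finally show ?thesis .
qed

text \<open>In terms of \<open>j = M - k\<close> the exponent is that of \<open>outer c y j\<close>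
  plus \<open>c * k + 3\<close>, so the double series factors into the pentagonal and the Lambert
  series.\<close>

lemma outer_times_theta_lift:
  assumes y: "y \<noteq> 0" "norm y < 1 / 2" and c: "0 < c" "c < 12"
  shows "((\<lambda>M. outer c y M * theta_lift y M) has_sum y powi (- 1) * euler4 c y * lambert12 c y) UNIV"
proof -
  let ?L = "\<lambda>k. y powi (c * k) / (1 - y powi (12 * k))"
  let ?P = "\<lambda>(j, k). - (y ^ 3) * (outer c y j * ?L k)"
  have "(\<lambda>(j, k). outer c y j * ?L k) summable_on UNIV \<times> - {0}"
    by (rule summable_on_complex_product[OF outer_summable[OF y] lambert12_summable[OF y c]])
  then have smP: "?P summable_on UNIV \<times> - {0}"
    unfolding case_prod_unfold by (rule summable_on_cmult_right)
  have bij: "bij_betw (\<lambda>(M, k). (M - k, k)) (UNIV \<times> - {0}) (UNIV \<times> - {0 :: int})"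
    by (rule bij_betw_byWitness[where f' = "\<lambda>(j, k). (j + k, k)"]) auto
  have eq: "?P (M - k, k) = outer c y M * theta_lift_coeff y M k" for M k
  proof -
    have "y powi (6 * M\<^sup>2 + (9 + c) * M + (c - 1)) * y powi (6 * k\<^sup>2 - 12 * M * k - 9 * k + 3) =
      y powi (6 * (M - k)\<^sup>2 + (9 + c) * (M - k) + (c - 1)) * y powi (c * k + 3)"
      unfolding powi_split[OF y(1) refl, symmetric] by (simp add: power2_eq_square algebra_simps)
    also have "y powi (c * k + 3) = y powi (c * k) * y ^ 3"
      using powi_split[OF y(1) refl, of "c * k" 3] by simp
    finally have e: "y powi (6 * M\<^sup>2 + (9 + c) * M + (c - 1)) * y powi (6 * k\<^sup>2 - 12 * M * k - 9 * k + 3) =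
      y powi (6 * (M - k)\<^sup>2 + (9 + c) * (M - k) + (c - 1)) * (y powi (c * k) * y ^ 3)" .
    have "outer c y M * theta_lift_coeff y M k = - ((- 1) powi M * (- 1) powi k * (1 / (1 - y powi (12 * k))) *
      (y powi (6 * M\<^sup>2 + (9 + c) * M + (c - 1)) * y powi (6 * k\<^sup>2 - 12 * M * k - 9 * k + 3)))"
      unfolding theta_lift_coeff_def by simp
    then show ?thesis
      unfolding e prod.case minus1_powi_reflect by simp
  qed
  have sm: "(\<lambda>(M, k). outer c y M * theta_lift_coeff y M k) summable_on UNIV \<times> - {0}"
    using summable_on_reindex_bij_betw[OF bij, of ?P] smP by (simp add: eq[symmetric] case_prod_unfold)
  have inner: "(\<Sum>\<^sub>\<infinity>k\<in>- {0}. outer c y M * theta_lift_coeff y M k) = outer c y M * theta_lift y M" for M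
    unfolding theta_lift_def by (rule infsum_cmult_right')
  have "(\<Sum>\<^sub>\<infinity>M. outer c y M * theta_lift y M) = infsum (\<lambda>(M, k). outer c y M * theta_lift_coeff y M k) (UNIV \<times> - {0})"
    unfolding inner[symmetric] by (rule infsum_Sigma'_banach[OF sm])
  also have "\<dots> = infsum ?P (UNIV \<times> - {0})"
    using infsum_reindex_bij_betw[OF bij, of ?P] by (simp add: eq[symmetric] case_prod_unfold)
  also have "\<dots> = - (y ^ 3) * infsum (\<lambda>(j, k). outer c y j * ?L k) (UNIV \<times> - {0})"
    unfolding case_prod_unfold by (rule infsum_cmult_right')
  also have "\<dots> = - (y ^ 3) * ((- (y powi (- 4)) * euler4 c y) * lambert12 c y)"
    unfolding infsum_complex_product[OF outer_summable[OF y] lambert12_summable[OF y c]] infsum_outer[OF y(1)] lambert12_def ..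
  also have "\<dots> = y powi (- 1) * euler4 c y * lambert12 c y"
    using powi_split[OF y(1), of "- 1" 3 "- 4"] by simp
  finally have "(\<Sum>\<^sub>\<infinity>M. outer c y M * theta_lift y M) = y powi (- 1) * euler4 c y * lambert12 c y" .
  moreover have "(\<lambda>M. outer c y M * theta_lift y M) summable_on UNIV"
    using summable_on_Sigma_banach[OF sm] unfolding inner .
  ultimately show ?thesis by (simp only: has_sum_iff)
qed

text \<open>Summing \<open>psi6_times_partial_theta\<close> against \<open>outer c y M\<close> turns
  its three terms into the Lambert product, the multiple of \<open>theta_lift y (- 1)\<close> and
  the weighted series.\<close>

lemma psi6_times_appell:
  assumes y: "y \<noteq> 0" "norm y < 1 / 2" and c: "0 < c" "c < 12"
  shows "y * psi6 y * appell c y = euler4 c y * (lambert12 c y + y powi (- 3) * theta_lift y (- 1)) + euler4' c y"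
proof -
  have h1: "((\<lambda>M. outer c y M * theta_lift y M) has_sum y powi (- 1) * euler4 c y * lambert12 c y) UNIV"
    by (rule outer_times_theta_lift[OF y c])
  have h2: "((\<lambda>M. (- theta_lift y (- 1)) * outer c y M) has_sum (- theta_lift y (- 1)) * (- (y powi (- 4)) * euler4 c y)) UNIV"
    unfolding infsum_outer[OF y(1), symmetric]
    by (intro has_sum_cmult_right has_sum_infsum outer_summable[OF y])
  have h3: "((\<lambda>M. (- psi6 y) * (outer c y M * partial_theta y M)) has_sum (- psi6 y) * appell c y) UNIV"
    by (intro has_sum_cmult_right appell_eq_partial_theta[OF y c])
  have "outer c y M * theta_lift y M + (- theta_lift y (- 1)) * outer c y M + (- psi6 y) * (outer c y M * partial_theta y M) = y ^ 3 * (of_int (M + 1) * outer c y M)" for M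
  proof -
    have "outer c y M * theta_lift y M + (- theta_lift y (- 1)) * outer c y M + (- psi6 y) * (outer c y M * partial_theta y M) =
      outer c y M * (theta_lift y M - theta_lift y (- 1) - psi6 y * partial_theta y M)"
      by (simp add: algebra_simps)
    then show ?thesis
      unfolding psi6_times_partial_theta[OF y] by simp
  qed
  then have "((\<lambda>M. y ^ 3 * (of_int (M + 1) * outer c y M)) has_sum
    (y powi (- 1) * euler4 c y * lambert12 c y + (- theta_lift y (- 1)) * (- (y powi (- 4)) * euler4 c y) + (- psi6 y) * appell c y)) UNIV"
    using has_sum_add[OF has_sum_add[OF h1 h2] h3] by (simp only:)
  then have "y ^ 3 * (- (y powi (- 4)) * euler4' c y) =
    y powi (- 1) * euler4 c y * lambert12 c y + (- theta_lift y (- 1)) * (- (y powi (- 4)) * euler4 c y) + (- psi6 y) * appell c y"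
    unfolding infsum_outer_weighted[OF y(1), symmetric] infsum_cmult_right'[symmetric] by (rule infsumI)
  then have "y * (y ^ 3 * (- (y powi (- 4)) * euler4' c y)) =
    y * (y powi (- 1) * euler4 c y * lambert12 c y + (- theta_lift y (- 1)) * (- (y powi (- 4)) * euler4 c y) + (- psi6 y) * appell c y)"
    by simp
  moreover have "y * y ^ 3 * y powi (- 4) = 1" "y * y powi (- 1) = 1" "y * y powi (- 4) = y powi (- 3)"
    using y(1) powi_split[OF y(1), of "- 3" 1 "- 4"] by (simp_all add: power_int_minus field_simps power_eq_if)
  moreover have "y * Y * A = E * (L + Z * W) + D"
    if "y * (Q * (- V * D)) = y * (U * E * L + (- W) * (- V * E) + (- Y) * A)" "y * Q * V = 1" "y * U = 1" "y * V = Z" for Q V D U E L W Y A Z :: complex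
  proof -
    have "y * Y * A = (y * U) * E * L + (y * V) * W * E + (y * Q * V) * D"
      using that(1) by (simp add: algebra_simps)
    then show ?thesis unfolding that(2-4) by (simp add: algebra_simps)
  qed
  ultimately show ?thesis by blast
qed

section \<open>Combination of the cases \<open>c = 1\<close> and \<open>c = 5\<close>\<close>

lemma euler4_sym: "euler4 5 y = euler4 1 y"
  unfolding euler4_def
  by (subst infsum_int_minus[symmetric]) (simp add: algebra_simps)

lemma euler4'_antisym: "euler4' 5 y = - euler4' 1 y"
  unfolding euler4'_def
  by (subst infsum_int_minus[symmetric]) (simp add: infsum_uminus algebra_simps)

definition correction :: "complex \<Rightarrow> complex" where
  "correction w = - (\<Sum>\<^sub>\<infinity>k\<in>- {0}. (- 1) powi k * w powi (2 * k\<^sup>2 + k) / (1 - w powi (4 * k)))"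

lemma power3_powi: "(y ^ 3 :: complex) powi k = y powi (3 * k)"
  by (simp add: power_int_mult)

text \<open>At \<open>M = - 1\<close> the exponents are \<open>6 k^2 + 3 k + 3\<close> and
  \<open>12 k\<close>, all divisible by 3. So this piece is a function of \<open>y^3 = q^9\<close>,
  the property on which the final comparison of coefficients rests.\<close>

lemma theta_lift_minus1:
  assumes "y \<noteq> 0"
  shows "y powi (- 3) * theta_lift y (- 1) = correction (y ^ 3)"
proof -
  have "y powi (- 3) * theta_lift y (- 1) = (\<Sum>\<^sub>\<infinity>k\<in>- {0}. y powi (- 3) * theta_lift_coeff y (- 1) k)"
    unfolding theta_lift_def by (rule infsum_cmult_right'[symmetric])
  also have "\<dots> = (\<Sum>\<^sub>\<infinity>k\<in>- {0}. - ((- 1) powi k * (y ^ 3) powi (2 * k\<^sup>2 + k) / (1 - (y ^ 3) powi (4 * k))))"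
  proof (intro infsum_cong)
    fix k :: int
    have "y powi (6 * k\<^sup>2 - 12 * (- 1) * k - 9 * k + 3) * y powi (- 3) = y powi (3 * (2 * k\<^sup>2 + k))"
      by (rule powi_split[OF assms, symmetric]) simp
    then show "y powi (- 3) * theta_lift_coeff y (- 1) k = - ((- 1) powi k * (y ^ 3) powi (2 * k\<^sup>2 + k) / (1 - (y ^ 3) powi (4 * k)))"
      unfolding theta_lift_coeff_def power3_powi by (simp add: mult.commute mult.left_commute)
  qed
  finally show ?thesis
    unfolding correction_def by (simp add: infsum_uminus)
qed

text \<open>For \<open>t\<close> nonzero the exponent is at least \<open>|t| + 3\<close>, so the
  terms other than 1 add up to at most \<open>2 |q|^4 / (1 - |q|)\<close>, which stays below
  1.\<close>

lemma euler12_nonzero: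
  assumes q: "q \<noteq> 0" "norm q < 1 / 2"
  shows "euler12 q \<noteq> 0"
proof -
  let ?f = "\<lambda>t. (- 1) powi t * q powi (18 * t\<^sup>2 - 6 * t)"
  let ?g = "\<lambda>t::int. norm q ^ 3 * norm q ^ nat \<bar>t\<bar>"
  have smf: "?f summable_on A" for A
    using summable_theta[OF q(1), of 18 "\<lambda>t. (- 1) powi t" 1 "- 6" 0] q by simp
  have euler: "euler12 q = 1 + infsum ?f (- {0})"
  proof -
    have "infsum ?f (insert 0 (- {0})) = ?f 0 + infsum ?f (- {0})"
      by (rule infsum_insert[OF smf]) simp
    moreover have "insert 0 (- {0}) = (UNIV :: int set)" by auto
    ultimately show ?thesis by (simp add: euler12_def)
  qed
  have geo: "((\<lambda>n. norm q ^ n) has_sum norm q / (1 - norm q)) {1..}"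
    using q by (intro has_sum_geometric_from_1) auto
  have pos: "((\<lambda>t::int. norm q ^ nat \<bar>t\<bar>) has_sum norm q / (1 - norm q)) {0<..}"
    using geo by (subst has_sum_reindex_bij_witness[of _ int nat "{1..}" "\<lambda>n. norm q ^ n" _ _ "norm q / (1 - norm q)"]) auto
  have neg: "((\<lambda>t::int. norm q ^ nat \<bar>t\<bar>) has_sum norm q / (1 - norm q)) {..<0}"
    using geo by (subst has_sum_reindex_bij_witness[of _ "\<lambda>n. - int n" "\<lambda>t. nat (- t)" "{1..}" "\<lambda>n. norm q ^ n" _ _ "norm q / (1 - norm q)"]) auto
  have U: "{0<..} \<union> {..<0} = - {0 :: int}" by auto
  have "((\<lambda>t::int. norm q ^ nat \<bar>t\<bar>) has_sum (norm q / (1 - norm q) + norm q / (1 - norm q))) (- {0})"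
    unfolding U[symmetric] by (rule has_sum_Un_disjoint[OF pos neg]) auto
  then have hg: "(?g has_sum norm q ^ 3 * (norm q / (1 - norm q) + norm q / (1 - norm q))) (- {0})"
    by (rule has_sum_cmult_right)
  have "norm (infsum ?f (- {0})) \<le> norm q ^ 3 * (norm q / (1 - norm q) + norm q / (1 - norm q))"
  proof (rule norm_infsum_le[OF has_sum_infsum[OF smf] hg])
    fix t :: int assume "t \<in> - {0}"
    then have t: "\<bar>t\<bar> \<ge> 1" by auto
    have "18 * t\<^sup>2 - 6 * t \<ge> 12 * \<bar>t\<bar>"
    proof -
      have "t\<^sup>2 = \<bar>t\<bar> * \<bar>t\<bar>" by (simp add: power2_eq_square)
      moreover have "\<bar>t\<bar> * 1 \<le> \<bar>t\<bar> * \<bar>t\<bar>" using t by (intro mult_left_mono) auto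
      ultimately show ?thesis by linarith
    qed
    then have "\<bar>t\<bar> - (- 3) \<le> 18 * t\<^sup>2 - 6 * t" using t by linarith
    from norm_powi_le[OF q(1) _ this] q show "norm (?f t) \<le> ?g t"
      by (simp add: norm_mult)
  qed
  also have "\<dots> < 1"
  proof -
    have "norm q / (1 - norm q) \<le> 1" using q by (simp add: field_simps)
    moreover have "norm q ^ 3 \<le> (1 / 2) ^ 3" using q by (intro power_mono) auto
    moreover have "0 \<le> norm q / (1 - norm q)" using q by simp
    ultimately have "norm q ^ 3 * (norm q / (1 - norm q) + norm q / (1 - norm q)) \<le> (1 / 2) ^ 3 * (1 + 1)"
      by (intro mult_mono add_mono) auto
    then show ?thesis by (simp add: power3_eq_cube)
  qed
  finally have "norm (infsum ?f (- {0})) < 1" .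
  then show ?thesis
    unfolding euler by (metis add_eq_0_iff norm_minus_cancel norm_one less_irrefl)
qed

text \<open>In the sum over \<open>c = 1\<close> and \<open>c = 5\<close> the pentagonal factors
  both equal \<open>euler12 q\<close> and can be divided out, and the weighted series cancel;
  multiplication by \<open>gf (q^9)\<close> then removes \<open>psi6\<close>.\<close>

lemma rank_gf2_formula:
  assumes q: "q \<noteq> 0" "norm q < 1 / 2"
  shows "q * rank_gf2 q = gf (q ^ 9) * (lambert12 1 (q ^ 3) + lambert12 5 (q ^ 3) + 2 * correction (q ^ 9))"
proof -
  define y where "y = q ^ 3"
  have nrm: "norm (q ^ n) < 1 / 2" if "n \<ge> 1" for n
  proof -
    have "norm q ^ n \<le> norm q ^ 1"
      using q that by (intro power_decreasing) auto
    then show ?thesis using q by (simp add: norm_power)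
  qed
  have y: "y \<noteq> 0" "norm y < 1 / 2" using q nrm by (auto simp: y_def)
  have y3: "y ^ 3 = q ^ 9" by (simp add: y_def flip: power_mult)
  have psi: "gf (q ^ 9) * psi6 y = 1"
  proof -
    have "psi6 y = (\<Sum>\<^sub>\<infinity>k. (- 1) powi k * (q ^ 9) powi (2 * k\<^sup>2 + k))"
      unfolding psi6_def y3[symmetric] power3_powi by (simp add: algebra_simps)
    then show ?thesis using gf_times_psi[of "q ^ 9"] q nrm by simp
  qed
  have e12: "euler4 1 y = euler12 q"
    unfolding euler4_def euler12_def y_def power3_powi by (simp add: algebra_simps)
  have "y * psi6 y * (appell 1 y + appell 5 y) = y * psi6 y * appell 1 y + y * psi6 y * appell 5 y"
    by (rule distrib_left)
  also have "\<dots> = euler12 q * (lambert12 1 y + lambert12 5 y + 2 * correction (q ^ 9))"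
    unfolding psi6_times_appell[OF y, of 1, simplified] psi6_times_appell[OF y, of 5, simplified]
      theta_lift_minus1[OF y(1), simplified] euler4_sym euler4'_antisym e12 y3 by (simp add: algebra_simps)
  finally have *: "y * psi6 y * (appell 1 y + appell 5 y) = euler12 q * (lambert12 1 y + lambert12 5 y + 2 * correction (q ^ 9))" .
  have "euler12 q * (q * rank_gf2 q * psi6 y) = y * psi6 y * (appell 1 y + appell 5 y)"
    using euler12_times_rank_gf2[OF q] by (simp add: y_def power3_eq_cube power2_eq_square mult_ac)
  then have "q * rank_gf2 q * psi6 y = lambert12 1 y + lambert12 5 y + 2 * correction (q ^ 9)"
    unfolding * using euler12_nonzero[OF q] by simp
  then have "gf (q ^ 9) * (lambert12 1 y + lambert12 5 y + 2 * correction (q ^ 9)) = q * rank_gf2 q * (gf (q ^ 9) * psi6 y)"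
    by (simp add: mult_ac)
  then show ?thesis unfolding psi by (simp add: y_def)
qed

subsection \<open>Divisor sums\<close>

definition chi12 :: "nat \<Rightarrow> int" where
  "chi12 d = (if d mod 12 = 1 \<or> d mod 12 = 5 then 1 else if d mod 12 = 7 \<or> d mod 12 = 11 then - 1 else 0)"

lemma chi12_mult: "chi12 (a * b) = chi12 a * chi12 b"
proof -
  have "\<forall>a\<in>{..<12}. \<forall>b\<in>{..<12}. chi12 (a * b) = chi12 a * chi12 b"
    by (simp add: lessThan_nat_numeral lessThan_Suc chi12_def)
  then have *: "chi12 ((a mod 12) * (b mod 12)) = chi12 (a mod 12) * chi12 (b mod 12)"
    by simp
  have cm: "chi12 (n mod 12) = chi12 n" for n
    by (simp add: chi12_def)
  have "chi12 (a * b) = chi12 (((a mod 12) * (b mod 12)) mod 12)"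
    unfolding mod_mult_eq cm ..
  then show ?thesis
    unfolding cm * .
qed

lemma chi12_power: "chi12 (p ^ i) = chi12 p ^ i"
  by (induction i) (simp_all add: chi12_mult, simp add: chi12_def)

text \<open>Splitting off the full power \<open>p^a\<close> of a prime factors the sum into
  \<open>1 + x + ... + x^a\<close>, with \<open>x = chi12 p\<close>, and the sum for
  \<open>m\<close>. As \<open>x\<close> is -1, 0 or 1, the first factor is nonnegative; for -1 it
  alternates between 1 and 0.\<close>

lemma chi12_divisor_sum_nonneg: "n > 0 \<Longrightarrow> (\<Sum>d | d dvd n. chi12 d) \<ge> 0"
proof (induction n rule: less_induct)
  case (less n)
  show ?case
  proof (cases "n = 1")
    case True
    then show ?thesis by (simp add: chi12_def)
  next
    case False
    then obtain p where p: "prime p" "p dvd n" using prime_factor_nat by blast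
    define a where "a = multiplicity p n"
    have "n \<noteq> 0" "\<not> is_unit p" using less.prems p(1) by auto
    then obtain m where m: "n = p ^ a * m" "\<not> p dvd m"
      unfolding a_def by (rule multiplicity_decompose')
    have "a > 0" using m p by (auto intro: gr0I)
    have "m > 0" using m less.prems by (auto intro: gr0I)
    moreover have "m < n"
    proof -
      have "1 < p ^ a" using prime_gt_1_nat[OF p(1)] \<open>a > 0\<close> by (rule one_less_power)
      then show ?thesis using m(1) \<open>m > 0\<close> by simp
    qed
    ultimately have IH: "(\<Sum>d | d dvd m. chi12 d) \<ge> 0" using less.IH by blast
    have inj: "inj_on (\<lambda>(i, e). p ^ i * e) ({..a} \<times> {e. e dvd m})"
    proof (rule inj_onI, clarify)
      fix i e j f assume *: "e dvd m" "f dvd m" "p ^ i * e = p ^ j * f"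
      have nd: "\<not> p dvd e" "\<not> p dvd f" using * m(2) dvd_trans by blast+
      then have "e \<noteq> 0" "f \<noteq> 0" using dvd_0_right[of p] by metis+
      have "multiplicity p (p ^ i * e) = i" "multiplicity p (p ^ j * f) = j"
        using nd \<open>e \<noteq> 0\<close> \<open>f \<noteq> 0\<close> p(1)
        by (simp_all add: prime_elem_multiplicity_mult_distrib not_dvd_imp_multiplicity_0)
      then have "i = j" using *(3) by simp
      then show "i = j \<and> e = f" using *(3) p(1) by (auto simp: prime_gt_0_nat)
    qed
    have img: "{d. d dvd n} = (\<lambda>(i, e). p ^ i * e) ` ({..a} \<times> {e. e dvd m})"
    proof (intro equalityI subsetI)
      fix d assume "d \<in> {d. d dvd n}"
      then obtain b e where "d = b * e" "b dvd p ^ a" "e dvd m"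
        using m(1) division_decomp by blast
      moreover from this obtain i where "i \<le> a" "b = p ^ i"
        using divides_primepow_nat[OF p(1)] by blast
      ultimately show "d \<in> (\<lambda>(i, e). p ^ i * e) ` ({..a} \<times> {e. e dvd m})" by auto
    qed (auto simp: m(1) intro: mult_dvd_mono le_imp_power_dvd)
    have "(\<Sum>d | d dvd n. chi12 d) = (\<Sum>(i, e)\<in>{..a} \<times> {e. e dvd m}. chi12 p ^ i * chi12 e)"
      unfolding img sum.reindex[OF inj] by (simp add: case_prod_unfold chi12_mult chi12_power)
    also have "\<dots> = (\<Sum>i\<le>a. chi12 p ^ i) * (\<Sum>d | d dvd m. chi12 d)"
      by (simp add: sum_product sum.cartesian_product)
    also have "\<dots> \<ge> 0"
    proof -
      have "chi12 p = 1 \<or> chi12 p = 0 \<or> chi12 p = - 1" by (simp add: chi12_def)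
      moreover have "(\<Sum>i\<le>a. (- 1) ^ i :: int) \<ge> 0"
      proof -
        have "(\<Sum>i\<le>k. (- 1) ^ i :: int) = (if even k then 1 else 0)" for k
          by (induction k) auto
        then show ?thesis by simp
      qed
      moreover have "(\<Sum>i\<le>a. 0 ^ i :: int) \<ge> 0" by (intro sum_nonneg) simp
      ultimately have "(\<Sum>i\<le>a. chi12 p ^ i) \<ge> 0" by auto
      then show ?thesis using IH by simp
    qed
    finally show ?thesis .
  qed
qed

lemma has_sum_chi12:
  fixes x :: complex
  assumes "norm x < 1"
  shows "((\<lambda>d. of_int (chi12 d) * x ^ d) has_sum (x + x ^ 5 - x ^ 7 - x ^ 11) / (1 - x ^ 12)) {1..}"
proof -
  let ?f = "\<lambda>d. of_int (chi12 d) * x ^ d"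
  have le: "norm (of_int (chi12 d) :: complex) \<le> 1" for d by (simp add: chi12_def)
  have "summable (\<lambda>d. norm x ^ d)" using assms by (intro summable_geometric) auto
  then have "(\<lambda>d. norm x ^ d) summable_on UNIV" by (intro summable_nonneg_imp_summable_on) auto
  then have sm: "?f summable_on A" for A
  proof (rule summable_on_subset[OF summable_on_complex_comparison])
    show "norm (?f d) \<le> norm x ^ d" for d
      using mult_right_mono[OF le, of "norm x ^ d"] by (simp add: norm_mult norm_power)
  qed auto
  have per: "chi12 (d + 12) = chi12 d" for d by (simp add: chi12_def)
  have "infsum ?f UNIV = infsum ?f {..<12} + infsum ?f {12..}"
    by (subst infsum_Un_disjoint[symmetric]) (auto intro!: sm arg_cong[where f = "infsum _"])
  also have "infsum ?f {..<12} = x + x ^ 5 - x ^ 7 - x ^ 11"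
    by (simp add: lessThan_nat_numeral lessThan_Suc chi12_def)
  also have "infsum ?f {12..} = infsum (\<lambda>d. x ^ 12 * ?f d) UNIV"
  proof (rule infsum_reindex_bij_witness[of _ "\<lambda>d. d + 12" "\<lambda>d. d - 12"])
    fix d :: nat assume "d \<in> {12..}"
    then obtain b where "d = b + 12" using le_Suc_ex by (metis add.commute atLeast_iff)
    then show "x ^ 12 * ?f (d - 12) = ?f d" using per[of b] by (simp add: power_add)
  qed auto
  also have "\<dots> = x ^ 12 * infsum ?f UNIV" by (rule infsum_cmult_right')
  finally have eq: "infsum ?f UNIV * (1 - x ^ 12) = x + x ^ 5 - x ^ 7 - x ^ 11"
    by (simp add: algebra_simps)
  have "norm (x ^ 12) < 1" using assms by (simp add: norm_power power_less_one_iff)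
  then have "1 - x ^ 12 \<noteq> 0" by auto
  then have val: "infsum ?f UNIV = (x + x ^ 5 - x ^ 7 - x ^ 11) / (1 - x ^ 12)"
    using eq by (simp add: field_simps)
  have "infsum ?f {1..} = infsum ?f UNIV"
    by (rule infsum_cong_neutral) (auto simp: chi12_def Suc_le_eq)
  then show ?thesis using sm[of "{1..}"] val by (simp add: has_sum_iff)
qed

lemma chi12_double_summable:
  fixes y :: complex
  assumes "y \<noteq> 0" "norm y < 1"
  shows "(\<lambda>(k, d). of_int (chi12 d) * y ^ (k * d)) summable_on {1..} \<times> {1..}"
proof (rule summable_on_complex_comparison)
  have "(\<lambda>n. norm y ^ n) summable_on {1..}"
    using has_sum_geometric_from_1[of "norm y"] assms by (auto simp: summable_on_def)
  then have "(\<lambda>(k, d). norm y ^ k * norm y ^ d) summable_on {1..} \<times> {1..}"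
    by (intro summable_on_product_mult) auto
  then show "(\<lambda>x. (1 / norm y) * (case x of (k, d) \<Rightarrow> norm y ^ k * norm y ^ d)) summable_on {1..} \<times> {1..}"
    by (rule summable_on_cmult_right)
  fix x :: "nat \<times> nat" assume "x \<in> {1..} \<times> {1..}"
  then obtain k d where x: "x = (Suc k, Suc d)"
    by (cases x) (metis atLeast_iff mem_Sigma_iff Suc_le_D One_nat_def)
  have "norm (of_int (chi12 (Suc d)) :: complex) \<le> 1" by (simp add: chi12_def)
  then have "norm (of_int (chi12 (Suc d)) * y ^ (Suc k * Suc d)) \<le> norm y ^ (Suc k * Suc d)"
    unfolding norm_mult norm_power by (intro mult_left_le_one_le) auto
  \<comment> \<open>Positive \<open>k\<close> and \<open>d\<close> satisfy
    \<open>k d >= k + d - 1\<close>; the 1 lost here is the factor \<open>1 / norm y\<close> of the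
    bound.\<close>
  also have "norm y ^ (Suc k * Suc d) \<le> norm y ^ (Suc k + d)"
    using assms by (intro power_decreasing) auto
  also have "norm y ^ (Suc k + d) = (1 / norm y) * (norm y ^ Suc k * norm y ^ Suc d)"
    using assms by (simp add: power_add)
  finally show "norm (case x of (k, d) \<Rightarrow> of_int (chi12 d) * y ^ (k * d)) \<le>
      (1 / norm y) * (case x of (k, d) \<Rightarrow> norm y ^ k * norm y ^ d)"
    unfolding x prod.case .
qed

lemma powi_nat_mult:
  fixes y :: complex
  shows "y powi (int c * int k) = (y ^ k) ^ c" "y powi (int c * (- int k)) = 1 / (y ^ k) ^ c"
proof -
  have "int c * int k = int (k * c)" by simp
  then show *: "y powi (int c * int k) = (y ^ k) ^ c"
    by (simp only: power_int_of_nat power_mult)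
  have "int c * (- int k) = - (int c * int k)" by simp
  then show "y powi (int c * (- int k)) = 1 / (y ^ k) ^ c"
    by (simp only: power_int_minus * inverse_eq_divide)
qed

text \<open>The negative indices fold onto positive \<open>k\<close> and contribute the residue
  \<open>12 - c\<close> with a minus sign; \<open>c = 1\<close> and \<open>c = 5\<close> thus supply
  the residues 1, 11 and 5, 7 on which \<open>chi12\<close> is supported.\<close>

lemma lambert12_as_nat_sum:
  fixes y :: complex
  assumes y: "y \<noteq> 0" "norm y < 1 / 2" and c: "0 < c" "c < 12"
  shows "((\<lambda>k. ((y ^ k) ^ c - (y ^ k) ^ (12 - c)) / (1 - (y ^ k) ^ 12)) has_sum lambert12 (int c) y) {1..}"
proof -
  let ?f = "\<lambda>k. y powi (int c * k) / (1 - y powi (12 * k))"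
  have sm: "?f summable_on A" if "A \<subseteq> - {0}" for A
    by (rule summable_on_subset[OF lambert12_summable[OF y] that]) (use c in auto)
  have "{0<..} \<union> {..<0} = - {0 :: int}" by auto
  then have split: "lambert12 (int c) y = infsum ?f {0<..} + infsum ?f {..<0}"
    using infsum_Un_disjoint[OF sm[of "{0<..}"] sm[of "{..<0}"]] unfolding lambert12_def by force
  have h1: "((\<lambda>k. (y ^ k) ^ c / (1 - (y ^ k) ^ 12)) has_sum infsum ?f {0<..}) {1..}"
  proof (subst has_sum_reindex_bij_witness[of _ nat int "{0<..}" ?f _ _ "infsum ?f {0<..}"])
    fix k :: nat
    show "?f (int k) = (y ^ k) ^ c / (1 - (y ^ k) ^ 12)"
      using powi_nat_mult(1)[of y c k] powi_nat_mult(1)[of y 12 k] by (simp only: of_nat_numeral)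
  qed (use sm[of "{0<..}"] in auto)
  have h2: "((\<lambda>k. - ((y ^ k) ^ (12 - c) / (1 - (y ^ k) ^ 12))) has_sum infsum ?f {..<0}) {1..}"
  proof (subst has_sum_reindex_bij_witness[of _ "\<lambda>k. nat (- k)" "\<lambda>k. - int k" "{..<0}" ?f _ _ "infsum ?f {..<0}"])
    fix k :: nat assume k: "k \<in> {1..}"
    define x where "x = y ^ k"
    have x: "x \<noteq> 0" using y by (simp add: x_def)
    have "12 * int k \<noteq> 0" using k by simp
    then have x12: "x ^ 12 \<noteq> 1"
      using powi_neq_one(1)[OF y, of "12 * int k"] powi_nat_mult(1)[of y 12 k] by (simp only: x_def of_nat_numeral not_False_eq_True)
    have "y powi (int c * (- int k)) = 1 / x ^ c" "y powi (12 * (- int k)) = 1 / x ^ 12"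
      using powi_nat_mult(2)[of y c k] powi_nat_mult(2)[of y 12 k] by (simp_all only: x_def of_nat_numeral)
    moreover have "(1 / x ^ c) / (1 - 1 / x ^ 12) = - (x ^ (12 - c) / (1 - x ^ 12))"
    proof -
      have "x ^ 12 = x ^ c * x ^ (12 - c)" using c by (simp add: power_add[symmetric])
      moreover have "(1 / u) / (1 - 1 / (u * v)) = - (v / (1 - u * v))" if "u \<noteq> 0" "v \<noteq> 0" "u * v \<noteq> 1" for u v :: complex
        using that by (simp add: field_simps)
      ultimately show ?thesis using x x12 by simp
    qed
    ultimately show "?f (- int k) = - ((y ^ k) ^ (12 - c) / (1 - (y ^ k) ^ 12))"
      by (simp only: x_def)
  qed (use sm[of "{..<0}"] in auto)
  have "((\<lambda>k. (y ^ k) ^ c / (1 - (y ^ k) ^ 12) + - ((y ^ k) ^ (12 - c) / (1 - (y ^ k) ^ 12))) has_sum lambert12 (int c) y) {1..}"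
    unfolding split by (rule has_sum_add[OF h1 h2])
  then show ?thesis by (simp add: diff_divide_distrib)
qed

lemma lambert12_eq_chi12:
  fixes y :: complex
  assumes y: "y \<noteq> 0" "norm y < 1 / 2"
  shows "lambert12 1 y + lambert12 5 y = (\<Sum>\<^sub>\<infinity>(k, d)\<in>{1..} \<times> {1..}. of_int (chi12 d) * y ^ (k * d))"
proof -
  have "((\<lambda>k. ((y ^ k) ^ 1 - (y ^ k) ^ (12 - 1)) / (1 - (y ^ k) ^ 12) + ((y ^ k) ^ 5 - (y ^ k) ^ (12 - 5)) / (1 - (y ^ k) ^ 12))
      has_sum (lambert12 1 y + lambert12 5 y)) {1..}"
    using lambert12_as_nat_sum[OF y, of 1] lambert12_as_nat_sum[OF y, of 5] by (intro has_sum_add) auto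
  then have "lambert12 1 y + lambert12 5 y =
      (\<Sum>\<^sub>\<infinity>k\<in>{1..}. ((y ^ k) ^ 1 - (y ^ k) ^ (12 - 1)) / (1 - (y ^ k) ^ 12) + ((y ^ k) ^ 5 - (y ^ k) ^ (12 - 5)) / (1 - (y ^ k) ^ 12))"
    by (rule infsumI[symmetric])
  also have "\<dots> = (\<Sum>\<^sub>\<infinity>k\<in>{1..}. \<Sum>\<^sub>\<infinity>d\<in>{1..}. of_int (chi12 d) * y ^ (k * d))"
  proof (intro infsum_cong)
    fix k :: nat assume "k \<in> {1..}"
    then have "norm (y ^ k) < 1" using y by (simp add: norm_power power_less_one_iff)
    from infsumI[OF has_sum_chi12[OF this]]
    have "(\<Sum>\<^sub>\<infinity>d\<in>{1..}. of_int (chi12 d) * y ^ (k * d)) = (y ^ k + (y ^ k) ^ 5 - (y ^ k) ^ 7 - (y ^ k) ^ 11) / (1 - (y ^ k) ^ 12)"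
      by (simp add: power_mult)
    then show "((y ^ k) ^ 1 - (y ^ k) ^ (12 - 1)) / (1 - (y ^ k) ^ 12) + ((y ^ k) ^ 5 - (y ^ k) ^ (12 - 5)) / (1 - (y ^ k) ^ 12)
      = (\<Sum>\<^sub>\<infinity>d\<in>{1..}. of_int (chi12 d) * y ^ (k * d))"
      by (simp add: add_divide_distrib diff_divide_distrib)
  qed
  also have "\<dots> = (\<Sum>\<^sub>\<infinity>(k, d)\<in>{1..} \<times> {1..}. of_int (chi12 d) * y ^ (k * d))"
    using y by (intro infsum_Sigma'_banach chi12_double_summable) auto
  finally show ?thesis .
qed

subsection \<open>Symmetry of the rank\<close>

lemma NRO_sum_eq_partitions: "{p \<in> NRO. sum_mset p = n} = {p \<in> partitions n. no_repeated_odd_parts p}"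
  by (auto simp: NRO_def partitions_def)

lemma finite_NRO_sum: "finite {p \<in> NRO. sum_mset p = n}"
  unfolding NRO_sum_eq_partitions using finite_partitions by simp

lemma card_dyson_adjoint:
  "card {p \<in> NRO. (M2_rank p \<le> k \<and> \<not> (k = 0 \<and> p = {#})) \<and> int (sum_mset p) = m} =
   card {p \<in> NRO. (M2_rank p \<ge> k - 1 \<and> \<not> (k = 1 \<and> p = {#})) \<and> int (sum_mset p) = m + 2 * k - 1}"
    (is "card ?A = card ?B")
proof -
  have "dyson_adjoint k ` ?A = ?B"
  proof (intro equalityI subsetI)
    fix r assume "r \<in> dyson_adjoint k ` ?A"
    then obtain p where p: "p \<in> ?A" "r = dyson_adjoint k p" by blast
    then show "r \<in> ?B" using dyson_adjoint_properties[of p k] by auto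
  next
    fix r assume r: "r \<in> ?B"
    then have "r \<in> dyson_adjoint k ` {p \<in> NRO. M2_rank p \<le> k \<and> \<not> (k = 0 \<and> p = {#})}"
      using bij_betw_imp_surj_on[OF bij_betw_dyson_adjoint[of k]] by blast
    then obtain p where p: "p \<in> NRO" "M2_rank p \<le> k" "\<not> (k = 0 \<and> p = {#})" "r = dyson_adjoint k p" by blast
    moreover have "int (sum_mset p) = m" using dyson_adjoint_properties(4)[OF p(1-3)] r p(4) by simp
    ultimately show "r \<in> dyson_adjoint k ` ?A" by blast
  qed
  then have "bij_betw (dyson_adjoint k) ?A ?B"
    by (rule bij_betw_subset[OF bij_betw_dyson_adjoint[of k], rotated]) auto
  then show ?thesis by (rule bij_betw_same_card)
qed

text \<open>By the adjoint, rank at least \<open>j\<close> at weight \<open>m\<close> matches rank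
  at most \<open>j + 1\<close> at \<open>m' = m - 2 j - 1\<close>, and rank at most
  \<open>- j\<close> matches rank at least \<open>- j - 1\<close> at the same \<open>m'\<close>. The
  complements there, rank at least \<open>j + 2\<close> and at most \<open>- (j + 2)\<close>, are
  equinumerous by induction.\<close>

lemma card_rank_ge_eq_card_rank_le:
  "j \<ge> 1 \<Longrightarrow> card {p \<in> NRO. M2_rank p \<ge> j \<and> int (sum_mset p) = m} = card {p \<in> NRO. M2_rank p \<le> - j \<and> int (sum_mset p) = m}"
proof (induction "nat m" arbitrary: m j rule: less_induct)
  case less
  define m' where "m' = m - 2 * j - 1"
  define T where "T = {p \<in> NRO. int (sum_mset p) = m'}"
  have finT: "finite T"
  proof (rule finite_subset)
    show "T \<subseteq> {p \<in> NRO. sum_mset p = nat m'}" by (auto simp: T_def simp del: of_nat_sum_mset)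
  qed (rule finite_NRO_sum)
  have "card {p \<in> NRO. M2_rank p \<ge> j \<and> int (sum_mset p) = m} = card {p \<in> NRO. M2_rank p \<le> j + 1 \<and> int (sum_mset p) = m'}"
    using card_dyson_adjoint[of "j + 1" m'] less.prems by (simp add: m'_def)
  also have "{p \<in> NRO. M2_rank p \<le> j + 1 \<and> int (sum_mset p) = m'} = T - {p \<in> NRO. M2_rank p \<ge> j + 2 \<and> int (sum_mset p) = m'}"
    by (auto simp: T_def)
  also have "card \<dots> = card T - card {p \<in> NRO. M2_rank p \<ge> j + 2 \<and> int (sum_mset p) = m'}"
    using finT by (intro card_Diff_subset) (auto simp: T_def intro: finite_subset[OF _ finT])
  also have "\<dots> = card T - card {p \<in> NRO. M2_rank p \<le> - (j + 2) \<and> int (sum_mset p) = m'}"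
  proof (cases "m > 0")
    case True
    then have "nat m' < nat m" using less.prems by (simp add: m'_def)
    then show ?thesis using less.hyps[of m' "j + 2"] less.prems by simp
  next
    case False
    then have "T = {}" using less.prems by (auto simp: T_def m'_def simp del: of_nat_sum_mset)
    then show ?thesis by simp
  qed
  also have "\<dots> = card (T - {p \<in> NRO. M2_rank p \<le> - (j + 2) \<and> int (sum_mset p) = m'})"
    using finT by (intro card_Diff_subset[symmetric]) (auto simp: T_def intro: finite_subset[OF _ finT])
  also have "T - {p \<in> NRO. M2_rank p \<le> - (j + 2) \<and> int (sum_mset p) = m'} = {p \<in> NRO. M2_rank p \<ge> - j - 1 \<and> int (sum_mset p) = m'}"
    by (auto simp: T_def)
  also have "card \<dots> = card {p \<in> NRO. M2_rank p \<le> - j \<and> int (sum_mset p) = m}"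
    using card_dyson_adjoint[of "- j" m] less.prems by (simp add: m'_def)
  finally show ?case .
qed

lemma card_rank_symmetric:
  "card {p \<in> {p \<in> NRO. sum_mset p = n}. M2_rank p = j} = card {p \<in> {p \<in> NRO. sum_mset p = n}. M2_rank p = - j}"
proof -
  have pos: "card {p \<in> {p \<in> NRO. sum_mset p = n}. M2_rank p = j} = card {p \<in> {p \<in> NRO. sum_mset p = n}. M2_rank p = - j}" if "j \<ge> 1" for j
  proof -
    define A where "A i = {p \<in> NRO. M2_rank p \<ge> i \<and> int (sum_mset p) = int n}" for i
    define B where "B i = {p \<in> NRO. M2_rank p \<le> - i \<and> int (sum_mset p) = int n}" for i
    have fin: "finite (A i)" "finite (B i)" for i
      by (rule finite_subset[OF _ finite_NRO_sum[of n]]; auto simp: A_def B_def simp del: of_nat_sum_mset)+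
    have "{p \<in> {p \<in> NRO. sum_mset p = n}. M2_rank p = j} = A j - A (j + 1)"
      by (auto simp: A_def simp del: of_nat_sum_mset)
    moreover have "{p \<in> {p \<in> NRO. sum_mset p = n}. M2_rank p = - j} = B j - B (j + 1)"
      by (auto simp: B_def simp del: of_nat_sum_mset)
    moreover have "card (A j - A (j + 1)) = card (A j) - card (A (j + 1))" "card (B j - B (j + 1)) = card (B j) - card (B (j + 1))"
      by (intro card_Diff_subset fin; auto simp: A_def B_def)+
    moreover have "card (A j) = card (B j)" "card (A (j + 1)) = card (B (j + 1))"
      unfolding A_def B_def using that by (intro card_rank_ge_eq_card_rank_le; simp)+
    ultimately show ?thesis by simp
  qed
  consider "j \<ge> 1" | "j = 0" | "- j \<ge> 1" by linarith
  then show ?thesis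
  proof cases
    case 3
    then show ?thesis using pos[of "- j"] by simp
  qed (use pos in auto)
qed

lemma sum_rank_symmetric:
  fixes h :: "int \<Rightarrow> int"
  shows "(\<Sum>p | p \<in> NRO \<and> sum_mset p = n. h (M2_rank p)) = (\<Sum>p | p \<in> NRO \<and> sum_mset p = n. h (- M2_rank p))"
proof -
  define X where "X = {p \<in> NRO. sum_mset p = n}"
  define J where "J = M2_rank ` X \<union> uminus ` M2_rank ` X"
  have fin: "finite X" "finite J" using finite_NRO_sum by (auto simp: X_def J_def)
  have group: "(\<Sum>p\<in>X. f (M2_rank p)) = (\<Sum>j\<in>J. int (card {p \<in> X. M2_rank p = j}) * f j)" for f :: "int \<Rightarrow> int"
  proof -
    have "(\<Sum>p\<in>X. f (M2_rank p)) = (\<Sum>j\<in>J. \<Sum>p | p \<in> X \<and> M2_rank p = j. f (M2_rank p))"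
      by (rule sum.group[symmetric]) (auto simp: fin J_def)
    also have "\<dots> = (\<Sum>j\<in>J. int (card {p \<in> X. M2_rank p = j}) * f j)"
      by (intro sum.cong refl) simp
    finally show ?thesis .
  qed
  have "(\<Sum>p\<in>X. h (- M2_rank p)) = (\<Sum>j\<in>J. int (card {p \<in> X. M2_rank p = j}) * h (- j))"
    by (rule group)
  also have "\<dots> = (\<Sum>j\<in>J. int (card {p \<in> X. M2_rank p = - j}) * h j)"
    by (rule sum.reindex_bij_witness[of _ uminus uminus]) (auto simp: J_def)
  also have "\<dots> = (\<Sum>j\<in>J. int (card {p \<in> X. M2_rank p = j}) * h j)"
    using card_rank_symmetric[of n] by (simp add: X_def)
  also have "\<dots> = (\<Sum>p\<in>X. h (M2_rank p))" by (rule group[symmetric])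
  finally show ?thesis by (simp add: X_def)
qed

text \<open>The signs with which the four \<open>N2\<close> terms enter the claim. They are not
  symmetric in the rank, so they match powers of \<open>zeta6\<close> only after
  symmetrisation.\<close>

definition rank_weight :: "int \<Rightarrow> int" where
  "rank_weight m = (if m mod 6 = 0 \<or> m mod 6 = 1 then 1 else if m mod 6 = 2 \<or> m mod 6 = 3 then - 1 else 0)"

lemma zeta6_powi_mod6: "zeta6 powi m = zeta6 ^ nat (m mod 6)"
proof -
  have "zeta6 powi m = zeta6 powi (6 * (m div 6) + m mod 6)" by simp
  also have "\<dots> = zeta6 powi (m mod 6)" by (rule zeta6_powi_shift)
  finally show ?thesis by (simp add: power_int_nonneg_exp)
qed

lemma Re_zeta6_powi: "2 * Re (zeta6 powi m) = rank_weight m + rank_weight (- m)"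
proof -
  have Re: "Re zeta6 = 1 / 2" by (simp add: zeta6_def cos_60)
  have pow: "zeta6 ^ 2 = zeta6 - 1" "zeta6 ^ 3 = - 1" "zeta6 ^ 4 = - zeta6" "zeta6 ^ 5 = 1 - zeta6"
  proof -
    show 2: "zeta6 ^ 2 = zeta6 - 1" by (simp add: power2_eq_square zeta6_squared)
    show 3: "zeta6 ^ 3 = - 1" by (rule zeta6_cubed)
    show "zeta6 ^ 4 = - zeta6" using power_add[of zeta6 3 1] 3 by simp
    show "zeta6 ^ 5 = 1 - zeta6" using power_add[of zeta6 3 2] 3 2 by simp
  qed
  have "m mod 6 = 0 \<or> m mod 6 = 1 \<or> m mod 6 = 2 \<or> m mod 6 = 3 \<or> m mod 6 = 4 \<or> m mod 6 = 5" by presburger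
  then show ?thesis
  proof (elim disjE)
    assume "m mod 6 = 0"
    moreover from this have "(- m) mod 6 = 0" by presburger
    ultimately show ?thesis by (simp add: zeta6_powi_mod6 rank_weight_def)
  next
    assume "m mod 6 = 1"
    moreover from this have "(- m) mod 6 = 5" by presburger
    ultimately show ?thesis by (simp add: zeta6_powi_mod6 rank_weight_def Re)
  next
    assume "m mod 6 = 2"
    moreover from this have "(- m) mod 6 = 4" by presburger
    ultimately show ?thesis by (simp add: zeta6_powi_mod6 rank_weight_def pow Re)
  next
    assume "m mod 6 = 3"
    moreover from this have "(- m) mod 6 = 3" by presburger
    ultimately show ?thesis by (simp add: zeta6_powi_mod6 rank_weight_def pow Re)
  next
    assume "m mod 6 = 4"
    moreover from this have "(- m) mod 6 = 2" by presburger
    ultimately show ?thesis by (simp add: zeta6_powi_mod6 rank_weight_def pow Re)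
  next
    assume "m mod 6 = 5"
    moreover from this have "(- m) mod 6 = 1" by presburger
    ultimately show ?thesis by (simp add: zeta6_powi_mod6 rank_weight_def pow Re)
  qed
qed

text \<open>By the symmetry of the rank, \<open>rank_weight\<close> may be averaged over a rank and
  its negative, and the average is the real part of the power of \<open>zeta6\<close>.\<close>

lemma N2_difference:
  "real (N2 0 6 n) + real (N2 1 6 n) - real (N2 2 6 n) - real (N2 3 6 n) =
    Re (\<Sum>p | p \<in> NRO \<and> sum_mset p = n. zeta6 powi M2_rank p)"
proof -
  define X where "X = {p \<in> NRO. sum_mset p = n}"
  have finX: "finite X" using finite_NRO_sum by (simp add: X_def)
  have N2: "int (N2 s 6 n) = (\<Sum>p\<in>X. if M2_rank p mod 6 = s then 1 else 0)" if "0 \<le> s" "s < 6" for s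
  proof -
    have "{p \<in> partitions n. no_repeated_odd_parts p \<and> [M2_rank p = s] (mod int 6)} = {p \<in> X. M2_rank p mod 6 = s}"
      using that by (auto simp: X_def NRO_sum_eq_partitions Cong.cong_def)
    then show ?thesis
      using finX by (simp add: N2_def sum.If_cases Int_def)
  qed
  have "int (N2 0 6 n) + int (N2 1 6 n) - int (N2 2 6 n) - int (N2 3 6 n) = (\<Sum>p\<in>X. rank_weight (M2_rank p))"
    unfolding N2[of 0, simplified] N2[of 1, simplified] N2[of 2, simplified] N2[of 3, simplified]
      sum.distrib[symmetric] sum_subtractf[symmetric]
    by (intro sum.cong refl) (simp add: rank_weight_def)
  moreover have "2 * Re (\<Sum>p\<in>X. zeta6 powi M2_rank p) = real_of_int (2 * (\<Sum>p\<in>X. rank_weight (M2_rank p)))"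
  proof -
    have "2 * Re (\<Sum>p\<in>X. zeta6 powi M2_rank p) = (\<Sum>p\<in>X. real_of_int (rank_weight (M2_rank p) + rank_weight (- M2_rank p)))"
      by (simp add: Re_sum sum_distrib_left Re_zeta6_powi)
    also have "\<dots> = real_of_int ((\<Sum>p\<in>X. rank_weight (M2_rank p)) + (\<Sum>p\<in>X. rank_weight (- M2_rank p)))"
      by (simp add: sum.distrib)
    also have "(\<Sum>p\<in>X. rank_weight (- M2_rank p)) = (\<Sum>p\<in>X. rank_weight (M2_rank p))"
      using sum_rank_symmetric[of rank_weight n] by (simp add: X_def)
    finally show ?thesis by simp
  qed
  ultimately show ?thesis
    unfolding X_def by linarith
qed

subsection \<open>Comparison of coefficients\<close>

definition nonagon_root :: complex where
  "nonagon_root = cis (2 * pi / 9)"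

lemma nonagon_root_9: "nonagon_root ^ 9 = 1"
proof -
  have "nonagon_root ^ 9 = cis (real 9 * (2 * pi / 9))"
    unfolding nonagon_root_def by (rule Complex.DeMoivre)
  also have "real 9 * (2 * pi / 9) = 2 * pi" by simp
  finally show ?thesis by simp
qed

lemma nonagon_root_power_neq_1:
  assumes "\<not> 3 dvd N"
  shows "nonagon_root ^ (3 * N) \<noteq> 1"
proof -
  have "nonagon_root ^ 3 = omega"
  proof -
    have "nonagon_root ^ 3 = cis (real 3 * (2 * pi / 9))"
      unfolding nonagon_root_def by (rule Complex.DeMoivre)
    also have "real 3 * (2 * pi / 9) = 2 * pi / 3" by simp
    finally show ?thesis by (simp only: omega_def)
  qed
  then have "nonagon_root ^ (3 * N) = omega powi (int N)" by (simp add: power_mult)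
  also have "\<dots> = omega powi (int N mod 3)" by (rule omega_powi_mod3)
  finally have eq: "nonagon_root ^ (3 * N) = omega powi (int N mod 3)" .
  have "int N mod 3 = 1 \<or> int N mod 3 = 2" using assms by presburger
  then have "omega powi (int N mod 3) = omega \<or> omega powi (int N mod 3) = omega\<^sup>2" by auto
  moreover have "omega \<noteq> 1" "omega\<^sup>2 \<noteq> 1"
    unfolding omega_squared by (auto simp: omega_def complex_eq_iff cos_120)
  ultimately show ?thesis unfolding eq by metis
qed

text \<open>By \<open>rank_gf2_formula\<close> the difference \<open>G\<close> of the two generating
  functions is a function of \<open>z^9\<close>, so it is unchanged by \<open>nonagon_root\<close>.
  Since 3 does not divide \<open>N\<close>, the power \<open>3 * N\<close> of that root is not 1,
  and the coefficient at \<open>3 * N\<close> vanishes. The factor \<open>z\<close> in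
  \<open>G\<close> accounts for the weight \<open>3 * N - 1\<close>.\<close>

lemma rank_coefficient_formula:
  assumes "\<not> 3 dvd N" "N \<ge> 1"
  shows "(\<Sum>p | p \<in> NRO \<and> sum_mset p = 3 * N - 1. zeta6 powi M2_rank p) =
    (\<Sum>\<^sub>\<infinity>(p, k, d)\<in>{(p, k, d). p \<in> NRO \<and> k \<ge> 1 \<and> d \<ge> 1 \<and> 3 * sum_mset p + k * d = N}. of_int (chi12 d))"
proof -
  define I where "I = {p \<in> NRO. int (sum_mset p) mod 3 = 2}"
  define Q where "Q = NRO \<times> ({1..} \<times> {1..} :: (nat \<times> nat) set)"
  define s where "s = (\<lambda>(p :: nat multiset, (k :: nat, d)). of_int (chi12 d) :: complex)"
  define e where "e = (\<lambda>(p, (k, d)). 9 * sum_mset p + 3 * (k * d) :: nat)"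
  define c where "c n = infsum (\<lambda>p. zeta6 powi M2_rank p) {p \<in> I. sum_mset p + 1 = n} - infsum s {i \<in> Q. e i = n}" for n
  define G where "G z = z * rank_gf2 z - gf (z ^ 9) * (lambert12 1 (z ^ 3) + lambert12 5 (z ^ 3))" for z
  have "c (3 * N) = 0"
  proof (rule power_series_rotation_coeff[of "1 / 2" c G nonagon_root])
    fix z :: complex assume z: "z \<noteq> 0" "norm z < 1 / 2"
    have nrm: "norm (z ^ n) < 1 / 2" if "n \<ge> 1" for n
    proof -
      have "norm z ^ n \<le> norm z ^ 1"
        using z that by (intro power_decreasing) auto
      then show ?thesis using z by (simp add: norm_power)
    qed
    show "G (nonagon_root * z) = G z"
    proof -
      have w: "nonagon_root * z \<noteq> 0" "norm (nonagon_root * z) < 1 / 2"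
        using z by (auto simp: nonagon_root_def norm_mult)
      have "(nonagon_root * z) ^ 9 = z ^ 9" by (simp add: power_mult_distrib nonagon_root_9)
      then show ?thesis
        unfolding G_def rank_gf2_formula[OF z] rank_gf2_formula[OF w] by (simp only: distrib_left add_diff_cancel_left')
    qed
    have "((\<lambda>n. infsum (\<lambda>p. zeta6 powi M2_rank p) {p \<in> I. sum_mset p + 1 = n} * z ^ n) has_sum
      infsum (\<lambda>p. zeta6 powi M2_rank p * z ^ (sum_mset p + 1)) I) UNIV"
    proof (rule has_sum_power_fibres)
      have "(\<lambda>p. z * (zeta6 powi M2_rank p * z ^ sum_mset p)) summable_on I"
        using z by (intro summable_on_cmult_right summable_NRO[where B = 1]) (auto simp: I_def)
      then show "(\<lambda>p. zeta6 powi M2_rank p * z ^ (sum_mset p + 1)) summable_on I"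
        by (simp add: mult_ac)
    qed
    also have "infsum (\<lambda>p. zeta6 powi M2_rank p * z ^ (sum_mset p + 1)) I = z * rank_gf2 z"
      unfolding rank_gf2_def I_def[symmetric] infsum_cmult_right'[symmetric] power_int_of_nat
      by (intro infsum_cong) simp
    finally have h1: "((\<lambda>n. infsum (\<lambda>p. zeta6 powi M2_rank p) {p \<in> I. sum_mset p + 1 = n} * z ^ n) has_sum z * rank_gf2 z) UNIV" .
    let ?g = "\<lambda>p. (z ^ 9) ^ sum_mset p" and ?h = "\<lambda>(k, d). of_int (chi12 d) * (z ^ 3) ^ (k * d)"
    have smg: "?g summable_on NRO" using nrm by (intro summable_NRO_power) auto
    have smh: "?h summable_on {1..} \<times> {1..}"
      using nrm[of 3] z by (intro chi12_double_summable) auto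
    have eq: "s i * z ^ e i = (case i of (p, kd) \<Rightarrow> ?g p * ?h kd)" for i
      by (auto simp: s_def e_def power_add power_mult split: prod.splits)
    have "((\<lambda>n. infsum s {i \<in> Q. e i = n} * z ^ n) has_sum infsum (\<lambda>i. s i * z ^ e i) Q) UNIV"
      by (rule has_sum_power_fibres) (unfold eq Q_def, rule summable_on_complex_product[OF smg smh])
    also have "infsum (\<lambda>i. s i * z ^ e i) Q = gf (z ^ 9) * (lambert12 1 (z ^ 3) + lambert12 5 (z ^ 3))"
      unfolding eq Q_def infsum_complex_product[OF smg smh] gf_def
      using lambert12_eq_chi12[of "z ^ 3"] z nrm[of 3] by simp
    finally have h2: "((\<lambda>n. infsum s {i \<in> Q. e i = n} * z ^ n) has_sum gf (z ^ 9) * (lambert12 1 (z ^ 3) + lambert12 5 (z ^ 3))) UNIV" .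
    show "(\<lambda>n. c n * z ^ n) sums G z"
      using sums_diff[OF has_sum_imp_sums[OF h1] has_sum_imp_sums[OF h2]]
      by (simp add: c_def G_def left_diff_distrib)
  qed (use nonagon_root_power_neq_1[OF assms(1)] in \<open>auto simp: nonagon_root_def\<close>)
  then have "infsum (\<lambda>p. zeta6 powi M2_rank p) {p \<in> I. sum_mset p + 1 = 3 * N} = infsum s {i \<in> Q. e i = 3 * N}"
    by (simp add: c_def)
  moreover have "{p \<in> I. sum_mset p + 1 = 3 * N} = {p \<in> NRO. sum_mset p = 3 * N - 1}"
  proof -
    have "int x mod 3 = 2" if "x = 3 * N - 1" for x using that assms(2) by presburger
    then show ?thesis using assms(2) unfolding I_def by (auto simp del: of_nat_sum_mset)
  qed
  moreover have "{i \<in> Q. e i = 3 * N} = {(p, k, d). p \<in> NRO \<and> k \<ge> 1 \<and> d \<ge> 1 \<and> 3 * sum_mset p + k * d = N}"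
    by (auto simp: Q_def e_def)
  ultimately show ?thesis
    using finite_NRO_sum[of "3 * N - 1"] by (simp add: s_def)
qed

lemma chi12_factor_sum:
  assumes "m > 0"
  shows "(\<Sum>(k, d) | k \<ge> 1 \<and> d \<ge> 1 \<and> k * d = m. chi12 d) = (\<Sum>d | d dvd m. chi12 d)"
  by (rule sum.reindex_bij_witness[of _ "\<lambda>d. (m div d, d)" snd])
    (use assms in \<open>auto simp: Suc_le_eq dvd_div_eq_0_iff intro: dvd_pos_nat\<close>)

lemma rank_coefficient_pos:
  assumes "\<not> 3 dvd N"
  shows "Re (\<Sum>p | p \<in> NRO \<and> sum_mset p = 3 * N - 1. zeta6 powi M2_rank p) \<ge> 1"
proof -
  have N: "N \<ge> 1" using assms by (auto intro: Suc_leI gr0I)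
  define A where "A = {p \<in> NRO. 3 * sum_mset p < N}"
  define D where "D m = {(k, d). k \<ge> 1 \<and> d \<ge> 1 \<and> k * d = (m::nat)}" for m
  define T where "T = {(p, k, d). p \<in> NRO \<and> k \<ge> 1 \<and> d \<ge> 1 \<and> 3 * sum_mset p + k * d = N}"
  have T: "T = (SIGMA p:A. D (N - 3 * sum_mset p))"
    by (auto simp: T_def A_def D_def)
  have finA: "finite A"
  proof (rule finite_subset)
    show "A \<subseteq> (\<Union>n<N. {p \<in> NRO. sum_mset p = n})" by (auto simp: A_def)
  qed (use finite_NRO_sum in auto)
  have finD: "finite (D m)" if "m > 0" for m
  proof (rule finite_subset)
    have "k \<le> m \<and> d \<le> m" if "k * d = m" for k d
      using that \<open>m > 0\<close> by auto
    then show "D m \<subseteq> {..m} \<times> {..m}" by (auto simp: D_def)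
  qed auto
  have finT: "finite T"
    unfolding T using finA finD by (intro finite_SigmaI) (auto simp: A_def)
  define g where "g m = (\<Sum>d | d dvd m. chi12 d)" for m :: nat
  have "(\<Sum>(p, k, d)\<in>T. chi12 d) = (\<Sum>p\<in>A. \<Sum>(k, d)\<in>D (N - 3 * sum_mset p). chi12 d)"
    unfolding T using finA finD by (subst sum.Sigma) (auto simp: A_def)
  also have "\<dots> = (\<Sum>p\<in>A. g (N - 3 * sum_mset p))"
    unfolding D_def g_def by (intro sum.cong refl chi12_factor_sum) (simp add: A_def)
  finally have val: "(\<Sum>(p, k, d)\<in>T. chi12 d) = (\<Sum>p\<in>A. g (N - 3 * sum_mset p))" .
  \<comment> \<open>One positive summand suffices: for a partition of \<open>N div 3\<close> the
    remaining argument of \<open>g\<close> is 1 or 2, where the divisor sum is 1. The case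
    \<open>j = 0\<close> is separate because 0 is not a part.\<close>
  define j where "j = N div 3"
  define p0 where "p0 = (if j = 0 then {#} else {#j#})"
  have p0: "p0 \<in> NRO" "sum_mset p0 = j"
    by (auto simp: p0_def NRO_def no_repeated_odd_parts_def)
  have Nj: "N - 3 * j = 1 \<or> N - 3 * j = 2" "3 * j < N"
    using assms unfolding j_def by presburger+
  have "g 1 = 1" by (simp add: g_def chi12_def)
  moreover have "g 2 = 1"
  proof -
    have "{d::nat. d dvd 2} = {1, 2}"
      using prime_nat_iff two_is_prime_nat by auto
    then show ?thesis by (simp add: g_def chi12_def)
  qed
  ultimately have "1 = g (N - 3 * sum_mset p0)" using Nj p0 by auto
  also have "\<dots> \<le> (\<Sum>p\<in>A. g (N - 3 * sum_mset p))"
    using finA Nj p0 by (intro member_le_sum) (auto simp: A_def g_def intro!: chi12_divisor_sum_nonneg)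
  finally have ge: "(\<Sum>(p, k, d)\<in>T. chi12 d) \<ge> 1" unfolding val .
  have "(\<Sum>p | p \<in> NRO \<and> sum_mset p = 3 * N - 1. zeta6 powi M2_rank p) = (\<Sum>(p, k, d)\<in>T. of_int (chi12 d))"
    unfolding rank_coefficient_formula[OF assms N] T_def[symmetric] using finT by simp
  also have "\<dots> = of_int (\<Sum>(p, k, d)\<in>T. chi12 d)"
    by (simp add: case_prod_unfold)
  finally have "Re (\<Sum>p | p \<in> NRO \<and> sum_mset p = 3 * N - 1. zeta6 powi M2_rank p) = real_of_int (\<Sum>(p, k, d)\<in>T. chi12 d)"
    by simp
  then show ?thesis using ge by linarith
qed

lemma N2_inequality:
  assumes "\<not> 3 dvd N"
  shows "N2 0 6 (3 * N - 1) + N2 1 6 (3 * N - 1) > N2 2 6 (3 * N - 1) + N2 3 6 (3 * N - 1)"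
  using rank_coefficient_pos[OF assms] N2_difference[of "3 * N - 1"] by linarith

theorem theorem1p2:
  shows "(\<forall>n::nat. N2 0 6 (9 * n + 2) + N2 1 6 (9 * n + 2) > N2 2 6 (9 * n + 2) + N2 3 6 (9 * n + 2))
    \<and> (\<forall>n::nat. N2 0 6 (9 * n + 5) + N2 1 6 (9 * n + 5) > N2 2 6 (9 * n + 5) + N2 3 6 (9 * n + 5))
    \<and> (\<forall>n::nat. \<not> 3 dvd (n + 1) \<longrightarrow>
         N2 0 6 (3 * n + 2) + N2 1 6 (3 * n + 2) > N2 2 6 (3 * n + 2) + N2 3 6 (3 * n + 2))"
proof (intro conjI allI impI)
  fix n :: nat
  have "\<not> 3 dvd 3 * n + 1" "\<not> 3 dvd 3 * n + 2" by presburger+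
  moreover have "3 * (3 * n + 1) - 1 = 9 * n + 2" "3 * (3 * n + 2) - 1 = 9 * n + 5" by simp_all
  ultimately show "N2 0 6 (9 * n + 2) + N2 1 6 (9 * n + 2) > N2 2 6 (9 * n + 2) + N2 3 6 (9 * n + 2)"
    and "N2 0 6 (9 * n + 5) + N2 1 6 (9 * n + 5) > N2 2 6 (9 * n + 5) + N2 3 6 (9 * n + 5)"
    using N2_inequality[of "3 * n + 1"] N2_inequality[of "3 * n + 2"] by metis+
next
  fix n :: nat assume "\<not> 3 dvd (n + 1)"
  moreover have "3 * (n + 1) - 1 = 3 * n + 2" by simp
  ultimately show "N2 0 6 (3 * n + 2) + N2 1 6 (3 * n + 2) > N2 2 6 (3 * n + 2) + N2 3 6 (3 * n + 2)"
    using N2_inequality[of "n + 1"] by simp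
qed

end
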